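(* Let $k\ge 1$ and let $r=r_1\cdots r_k$ with integers $r_i\ge 3$. Let $P(r,2k)=P_{r_1}\times\cdots\times P_{r_k}$ and $P(2r,2k+1)=P_{r_1}\times\cdots\times P_{r_k}\times P_2$. Then $$N_{P(r,2k)}\le T(r,2k)-2k\quad\text{and}\quad N_{P(2r,2k+1)}\le T(2r,2k+1)-2k-1.$$ Moreover: (a) Let $S$ be a set of $T(r,2k)-2k$ generic points in $\mathbb{R}^{2k}$. For any decomposition of $\mathbb{R}^{2k}$ by $k$ pairwise orthogonal coordinate planes $U_1,\dots,U_k$, there exists a $P(r,2k)$-partition of $S$ such that $P_{r_i}$ is parallel to $U_i$ for all $1\le i\le k$. (b) Let $S$ be a set of $T(2r,2k+1)-2k-1$ generic points in $\mathbb{R}^{2k+1}$. For any $k$ pairwise orthogonal coordinate planes $U_1,\dots,U_k$ in $\mathbb{R}^{2k+1}$, there exists a $P(2r,2k+1)$-partition of $S$ such that $P_{r_i}$ is parallel to $U_i$ for all $1\le i\le k$.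
   Context: $T(r,d):=(r-1)(d+1)+1$. A coordinate plane (line) of $\mathbb{R}^D$ is the span of two distinct (one) standard basis vectors. **Multiprisms.** $P(r,2k)=P_{r_1}\times\cdots\times P_{r_k}$ denotes a Cartesian product, in $\mathbb{R}^{2k}$, of $k$ pairwise orthogonal two-dimensional (non-degenerate) regular $r_i$-gons $P_{r_i}$; the sizes of the factors are arbitrary. Its vertex set is $\{a_1+\cdots+a_k: a_i\in V_i\}$, where $V_i$ is the vertex set of a regular $r_i$-gon in a 2-dimensional linear subspace $W_i$ and $W_1,\dots,W_k$ are pairwise orthogonal (polygons need not be centred at $0$). $P_{r_i}$ is parallel to $U_i$ if $W_i=U_i$. Similarly $P(2r,2k+1)=P_{r_1}\times\cdots\times P_{r_k}\times P_2$ in $\mathbb{R}^{2k+1}$ is the pairwise orthogonal product with an additional non-degenerate line segment $P_2$ lying along the line orthogonal to $W_1\oplus\cdots\oplus W_k$. **Partitions.** For $P$ one of these types of polytope in $\mathbb{R}^D$, with $q$ vertices ($q=r$ or $q=2r$), a $P$-partition of a finite set $S\subset\mathbb{R}^D$ is a partition of $S$ into $q$ pairwise disjoint sets $A_1,\dots,A_q$ for which there are points $x_j\in\mathrm{Conv}(A_j)$, $1\le j\le q$, such that $x_1,\dots,x_q$ are the vertices of a polytope of type $P$. $N_P$ is the minimum $N$ such that almost any $N$ points in $\mathbb{R}^D$ (Lebesgue-almost every $N$-tuple) admit a $P$-partition. **Genericity.** A set $S$ of $N$ points in $\mathbb{R}^D$ is generic if the affine map $\Delta_{N-1}\to\mathbb{R}^D$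 sending the vertices of the $(N-1)$-simplex bijectively to $S$ is Fourier generic, as follows. Let $G=\mathbb{Z}_{q_1}\oplus\cdots\oplus\mathbb{Z}_{q_l}$ ($q_j\ge2$), with characters $\chi_h(g)=\prod_{j=1}^l\zeta_{q_j}^{h_jg_j}$, $\zeta_q=e^{2\pi i/q}$, for $g,h\in G$. For a map $F=(F_1,\dots,F_{d+d'}):\Delta_n\to\mathbb{C}^d\oplus\mathbb{R}^{d'}$ and points $\{x_g\}_{g\in G}\subset\Delta_n$, the Fourier coefficients are $c_{i,h}=\frac1{|G|}\sum_{g\in G}F_i(x_g)\chi_h(g)^{-1}$. Points have pairwise disjoint support if they lie in pairwise disjoint faces. An admissible choice is a family $S_i\subseteq G\setminus\{0\}$, $1\le i\le d+d'$, such that for each $i>d$, writing $T_i=\{h\in S_i: h\text{ has order }2\}$, one has $-h\notin S_i$ whenever $h\in S_i\setminus T_i$; put $m=\sum_{i=1}^{d+d'}|S_i|$ and $m'=\sum_{i=d+1}^{d+d'}|T_i|$. A map $f:\Delta_M\to\mathbb{R}^D$ is Fourier generic if for every such group $G$, every decomposition $\mathbb{R}^D=\bigoplus_{i=1}^dU_i\oplus\bigoplus_{j=1}^{d'}L_j$ ($D=2d+d'$, $d,d'\ge0$, $d+d'\ge1$) into pairwise orthogonal coordinate planes $U_i$ and coordinate lines $L_j$, with $\sigma:\mathbb{R}^D\to\mathbb{C}^d\oplus\mathbb{R}^{d'}$ a coordinate permutation sending $U_i$ to the $i$-th complex coordinate plane and $L_j$ to the $j$-th real coordinate line, every admissible choice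 of the $S_i$, and every face $\Delta_n$ of $\Delta_M$ with $n<2m-m'+|G|-1$, there is no $\{x_g\}_{g\in G}\subset\Delta_n$ with pairwise disjoint support for which all Fourier coefficients $c_{i,h}$ of $(\sigma\circ f)|_{\Delta_n}$ with $h\in S_i$, $1\le i\le d+d'$, vanish. *)

theory Defs
  imports
    "HOL-Analysis.Analysis"
    "HOL-Library.Extended_Nat"
    "HOL-Algebra.Multiplicative_Group"
    "HOL-Algebra.Product_Groups"
    "HOL-Homology.Simplices"
begin

definition tverberg_number :: "nat \<Rightarrow> nat \<Rightarrow> nat" where
  "tverberg_number r d = (r - 1) * (d + 1) + 1"

definition coordinate_plane :: "(real ^ 'n) set \<Rightarrow> bool" where
  "coordinate_plane U \<longleftrightarrow> (\<exists>a b. a \<noteq> b \<and> U = span {axis a 1, axis b 1})"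

definition coordinate_line :: "(real ^ 'n) set \<Rightarrow> bool" where
  "coordinate_line L \<longleftrightarrow> (\<exists>a. L = span {axis a 1})"

definition pairwise_orthogonal :: "nat \<Rightarrow> (nat \<Rightarrow> ('a :: real_inner) set) \<Rightarrow> bool" where
  "pairwise_orthogonal k W \<longleftrightarrow>
     (\<forall>i<k. \<forall>j<k. i \<noteq> j \<longrightarrow> (\<forall>u\<in>W i. \<forall>v\<in>W j. orthogonal u v))"

text \<open>Polytopes are represented by their vertex sets. A type of polytope is a set of vertex sets.
  Families are indexed by \<open>i < k\<close> rather than \<open>1, \<dots>, k\<close>.\<close>

definition regular_polygon :: "nat \<Rightarrow> (real ^ 'n) set \<Rightarrow> (real ^ 'n) set \<Rightarrow> bool" where
  "regular_polygon r W V \<longleftrightarrow>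
     subspace W \<and> dim W = 2 \<and>
     (\<exists>c u v. c \<in> W \<and> u \<in> W \<and> v \<in> W \<and> orthogonal u v \<and> norm u = norm v \<and> u \<noteq> 0 \<and>
        V = {c + cos (2 * pi * real j / real r) *\<^sub>R u + sin (2 * pi * real j / real r) *\<^sub>R v
               | j. j < r})"

definition multiprisms_parallel ::
    "nat \<Rightarrow> (nat \<Rightarrow> nat) \<Rightarrow> (nat \<Rightarrow> (real ^ 'n) set) \<Rightarrow> (real ^ 'n) set set" where
  "multiprisms_parallel k r W =
     {X. pairwise_orthogonal k W \<and>
         (\<exists>V. (\<forall>i<k. regular_polygon (r i) (W i) (V i)) \<and>
              X = {(\<Sum>i<k. a i) | a. \<forall>i<k. a i \<in> V i})}"

text \<open>The factor \<open>P\<^sub>2\<close> is a segment with end points \<open>s \<noteq> t\<close> in the orthogonal complement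
  of \<open>W\<^sub>1 \<oplus> \<dots> \<oplus> W\<^sub>k\<close>. In dimension \<open>2k + 1\<close> this complement is a line.\<close>

definition segment_multiprisms_parallel ::
    "nat \<Rightarrow> (nat \<Rightarrow> nat) \<Rightarrow> (nat \<Rightarrow> (real ^ 'n) set) \<Rightarrow> (real ^ 'n) set set" where
  "segment_multiprisms_parallel k r W =
     {Y. \<exists>X s t. X \<in> multiprisms_parallel k r W \<and> s \<noteq> t \<and>
           s \<in> orthogonal_comp (\<Union>i<k. W i) \<and> t \<in> orthogonal_comp (\<Union>i<k. W i) \<and>
           Y = {x + y | x y. x \<in> X \<and> y \<in> {s, t}}}"

definition multiprisms :: "nat \<Rightarrow> (nat \<Rightarrow> nat) \<Rightarrow> (real ^ 'n) set set" where
  "multiprisms k r = (\<Union>W. multiprisms_parallel k r W)"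

definition segment_multiprisms :: "nat \<Rightarrow> (nat \<Rightarrow> nat) \<Rightarrow> (real ^ 'n) set set" where
  "segment_multiprisms k r = (\<Union>W. segment_multiprisms_parallel k r W)"

definition polytope_partition ::
    "(real ^ 'n) set set \<Rightarrow> nat \<Rightarrow> (real ^ 'n) set \<Rightarrow> (nat \<Rightarrow> (real ^ 'n) set) \<Rightarrow> bool" where
  "polytope_partition P q S A \<longleftrightarrow>
     disjoint_family_on A {..<q} \<and> (\<Union>j<q. A j) = S \<and>
     (\<exists>x. (\<forall>j<q. x j \<in> convex hull A j) \<and> (\<exists>V\<in>P. bij_betw x {..<q} V))"

text \<open>The value is \<open>\<infinity>\<close> if no number of points suffices.\<close>

definition partition_number :: "(real ^ 'n) set set \<Rightarrow> nat \<Rightarrow> enat" where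
  "partition_number P q =
     Inf {enat N | N.
       AE X in (\<Pi>\<^sub>M i\<in>{..<N}. (lborel :: (real ^ 'n) measure)).
         \<exists>A. polytope_partition P q (X ` {..<N}) A}"

definition cyclic_sum :: "nat \<Rightarrow> (nat \<Rightarrow> nat) \<Rightarrow> (nat \<Rightarrow> int) monoid" where
  "cyclic_sum l q = product_group {..<l} (\<lambda>j. integer_mod_group (q j))"

definition group_character ::
    "nat \<Rightarrow> (nat \<Rightarrow> nat) \<Rightarrow> (nat \<Rightarrow> int) \<Rightarrow> (nat \<Rightarrow> int) \<Rightarrow> complex" where
  "group_character l q h g = (\<Prod>j<l. cis (2 * pi / real (q j)) powi (h j * g j))"

definition fourier_coefficient ::
    "nat \<Rightarrow> (nat \<Rightarrow> nat) \<Rightarrow> ('p \<Rightarrow> complex) \<Rightarrow> ((nat \<Rightarrow> int) \<Rightarrow> 'p) \<Rightarrow> (nat \<Rightarrow> int) \<Rightarrow> complex" where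
  "fourier_coefficient l q F x h =
     1 / of_nat (card (carrier (cyclic_sum l q))) *
     (\<Sum>g\<in>carrier (cyclic_sum l q). F (x g) * inverse (group_character l q h g))"

definition order_two :: "('g, 'm) monoid_scheme \<Rightarrow> 'g set \<Rightarrow> 'g set" where
  "order_two G A = {h \<in> A. group.ord G h = 2}"

text \<open>The library groups are multiplicative, so the unit stands for \<open>0\<close> and the inverse for \<open>-h\<close>.
  The indices \<open>i < d\<close> belong to the complex coordinates and \<open>d \<le> i < d + d'\<close> to the real ones.\<close>

definition admissible_choice ::
    "('g, 'm) monoid_scheme \<Rightarrow> nat \<Rightarrow> nat \<Rightarrow> (nat \<Rightarrow> 'g set) \<Rightarrow> bool" where
  "admissible_choice G d d' S \<longleftrightarrow>
     (\<forall>i<d + d'. S i \<subseteq> carrier G - {\<one>\<^bsub>G\<^esub>}) \<and>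
     (\<forall>i\<in>{d..<d + d'}. \<forall>h \<in> S i - order_two G (S i). inv\<^bsub>G\<^esub> h \<notin> S i)"

definition simplex_face :: "nat \<Rightarrow> nat set \<Rightarrow> (nat \<Rightarrow> real) set" where
  "simplex_face M I = {x \<in> standard_simplex M. \<forall>j. j \<notin> I \<longrightarrow> x j = 0}"

definition pairwise_disjoint_support ::
    "nat \<Rightarrow> 'g set \<Rightarrow> ('g \<Rightarrow> nat \<Rightarrow> real) \<Rightarrow> bool" where
  "pairwise_disjoint_support M A x \<longleftrightarrow>
     (\<exists>J. (\<forall>g\<in>A. J g \<subseteq> {..M} \<and> x g \<in> simplex_face M (J g)) \<and>
          disjoint_family_on (\<lambda>g. simplex_face M (J g)) A)"

text \<open>One family \<open>B\<close> lists the planes \<open>U\<^sub>1, \<dots>, U\<^sub>d\<close> (at \<open>i < d\<close>) followed by the lines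
  \<open>L\<^sub>1, \<dots>, L\<^sub>d\<^sub>'\<close> (at \<open>d \<le> i < d + d'\<close>).\<close>

definition coordinate_decomposition ::
    "nat \<Rightarrow> nat \<Rightarrow> (nat \<Rightarrow> (real ^ 'n) set) \<Rightarrow> bool" where
  "coordinate_decomposition d d' B \<longleftrightarrow>
     CARD('n) = 2 * d + d' \<and>
     (\<forall>i<d. coordinate_plane (B i)) \<and>
     (\<forall>i\<in>{d..<d + d'}. coordinate_line (B i)) \<and>
     pairwise_orthogonal (d + d') B \<and>
     span (\<Union>i<d + d'. B i) = UNIV"

text \<open>The components \<open>\<sigma> i\<close> of a coordinate permutation \<open>\<real>\<^sup>D \<rightarrow> \<complex>\<^sup>d \<oplus> \<real>\<^sup>d\<^sup>'\<close> that carries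
  each \<open>B i\<close> to the \<open>i\<close>-th coordinate plane or line. Either order of the two real coordinates of
  a plane is allowed. Real components are viewed in the complex numbers.\<close>

definition coordinate_permutation ::
    "nat \<Rightarrow> nat \<Rightarrow> (nat \<Rightarrow> (real ^ 'n) set) \<Rightarrow> (nat \<Rightarrow> real ^ 'n \<Rightarrow> complex) \<Rightarrow> bool" where
  "coordinate_permutation d d' B \<sigma> \<longleftrightarrow>
     (\<forall>i<d. \<exists>a b. a \<noteq> b \<and> B i = span {axis a 1, axis b 1} \<and>
        \<sigma> i = (\<lambda>y. Complex (y $ a) (y $ b))) \<and>
     (\<forall>i\<in>{d..<d + d'}. \<exists>a. B i = span {axis a 1} \<and> \<sigma> i = (\<lambda>y. complex_of_real (y $ a)))"

definition fourier_generic :: "nat \<Rightarrow> ((nat \<Rightarrow> real) \<Rightarrow> real ^ 'n) \<Rightarrow> bool" where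
  "fourier_generic M f \<longleftrightarrow>
     (\<forall>l q d d' B \<sigma> S I n m m'.
        (\<forall>j<l. q j \<ge> 2) \<and>
        d + d' \<ge> 1 \<and>
        coordinate_decomposition d d' B \<and>
        coordinate_permutation d d' B \<sigma> \<and>
        admissible_choice (cyclic_sum l q) d d' S \<and>
        m = (\<Sum>i<d + d'. card (S i)) \<and>
        m' = (\<Sum>i\<in>{d..<d + d'}. card (order_two (cyclic_sum l q) (S i))) \<and>
        I \<subseteq> {..M} \<and> card I = n + 1 \<and>
        int n < 2 * int m - int m' + int (card (carrier (cyclic_sum l q))) - 1
        \<longrightarrow>
        \<not> (\<exists>x. (\<forall>g\<in>carrier (cyclic_sum l q). x g \<in> simplex_face M I) \<and>
              pairwise_disjoint_support M (carrier (cyclic_sum l q)) x \<and>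
              (\<forall>i<d + d'. \<forall>h\<in>S i. fourier_coefficient l q (\<sigma> i \<circ> f) x h = 0)))"

text \<open>Fourier genericity is invariant under relabelling the vertices of the simplex, so it does not
  matter which enumeration \<open>v\<close> of the points is used.\<close>

definition generic_points :: "(real ^ 'n) set \<Rightarrow> bool" where
  "generic_points S \<longleftrightarrow>
     (\<exists>M v. bij_betw v {..M} S \<and> fourier_generic M (\<lambda>w. \<Sum>j\<le>M. w j *\<^sub>R v j))"

end

theory Submission
  imports Defs "Jordan_Normal_Form.Determinant"
begin

text \<open>
  Let \<open>G\<close> be the product of the cyclic groups of orders \<open>r\<^sub>i\<close>, with a factor of order two for
  the segment. Points \<open>x\<^sub>g\<close> are the vertices of a multiprism as soon as the component of
  \<open>g \<mapsto> x\<^sub>g\<close> in the \<open>i\<close>-th plane is \<open>C\<^sub>0 + C\<^sub>1 \<zeta>\<^bsup>g\<^sub>i\<^esup>\<close> with \<open>C\<^sub>1 \<noteq> 0\<close>. The shape of this function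
  is a system of real linear equations in the \<open>x\<^sub>g\<close> satisfied by constant functions. So Sarkaria's
  trick applies: for each given point the \<open>G\<close>-many vectors describing its placement into the classes
  sum to zero, and Barany's colourful Caratheodory theorem yields classes and weights that solve the system.
  The number of points is exactly one more than the number of equations.

  If some \<open>C\<^sub>1\<close> vanishes, additional Fourier coefficients vanish, which genericity forbids. For almost
  every point set the same is excluded as follows. With one additional equation the system has more rows than
  columns, so some functional annihilates all columns. Translating each class of points by its own vector is a
  shear of the columns: it preserves their rank but changes the pairing of the functional with the right hand
  side. Hence the system is unsolvable at some configuration of maximal rank, which is witnessed by a
  nonvanishing determinant that is affine in each single point and hence nonzero almost everywhere.
\<close>

section \<open>Linear algebra over a finite set of coordinates\<close>

text \<open>Let D be the dimension and n the order of \<open>G\<close>. Two values of each component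
  are free, so the shape costs n - 2 real equations per real coordinate; equal class weights cost n
  - 1 more. This gives D (n - 2) + n - 1 equations, hence D (n - 2) + n = T(n, D) - D points. The
  segment fits the same scheme: on a factor of order two every function has the form C0 + C1 (-1)^s.
  The obstacle is that the existence argument gives no control over which solution it finds, and C1
  = 0 satisfies the system as well. Nondegeneracy is therefore a statement about all solutions. The
  labelling is unknown beforehand, so it is proved for each of the finitely many labellings and for
  arbitrary real weights, which makes it pure linear algebra. In the almost-everywhere argument only
  one real coordinate of the difference of two vertices is set to zero, so a single equation is
  added and the system becomes overdetermined by exactly enough. Overdetermination alone does not
  give unsolvability at a particular configuration, and independence of a subfamily of columns and
  the right hand side does not exclude help from the remaining columns; maximal rank closes this
  gap.\<close>

lemma homogeneous_system_nontrivial: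
  fixes u :: "'j \<Rightarrow> 'i \<Rightarrow> real"
  assumes "finite I" "finite J" "card I < card J"
  shows "\<exists>s. (\<exists>j\<in>J. s j \<noteq> 0) \<and> (\<forall>i\<in>I. (\<Sum>j\<in>J. s j * u j i) = 0)"
  using assms
proof (induction I arbitrary: J u rule: finite_induct)
  case empty
  then obtain j where "j \<in> J"
    by (metis card.empty less_numeral_extra(3) all_not_in_conv)
  then show ?case
    by (intro exI[of _ "\<lambda>_. 1"]) auto
next
  case (insert i0 I)
  show ?case
  proof (cases "\<forall>j\<in>J. u j i0 = 0")
    case True
    obtain s where "\<exists>j\<in>J. s j \<noteq> 0" "\<forall>i\<in>I. (\<Sum>j\<in>J. s j * u j i) = 0"
      using insert.IH[of J u] insert.prems insert.hyps by auto
    then show ?thesis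
      using True by (intro exI[of _ s]) auto
  next
    case False
    then obtain j0 where j0: "j0 \<in> J" "u j0 i0 \<noteq> 0"
      by blast
    define J' where "J' = J - {j0}"
    have J': "finite J'" "card I < card J'" "j0 \<notin> J'" "J = insert j0 J'"
      using insert.prems insert.hyps j0 by (auto simp: J'_def)
    obtain s where s: "\<exists>j\<in>J'. s j \<noteq> 0"
      "\<forall>i\<in>I. (\<Sum>j\<in>J'. s j * (u j i - u j i0 / u j0 i0 * u j0 i)) = 0"
      using insert.IH[OF J'(1,2), of "\<lambda>j i. u j i - u j i0 / u j0 i0 * u j0 i"] by blast
    \<comment> \<open>The pivot unknown \<open>j0\<close> has been eliminated from the other
      equations, so its value is the one that equation \<open>i0\<close> forces.\<close>
    define s0 where "s0 = - (\<Sum>j\<in>J'. s j * u j i0) / u j0 i0"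
    have *: "(\<Sum>j\<in>J. (s(j0 := s0)) j * u j i) = (\<Sum>j\<in>J'. s j * u j i) + s0 * u j0 i" for i
      using J' by (simp add: sum.insert algebra_simps cong: sum.cong)
         (intro sum.cong, auto)
    have "(\<Sum>j\<in>J. (s(j0 := s0)) j * u j i) = 0" if "i \<in> insert i0 I" for i
    proof (cases "i = i0")
      case True
      then show ?thesis unfolding * by (simp add: s0_def j0)
    next
      case False
      then have "0 = (\<Sum>j\<in>J'. s j * (u j i - u j i0 / u j0 i0 * u j0 i))"
        using s(2) that by simp
      also have "\<dots> = (\<Sum>j\<in>J'. s j * u j i) - (\<Sum>j\<in>J'. (s j * u j i0) * (u j0 i / u j0 i0))"
        by (simp add: algebra_simps flip: sum_subtractf)
      also have "\<dots> = (\<Sum>j\<in>J'. s j * u j i) + s0 * u j0 i"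
        unfolding sum_distrib_right[symmetric] by (simp add: s0_def)
      finally show ?thesis unfolding * by simp
    qed
    moreover have "\<exists>j\<in>J. (s(j0 := s0)) j \<noteq> 0"
      using s(1) J' by (metis fun_upd_other insertCI)
    ultimately show ?thesis
      by blast
  qed
qed

definition in_span :: "'i set \<Rightarrow> 'j set \<Rightarrow> ('j \<Rightarrow> 'i \<Rightarrow> real) \<Rightarrow> ('i \<Rightarrow> real) \<Rightarrow> bool" where
  "in_span I J u b \<longleftrightarrow> (\<exists>t. \<forall>i\<in>I. b i = (\<Sum>j\<in>J. t j * u j i))"

text \<open>The family is indexed, so a repeated vector counts as dependent. This suits columns
  labelled by points: the index set stays fixed while the points move.\<close>

definition lin_indep :: "'i set \<Rightarrow> 'j set \<Rightarrow> ('j \<Rightarrow> 'i \<Rightarrow> real) \<Rightarrow> bool" where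
  "lin_indep I J u \<longleftrightarrow>
     (\<forall>t. (\<forall>i\<in>I. (\<Sum>j\<in>J. t j * u j i) = 0) \<longrightarrow> (\<forall>j\<in>J. t j = 0))"

text \<open>Induction on the spanning family: a vector already spanned by the others is annihilated
  automatically, and a new one is projected away.\<close>

lemma separating_functional:
  fixes u :: "'j \<Rightarrow> 'i \<Rightarrow> real"
  assumes "finite I" "finite J" "\<not> in_span I J u b"
  shows "\<exists>y. (\<forall>j\<in>J. (\<Sum>i\<in>I. y i * u j i) = 0) \<and> (\<Sum>i\<in>I. y i * b i) = 1"
  using assms(2,3)
proof (induction J arbitrary: b rule: finite_induct)
  case empty
  then obtain i where i: "i \<in> I" "b i \<noteq> 0"
    by (auto simp: in_span_def)
  then show ?case
    using assms(1)
    by (intro exI[of _ "\<lambda>i'. if i' = i then 1 / b i else 0"])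
       (auto simp: if_distrib[of "\<lambda>x. x * _"] sum.delta cong: if_cong)
next
  case (insert j J)
  define pr where "pr y v = (\<Sum>i\<in>I. y i * v i)" for y v :: "'i \<Rightarrow> real"
  have mono: "in_span I (insert j J) u b" if sp: "in_span I J u (\<lambda>i. b i - c * u j i)" for c
  proof -
    obtain t where "\<forall>i\<in>I. b i - c * u j i = (\<Sum>k\<in>J. t k * u k i)"
      using sp unfolding in_span_def by blast
    moreover have "(\<Sum>k\<in>J. (t(j := c)) k * u k i) = (\<Sum>k\<in>J. t k * u k i)" for i
      using insert.hyps by (intro sum.cong) auto
    ultimately show ?thesis
      unfolding in_span_def using insert.hyps
      by (intro exI[of _ "t(j := c)"]) (auto simp: algebra_simps)
  qed
  show ?case
  proof (cases "in_span I J u (u j)")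
    case True
    obtain y where y: "\<forall>k\<in>J. pr y (u k) = 0" "pr y b = 1"
      using insert.IH[of b] mono[of 0] insert.prems unfolding pr_def by auto
    obtain t where t: "\<forall>i\<in>I. u j i = (\<Sum>k\<in>J. t k * u k i)"
      using True by (auto simp: in_span_def)
    have "pr y (u j) = (\<Sum>i\<in>I. \<Sum>k\<in>J. t k * (y i * u k i))"
      unfolding pr_def using t by (intro sum.cong) (auto simp: sum_distrib_left algebra_simps)
    also have "\<dots> = (\<Sum>k\<in>J. t k * pr y (u k))"
      unfolding pr_def by (subst sum.swap) (simp add: sum_distrib_left)
    finally show ?thesis
      using y unfolding pr_def by auto
  next
    case False
    obtain z where z: "\<forall>k\<in>J. pr z (u k) = 0" "pr z (u j) = 1"
      using insert.IH[OF False] unfolding pr_def by auto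
    \<comment> \<open>As \<open>pr z (u j) = 1\<close>, this vector is the part of \<open>b\<close>
      that \<open>z\<close> annihilates. The functional \<open>y\<close> found for it is corrected
      by a multiple of \<open>z\<close> so that it annihilates \<open>u j\<close> too; its value on
      \<open>b\<close> is then 1.\<close>
    have "\<not> in_span I J u (\<lambda>i. b i - pr z b * u j i)"
      using mono insert.prems by blast
    from insert.IH[OF this]
    obtain y where y: "\<forall>k\<in>J. pr y (u k) = 0" "pr y (\<lambda>i. b i - pr z b * u j i) = 1"
      unfolding pr_def by blast
    have lin: "pr (\<lambda>i. y i - c * z i) v = pr y v - c * pr z v" for c v
      by (simp add: pr_def algebra_simps sum_subtractf sum_distrib_left)
    have "pr y b - pr z b * pr y (u j) = 1"
      using y(2) by (simp add: pr_def algebra_simps sum_subtractf sum_distrib_left)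
    then have "(\<forall>k\<in>insert j J. pr (\<lambda>i. y i - pr y (u j) * z i) (u k) = 0) \<and>
        pr (\<lambda>i. y i - pr y (u j) * z i) b = 1"
      using y z by (auto simp only: lin) (simp_all add: mult.commute)
    then show ?thesis
      unfolding pr_def by (intro exI[of _ "\<lambda>i. y i - (\<Sum>i\<in>I. y i * u j i) * z i"])
  qed
qed

lemma lin_indep_insert:
  assumes "finite J" "j \<notin> J" "lin_indep I J u" "\<not> in_span I J u (u j)"
  shows "lin_indep I (insert j J) u"
  unfolding lin_indep_def
proof (intro allI impI)
  fix t assume "\<forall>i\<in>I. (\<Sum>k\<in>insert j J. t k * u k i) = 0"
  then have t: "\<forall>i\<in>I. t j * u j i + (\<Sum>k\<in>J. t k * u k i) = 0"
    using assms by simp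
  have "t j = 0"
  proof (rule ccontr)
    assume "t j \<noteq> 0"
    have "u j i = (\<Sum>k\<in>J. (- t k / t j) * u k i)" if "i \<in> I" for i
    proof -
      have "(\<Sum>k\<in>J. (- t k / t j) * u k i) = (\<Sum>k\<in>J. (t k * u k i) * (- 1 / t j))"
        by (intro sum.cong) auto
      also have "\<dots> = (\<Sum>k\<in>J. t k * u k i) * (- 1 / t j)"
        by (simp only: sum_distrib_right)
      also have "\<dots> = u j i"
        using t that \<open>t j \<noteq> 0\<close> by (auto simp: field_simps add_eq_0_iff)
      finally show ?thesis by simp
    qed
    then have "in_span I J u (u j)"
      unfolding in_span_def by (intro exI[of _ "\<lambda>k. - t k / t j"]) blast
    then show False using assms by blast
  qed
  then show "\<forall>j\<in>insert j J. t j = 0"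
    using t assms(3) by (auto simp: lin_indep_def)
qed

lemma lin_indep_not_in_span:
  assumes "finite J" "lin_indep I J u" "k \<in> J"
  shows "\<not> in_span I (J - {k}) u (u k)"
proof
  assume "in_span I (J - {k}) u (u k)"
  then obtain t where t: "\<forall>i\<in>I. u k i = (\<Sum>j\<in>J - {k}. t j * u j i)"
    by (auto simp: in_span_def)
  have "(\<Sum>j\<in>J. (t(k := - 1)) j * u j i) = 0" if "i \<in> I" for i
  proof -
    have "(\<Sum>j\<in>J. (t(k := - 1)) j * u j i) = - u k i + (\<Sum>j\<in>J - {k}. (t(k := - 1)) j * u j i)"
      using assms by (subst sum.remove[of _ k]) auto
    also have "(\<Sum>j\<in>J - {k}. (t(k := - 1)) j * u j i) = (\<Sum>j\<in>J - {k}. t j * u j i)"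
      by (intro sum.cong) auto
    finally show ?thesis using t that by simp
  qed
  then have "(t(k := - 1)) k = 0"
    using assms unfolding lin_indep_def by blast
  then show False by simp
qed

lemma in_span_trans:
  assumes "in_span I J u b" "\<And>j. j \<in> J \<Longrightarrow> in_span I C u (u j)"
  shows "in_span I C u b"
proof -
  obtain t where t: "\<forall>i\<in>I. b i = (\<Sum>j\<in>J. t j * u j i)"
    using assms by (auto simp: in_span_def)
  obtain s where s: "\<And>j. j \<in> J \<Longrightarrow> \<forall>i\<in>I. u j i = (\<Sum>k\<in>C. s j k * u k i)"
    using assms(2) unfolding in_span_def by metis
  have "b i = (\<Sum>k\<in>C. (\<Sum>j\<in>J. t j * s j k) * u k i)" if "i \<in> I" for i
  proof -
    have "b i = (\<Sum>j\<in>J. \<Sum>k\<in>C. t j * s j k * u k i)"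
      using t s that by (simp add: sum_distrib_left mult.assoc)
    also have "\<dots> = (\<Sum>k\<in>C. (\<Sum>j\<in>J. t j * s j k) * u k i)"
      by (subst sum.swap) (simp add: sum_distrib_right)
    finally show ?thesis .
  qed
  then show ?thesis
    unfolding in_span_def by (intro exI[of _ "\<lambda>k. \<Sum>j\<in>J. t j * s j k"]) blast
qed

text \<open>Each vector is separated from the span of the others. Pairing with the dual family gives
  an identity matrix, which is how independence becomes a nonzero determinant in
  \<open>AE_not_in_span\<close>.\<close>

lemma dual_family:
  fixes u :: "'j \<Rightarrow> 'i \<Rightarrow> real"
  assumes "finite I" "finite J" "lin_indep I J u"
  shows "\<exists>y. \<forall>k\<in>J. \<forall>j\<in>J. (\<Sum>i\<in>I. y k i * u j i) = (if j = k then 1 else 0)"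
proof -
  have "\<exists>y. \<forall>j\<in>J. (\<Sum>i\<in>I. y i * u j i) = (if j = k then 1 else 0)" if "k \<in> J" for k
  proof -
    have "finite (J - {k})" using assms(2) by simp
    from separating_functional[OF assms(1) this lin_indep_not_in_span[OF assms(2,3) that]]
    obtain y where "\<forall>j\<in>J - {k}. (\<Sum>i\<in>I. y i * u j i) = 0" "(\<Sum>i\<in>I. y i * u k i) = 1"
      by blast
    then show ?thesis
      by (intro exI[of _ y]) auto
  qed
  then have "\<forall>k\<in>J. \<exists>y. \<forall>j\<in>J. (\<Sum>i\<in>I. y i * u j i) = (if j = k then 1 else 0)"
    by blast
  then show ?thesis by (rule bchoice)
qed

lemma sum_mult_sum_swap:
  fixes p :: "'i \<Rightarrow> real"
  shows "(\<Sum>i\<in>I. p i * (\<Sum>j\<in>J. s j * v j i)) = (\<Sum>j\<in>J. s j * (\<Sum>i\<in>I. p i * v j i))"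
  unfolding sum_distrib_left by (subst sum.swap) (intro sum.cong refl mult.left_commute)

section \<open>The colourful Caratheodory theorem\<close>

lemma compact_function_box:
  fixes B :: "'j \<Rightarrow> real set"
  assumes "\<And>j. compact (B j)"
  shows "compact (PiE UNIV B)"
  using compactin_PiE[of "\<lambda>_. euclidean" UNIV B] assms by (simp add: euclidean_product_topology)

lemma nearest_simplex_point:
  fixes u :: "'j \<Rightarrow> 'i \<Rightarrow> real"
  assumes "finite J" "J \<noteq> {}"
  shows "\<exists>t. (\<forall>j\<in>J. t j \<ge> 0) \<and> (\<Sum>j\<in>J. t j) = 1 \<and>
    (\<forall>s. (\<forall>j\<in>J. s j \<ge> 0) \<longrightarrow> (\<Sum>j\<in>J. s j) = 1 \<longrightarrow>
      (\<Sum>i\<in>I. (\<Sum>j\<in>J. t j * u j i)\<^sup>2) \<le> (\<Sum>i\<in>I. (\<Sum>j\<in>J. s j * u j i)\<^sup>2))"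
proof -
  \<comment> \<open>Coefficients outside \<open>J\<close> are pinned to 0 to make the box compact;
    \<open>?Q\<close> does not see them.\<close>
  let ?B = "PiE UNIV (\<lambda>j. if j \<in> J then {0..1} else {0::real})"
  let ?S = "?B \<inter> {t. (\<Sum>j\<in>J. t j) = 1}"
  let ?Q = "\<lambda>t. \<Sum>i\<in>I. (\<Sum>j\<in>J. t j * u j i)\<^sup>2"
  have coord: "continuous_on A (\<lambda>t. t j)" for A :: "('j \<Rightarrow> real) set" and j
    by (rule continuous_on_subset[OF continuous_on_product_coordinates]) auto
  have "compact ?B"
    by (intro compact_function_box) auto
  moreover have "closed {t :: 'j \<Rightarrow> real. (\<Sum>j\<in>J. t j) = 1}"
    by (intro closed_Collect_eq continuous_intros coord)
  ultimately have "compact ?S"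
    by (rule compact_Int_closed)
  obtain j0 where "j0 \<in> J" using assms by blast
  then have "(\<lambda>j. if j = j0 then 1 else 0) \<in> ?B"
    by (intro PiE_I) auto
  moreover have "(\<Sum>j\<in>J. if j = j0 then 1 else (0::real)) = 1"
    using assms \<open>j0 \<in> J\<close> by simp
  ultimately have "?S \<noteq> {}" by blast
  have "continuous_on ?S ?Q"
    by (intro continuous_intros coord)
  then obtain t where t: "t \<in> ?S" "\<forall>s\<in>?S. ?Q t \<le> ?Q s"
    using continuous_attains_inf[OF \<open>compact ?S\<close> \<open>?S \<noteq> {}\<close>] by blast
  have "?Q t \<le> ?Q s" if s: "\<forall>j\<in>J. s j \<ge> 0" "(\<Sum>j\<in>J. s j) = 1" for s
  proof -
    define s' where "s' j = (if j \<in> J then s j else 0)" for j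
    have "s j \<le> 1" if "j \<in> J" for j
      using member_le_sum[of j J s] that s assms by auto
    then have "s' \<in> ?S" using s by (auto simp: s'_def)
    then have "?Q t \<le> ?Q s'" using t(2) by blast
    also have "?Q s' = ?Q s"
      by (intro sum.cong arg_cong[where f = "\<lambda>x. x\<^sup>2"]) (auto simp: s'_def)
    finally show ?thesis .
  qed
  moreover have "t j \<ge> 0" if "j \<in> J" for j
    using PiE_mem[of t UNIV "\<lambda>j. if j \<in> J then {0..1} else {0}" j] t(1) that by auto
  ultimately show ?thesis
    using t(1) by (intro exI[of _ t]) blast
qed

lemma quadratic_min_at_zero:
  fixes A B :: real
  assumes "\<And>e. 0 < e \<Longrightarrow> e \<le> \<delta> \<Longrightarrow> 0 \<le> 2 * e * A + e\<^sup>2 * B" "0 < \<delta>"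
  shows "0 \<le> A"
proof (rule ccontr)
  assume "\<not> 0 \<le> A"
  \<comment> \<open>With this \<open>e\<close> one has \<open>e * B \<le> - A\<close>, so 2 A + e B
    is at most A < 0. The summand 1 keeps the denominator positive.\<close>
  define e where "e = min \<delta> (- A / (\<bar>B\<bar> + 1))"
  have "0 < e" "e \<le> \<delta>" "e \<le> - A / (\<bar>B\<bar> + 1)"
    using assms(2) \<open>\<not> 0 \<le> A\<close> by (auto simp: e_def divide_neg_pos)
  moreover have "e * (\<bar>B\<bar> + 1) \<le> - A"
    using \<open>e \<le> - A / (\<bar>B\<bar> + 1)\<close> by (subst (asm) pos_le_divide_eq) auto
  ultimately have e: "0 < e" "e \<le> \<delta>" "e * (\<bar>B\<bar> + 1) \<le> - A"
    by blast+
  have "e * B \<le> e * (\<bar>B\<bar> + 1)"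
    using e by (intro mult_left_mono) auto
  then have "e * (2 * A + e * B) < 0"
    using e \<open>\<not> 0 \<le> A\<close> by (intro mult_pos_neg) linarith+
  then show False
    using assms(1)[OF e(1,2)] by (simp add: algebra_simps power2_eq_square)
qed

text \<open>Among all rainbow choices take one whose convex hull is nearest to the origin, with
  nearest point p. If p is not 0, some colour j is dispensable for p, and optimality puts every
  vector of colour j into the half space <p, x> >= <p, p>, so these vectors cannot sum to 0.\<close>

lemma colorful_caratheodory:
  fixes u :: "'j \<Rightarrow> 'g \<Rightarrow> 'i \<Rightarrow> real"
  assumes I: "finite I" and J: "finite J" and IJ: "card I < card J"
    and G: "finite G" "G \<noteq> {}"
    and zero: "\<And>i j. i \<in> I \<Longrightarrow> j \<in> J \<Longrightarrow> (\<Sum>g\<in>G. u j g i) = 0"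
  shows "\<exists>c t. c \<in> J \<rightarrow> G \<and> (\<forall>j\<in>J. t j \<ge> 0) \<and> (\<Sum>j\<in>J. t j) = 1 \<and>
    (\<forall>i\<in>I. (\<Sum>j\<in>J. t j * u j (c j) i) = (0::real))"
proof -
  have "J \<noteq> {}" using IJ by auto
  define Q where "Q c t = (\<Sum>i\<in>I. (\<Sum>j\<in>J. t j * u j (c j) i)\<^sup>2)" for c :: "'j \<Rightarrow> 'g" and t
  define simp where "simp t \<longleftrightarrow> (\<forall>j\<in>J. t j \<ge> 0) \<and> (\<Sum>j\<in>J. t j) = (1::real)" for t
  have "\<exists>t. simp t \<and> (\<forall>s. simp s \<longrightarrow> Q c t \<le> Q c s)" for c
    using nearest_simplex_point[OF J \<open>J \<noteq> {}\<close>, where I = I and u = "\<lambda>j. u j (c j)"]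
    unfolding Q_def simp_def by (simp only: imp_conjL conj_assoc)
  then obtain \<tau> where \<tau>: "\<And>c. simp (\<tau> c)" "\<And>c s. simp s \<Longrightarrow> Q c (\<tau> c) \<le> Q c s"
    by metis
  have fin: "finite (PiE J (\<lambda>_. G))" "PiE J (\<lambda>_. G) \<noteq> {}"
    using J G by (auto intro: finite_PiE simp: PiE_eq_empty_iff)
  define c where "c = arg_min_on (\<lambda>c. Q c (\<tau> c)) (PiE J (\<lambda>_. G))"
  have c: "c \<in> PiE J (\<lambda>_. G)" "\<And>c'. c' \<in> PiE J (\<lambda>_. G) \<Longrightarrow> Q c (\<tau> c) \<le> Q c' (\<tau> c')"
    using arg_min_if_finite[OF fin, of "\<lambda>c. Q c (\<tau> c)"] unfolding c_def by (auto simp: not_less)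
  have min: "Q c (\<tau> c) \<le> Q c' s" if "c' \<in> PiE J (\<lambda>_. G)" "simp s" for c' s
    using c(2)[OF that(1)] \<tau>(2)[OF that(2)] by (meson order_trans)
  define p where "p i = (\<Sum>j\<in>J. \<tau> c j * u j (c j) i)" for i
  define pp where "pp v = (\<Sum>i\<in>I. p i * v i)" for v :: "'i \<Rightarrow> real"
  have QPP: "Q c (\<tau> c) = pp p" unfolding Q_def pp_def p_def by (simp add: power2_eq_square)
  show ?thesis
  proof (cases "pp p = 0")
    case True
    then have "\<forall>i\<in>I. p i = 0"
      unfolding pp_def using I by (subst (asm) sum_nonneg_eq_0_iff) auto
    then show ?thesis
      using c(1) \<tau>(1)[of c] unfolding simp_def p_def
      by (intro exI[of _ c] exI[of _ "\<tau> c"]) (auto simp: PiE_iff)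
  next
    case False
    have "pp p \<ge> 0" unfolding pp_def by (auto intro!: sum_nonneg)
    with False have pos: "pp p > 0" by simp
    \<comment> \<open>First-order optimality of the nearest point \<open>p\<close>. The choice \<open>c'\<close> may differ from \<open>c\<close> in
      colours that some representation of \<open>p\<close> does not use, which gives the contradiction.\<close>
    have opt: "pp p \<le> pp (u j (c' j))"
      if c': "c' \<in> PiE J (\<lambda>_. G)" "simp s" "j \<in> J" "\<forall>i\<in>I. (\<Sum>j\<in>J. s j * u j (c' j) i) = p i" for c' s j
    proof -
      define w where "w i = u j (c' j) i - p i" for i
      have "0 \<le> 2 * e * pp w + e\<^sup>2 * (\<Sum>i\<in>I. (w i)\<^sup>2)" if e: "0 < e" "e \<le> 1" for e
      proof -
        define s' where "s' k = (1 - e) * s k + e * (if k = j then 1 else 0)" for k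
        have "simp s'"
          using c'(2,3) e J unfolding simp_def s'_def
          by (auto simp: sum.distrib sum_distrib_left[symmetric] sum.delta)
        then have "pp p \<le> Q c' s'" using min[OF c'(1)] QPP by simp
        also have "Q c' s' = (\<Sum>i\<in>I. (p i + e * w i)\<^sup>2)"
          unfolding Q_def
        proof (intro sum.cong refl arg_cong[where f = "\<lambda>x. x\<^sup>2"])
          fix i assume "i \<in> I"
          have "(\<Sum>k\<in>J. s' k * u k (c' k) i) =
              (\<Sum>k\<in>J. (1 - e) * (s k * u k (c' k) i) + e * (if k = j then u k (c' k) i else 0))"
            unfolding s'_def by (intro sum.cong) (auto simp: algebra_simps)
          also have "\<dots> = (1 - e) * p i + e * u j (c' j) i"
            using c'(3,4) \<open>i \<in> I\<close> J
            by (simp add: sum.distrib sum_distrib_left[symmetric] sum.delta)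
          finally show "(\<Sum>k\<in>J. s' k * u k (c' k) i) = p i + e * w i"
            by (simp add: w_def algebra_simps)
        qed
        also have "\<dots> = pp p + 2 * e * pp w + e\<^sup>2 * (\<Sum>i\<in>I. (w i)\<^sup>2)"
          unfolding pp_def sum_distrib_left sum.distrib[symmetric]
          by (intro sum.cong) (auto simp: power2_eq_square algebra_simps)
        finally show ?thesis by simp
      qed
      then have "0 \<le> pp w" by (rule quadratic_min_at_zero[where \<delta> = 1]) auto
      then show ?thesis
        unfolding w_def pp_def by (simp add: algebra_simps sum_subtractf)
    qed
    have \<tau>p: "\<forall>i\<in>I. (\<Sum>j\<in>J. \<tau> c j * u j (c j) i) = p i" by (simp add: p_def)
    \<comment> \<open>A representation of \<open>p\<close> that misses a colour. If all coefficients
      are positive, optimality forces the chosen vectors onto the hyperplane <p, x> = <p, p>, where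
      they are affinely dependent.\<close>
    have "\<exists>s j. simp s \<and> j \<in> J \<and> s j = 0 \<and> (\<forall>i\<in>I. (\<Sum>j\<in>J. s j * u j (c j) i) = p i)"
    proof (cases "\<exists>j\<in>J. \<tau> c j = 0")
      case True
      then show ?thesis using \<tau>(1)[of c] \<tau>p by blast
    next
      case False
      then have tpos: "\<tau> c j > 0" if "j \<in> J" for j
      proof -
        have "0 \<le> \<tau> c j" using \<tau>(1)[of c] that unfolding simp_def by blast
        moreover have "\<tau> c j \<noteq> 0" using False that by blast
        ultimately show ?thesis by simp
      qed
      have ge: "pp p \<le> pp (u j (c j))" if "j \<in> J" for j
        using opt[OF c(1) \<tau>(1) that \<tau>p] .
      have pp_p: "(\<Sum>j\<in>J. \<tau> c j * pp (u j (c j))) = pp p"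
        unfolding pp_def p_def by (rule sum_mult_sum_swap[symmetric])
      have "(\<Sum>j\<in>J. \<tau> c j * (pp (u j (c j)) - pp p)) = pp p - (\<Sum>j\<in>J. \<tau> c j) * pp p"
        by (simp only: right_diff_distrib sum_subtractf pp_p sum_distrib_right)
      also have "(\<Sum>j\<in>J. \<tau> c j) = 1"
        using \<tau>(1)[of c] unfolding simp_def by blast
      finally have "(\<Sum>j\<in>J. \<tau> c j * (pp (u j (c j)) - pp p)) = 0"
        by simp
      moreover have "0 \<le> \<tau> c j * (pp (u j (c j)) - pp p)" if "j \<in> J" for j
        using ge[OF that] tpos[OF that] by simp
      ultimately have zeros: "\<forall>j\<in>J. \<tau> c j * (pp (u j (c j)) - pp p) = 0"
        using sum_nonneg_eq_0_iff[OF J, of "\<lambda>j. \<tau> c j * (pp (u j (c j)) - pp p)"] by blast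
      have eq: "pp (u j (c j)) = pp p" if "j \<in> J" for j
      proof -
        have "\<tau> c j * (pp (u j (c j)) - pp p) = 0" "\<tau> c j \<noteq> 0"
          using tpos[OF that] zeros that by (blast, simp)
        then show ?thesis by simp
      qed
      \<comment> \<open>A linear dependence is enough: all chosen vectors have the same positive
        product with \<open>p\<close>, so pairing with \<open>p\<close> shows that the coefficients
        sum to 0. This saves the extra vector that an affine dependence usually requires.\<close>
      obtain s where s: "\<exists>j\<in>J. s j \<noteq> 0" "\<forall>i\<in>I. (\<Sum>j\<in>J. s j * u j (c j) i) = 0"
        using homogeneous_system_nontrivial[OF I J IJ, of "\<lambda>j. u j (c j)"] by blast
      have "(\<Sum>j\<in>J. s j) * pp p = (\<Sum>j\<in>J. s j * pp (u j (c j)))"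
        unfolding sum_distrib_right using eq by (intro sum.cong) auto
      also have "\<dots> = pp (\<lambda>i. \<Sum>j\<in>J. s j * u j (c j) i)"
        unfolding pp_def by (rule sum_mult_sum_swap[symmetric])
      also have "\<dots> = 0" unfolding pp_def using s(2) by simp
      finally have ssum: "(\<Sum>j\<in>J. s j) = 0" using pos by auto
      have "\<exists>j\<in>J. s j < 0"
      proof (rule ccontr)
        assume "\<not> (\<exists>j\<in>J. s j < 0)"
        then have "\<And>j. j \<in> J \<Longrightarrow> 0 \<le> s j"
          by (simp add: not_less)
        then have "\<forall>j\<in>J. s j = 0"
          using sum_nonneg_eq_0_iff[OF J, of s] ssum by blast
        then show False using s(1) by blast
      qed
      define K where "K = {j \<in> J. s j < 0}"
      have K: "finite K" "K \<noteq> {}"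
        using J \<open>\<exists>j\<in>J. s j < 0\<close> by (auto simp: K_def)
      \<comment> \<open>The smallest ratio marks the moment at which moving along \<open>s\<close>
        first makes a coefficient vanish, the others still being nonnegative.\<close>
      define j where "j = arg_min_on (\<lambda>j. \<tau> c j / - s j) K"
      have j: "j \<in> K" "\<And>k. k \<in> K \<Longrightarrow> \<tau> c j / - s j \<le> \<tau> c k / - s k"
        using arg_min_if_finite[OF K, of "\<lambda>j. \<tau> c j / - s j"] unfolding j_def
        by (auto simp: not_less)
      define e where "e = \<tau> c j / - s j"
      have e: "e > 0" using j(1) tpos unfolding e_def K_def by (auto intro!: divide_pos_pos simp del: divide_minus_right)
      have nn: "\<tau> c k + e * s k \<ge> 0" if "k \<in> J" for k
      proof (cases "s k < 0")
        case True
        then have "e \<le> \<tau> c k / - s k" using j(2)[of k] that by (simp add: K_def e_def)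
        then show ?thesis using True by (simp add: field_simps)
      next
        case False
        then show ?thesis using e tpos[OF that] by (simp add: add_nonneg_nonneg)
      qed
      have "simp (\<lambda>k. \<tau> c k + e * s k)"
        using nn ssum \<tau>(1)[of c] sum_distrib_left[of e s J] unfolding simp_def
        by (simp add: sum.distrib)
      moreover have "\<forall>i\<in>I. (\<Sum>k\<in>J. (\<tau> c k + e * s k) * u k (c k) i) = p i"
      proof
        fix i assume "i \<in> I"
        have "(\<Sum>k\<in>J. (\<tau> c k + e * s k) * u k (c k) i) =
            (\<Sum>k\<in>J. \<tau> c k * u k (c k) i) + e * (\<Sum>k\<in>J. s k * u k (c k) i)"
          by (simp add: distrib_right sum.distrib sum_distrib_left mult.assoc)
        then show "(\<Sum>k\<in>J. (\<tau> c k + e * s k) * u k (c k) i) = p i"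
          using s(2) \<open>i \<in> I\<close> by (simp add: p_def)
      qed
      moreover have "\<tau> c j + e * s j = 0" "j \<in> J"
        using j(1) by (auto simp: e_def K_def)
      ultimately show ?thesis by blast
    qed
    then obtain s j where s: "simp s" "j \<in> J" "s j = 0" "\<forall>i\<in>I. (\<Sum>j\<in>J. s j * u j (c j) i) = p i"
      by blast
    have "pp p \<le> pp (u j g)" if "g \<in> G" for g
    proof -
      have cg: "c(j := g) \<in> PiE J (\<lambda>_. G)" using c(1) that s(2) by (auto simp: PiE_iff extensional_def)
      have sg: "(\<Sum>k\<in>J. s k * u k ((c(j := g)) k) i) = p i" if "i \<in> I" for i
      proof -
        have "(\<Sum>k\<in>J. s k * u k ((c(j := g)) k) i) = (\<Sum>k\<in>J. s k * u k (c k) i)"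
          using s(3) by (intro sum.cong) auto
        then show ?thesis using s(4) that by simp
      qed
      have "pp p \<le> pp (u j ((c(j := g)) j))"
        using opt[OF cg s(1,2)] sg by simp
      then show ?thesis by simp
    qed
    \<comment> \<open>Summing over the colour class \<open>j\<close> contradicts its zero
      sum.\<close>
    then have 1: "real (card G) * pp p \<le> (\<Sum>g\<in>G. pp (u j g))"
      by (rule sum_bounded_below)
    have 2: "(\<Sum>g\<in>G. pp (u j g)) = (\<Sum>i\<in>I. p i * (\<Sum>g\<in>G. u j g i))"
      unfolding pp_def sum_distrib_left by (rule sum.swap)
    have 3: "(\<Sum>i\<in>I. p i * (\<Sum>g\<in>G. u j g i)) = 0"
      by (intro sum.neutral ballI) (simp only: zero[OF _ s(2)] mult_zero_right)
    have 4: "real (card G) * pp p > 0"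
      using pos G by (simp add: card_gt_0_iff)
    show ?thesis
      using 1 2 3 4 by linarith
  qed
qed

section \<open>Null sets of multiaffine functions\<close>

definition affine_functional :: "('a::real_inner \<Rightarrow> real) \<Rightarrow> bool" where
  "affine_functional f \<longleftrightarrow> (\<exists>c w. \<forall>x. f x = c + inner w x)"

lemma affine_functional_const: "affine_functional (\<lambda>_. c)"
  unfolding affine_functional_def by (intro exI[of _ c] exI[of _ 0]) simp

lemma affine_functional_add:
  assumes "affine_functional f" "affine_functional g"
  shows "affine_functional (\<lambda>x. f x + g x)"
proof -
  obtain c w d z where "\<forall>x. f x = c + inner w x" "\<forall>x. g x = d + inner z x"
    using assms unfolding affine_functional_def by blast
  then show ?thesis
    unfolding affine_functional_def
    by (intro exI[of _ "c + d"] exI[of _ "w + z"]) (simp add: inner_add_left)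
qed

lemma affine_functional_mult:
  assumes "affine_functional f"
  shows "affine_functional (\<lambda>x. f x * k)"
proof -
  obtain c w where "\<forall>x. f x = c + inner w x"
    using assms unfolding affine_functional_def by blast
  then show ?thesis
    unfolding affine_functional_def
    by (intro exI[of _ "c * k"] exI[of _ "k *\<^sub>R w"]) (simp add: algebra_simps)
qed

lemma affine_functional_sum:
  assumes "\<And>i. i \<in> I \<Longrightarrow> affine_functional (f i)"
  shows "affine_functional (\<lambda>x. \<Sum>i\<in>I. f i x)"
  using assms
  by (induction I rule: infinite_finite_induct)
     (auto intro: affine_functional_const affine_functional_add)

lemma affine_functional_measurable:
  fixes f :: "'a::euclidean_space \<Rightarrow> real"
  assumes "affine_functional f"
  shows "f \<in> borel_measurable borel"
proof -
  obtain c w where "\<forall>x. f x = c + inner w x"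
    using assms unfolding affine_functional_def by blast
  then have "f = (\<lambda>x. c + inner w x)" by auto
  then show ?thesis by simp
qed

lemma AE_affine_functional_nonzero:
  fixes f :: "'a::euclidean_space \<Rightarrow> real"
  assumes "affine_functional f" "f x0 \<noteq> 0"
  shows "AE x in lborel. f x \<noteq> 0"
proof -
  obtain c w where f: "\<forall>x. f x = c + inner w x"
    using assms unfolding affine_functional_def by blast
  have "negligible {x. inner w x = - c}"
    using assms(2) f by (cases "w = 0") (auto intro!: negligible_hyperplane)
  moreover have "{x. f x = 0} = {x. inner w x = - c}"
    using f by (auto simp: add_eq_0_iff)
  ultimately have "{x. f x = 0} \<in> null_sets lebesgue"
    by (simp add: negligible_iff_null_sets)
  moreover have "{x. f x = 0} \<in> sets borel"
    using measurable_sets[OF affine_functional_measurable[OF assms(1)], of "{0}"]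
    by (simp add: vimage_def)
  ultimately have "{x. f x = 0} \<in> null_sets lborel"
    by (simp add: null_sets_completion_iff)
  then have "AE x in lborel. x \<notin> {x. f x = 0}"
    by (rule AE_not_in)
  then show ?thesis by simp
qed

text \<open>Fubini and induction: with coordinate \<open>j\<close> frozen at \<open>X0 j\<close> the
  function is nonzero for almost all remaining coordinates, and for those it is a nonzero affine
  function of coordinate \<open>j\<close>, whose zeros lie in a hyperplane. \<open>X0\<close> is
  extensional so that in the base case it is the only point of the empty product.\<close>

lemma AE_multiaffine_nonzero:
  fixes p :: "('j \<Rightarrow> 'a::euclidean_space) \<Rightarrow> real"
  assumes "finite J"
    and "p \<in> borel_measurable (PiM J (\<lambda>_. lborel))"
    and "\<And>X j. j \<in> J \<Longrightarrow> affine_functional (\<lambda>x. p (X(j := x)))"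
    and "X0 \<in> extensional J" "p X0 \<noteq> 0"
  shows "AE X in PiM J (\<lambda>_. lborel). p X \<noteq> 0"
  using assms
proof (induction J arbitrary: p X0 rule: finite_induct)
  case empty
  then show ?case
    by (intro AE_I2) (simp add: space_PiM)
next
  case (insert j J)
  interpret product_sigma_finite "\<lambda>_::'j. lborel :: 'a measure"
    by standard
  let ?M = "\<lambda>K::'j set. PiM K (\<lambda>_. lborel :: 'a measure)"
  note [measurable] = insert.prems(1)
  define q where "q X = p (X(j := X0 j))" for X
  define Y where "Y = restrict X0 J"
  have upd: "(\<lambda>X. X(j := x)) \<in> measurable (?M J) (?M (insert j J))" for x
    by (rule measurable_fun_upd[where J = J]) auto
  have "AE X in ?M J. q X \<noteq> 0"
  proof (rule insert.IH)
    show "q \<in> borel_measurable (?M J)"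
      unfolding q_def using measurable_compose[OF upd insert.prems(1)] by simp
    show "affine_functional (\<lambda>x. q (X(i := x)))" if "i \<in> J" for X i
    proof -
      have "(X(i := x))(j := X0 j) = (X(j := X0 j))(i := x)" for x
        using that insert.hyps by (intro fun_upd_twist) auto
      then show ?thesis
        unfolding q_def using insert.prems(2)[of i "X(j := X0 j)"] that by (simp only: insertI2)
    qed
    show "Y \<in> extensional J" by (simp add: Y_def)
    have "Y(j := X0 j) = X0"
      using insert.prems(3) by (auto simp: Y_def fun_eq_iff extensional_def restrict_def)
    then show "q Y \<noteq> 0" using insert.prems(4) by (simp add: q_def)
  qed
  then have "AE X in ?M J. (\<integral>\<^sup>+ x. indicator {X \<in> space (?M (insert j J)). p X = 0} (X(j := x)) \<partial>lborel) = 0"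
  proof eventually_elim
    case (elim X)
    then have "p (X(j := X0 j)) \<noteq> 0" by (simp add: q_def)
    then have "AE x in lborel. p (X(j := x)) \<noteq> 0"
      by (rule AE_affine_functional_nonzero[OF insert.prems(2)[OF insertI1]])
    then have "(\<integral>\<^sup>+ x. indicator {X \<in> space (?M (insert j J)). p X = 0} (X(j := x)) \<partial>lborel) = (\<integral>\<^sup>+ (x::'a). 0 \<partial>lborel)"
      by (intro nn_integral_cong_AE) (auto simp: indicator_def)
    then show ?case by simp
  qed
  moreover have meas: "{X \<in> space (?M (insert j J)). p X = 0} \<in> sets (?M (insert j J))"
    by measurable
  ultimately have "emeasure (?M (insert j J)) {X \<in> space (?M (insert j J)). p X = 0} = 0"
    using insert.hyps
    by (subst nn_integral_indicator[symmetric, OF meas], subst product_nn_integral_insert)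
       (auto simp: nn_integral_cong_AE[of _ "\<lambda>_. 0"])
  then show ?case
    using meas by (intro AE_I[where N = "{X \<in> space (?M (insert j J)). p X = 0}"]) auto
qed

text \<open>Meant for the terms of a determinant in which one point occupies one row: at most one
  factor varies. \<open>r0\<close> may lie outside \<open>S\<close>, when the point occupies no
  row.\<close>

lemma affine_functional_prod:
  assumes "finite S" "\<And>r. r \<in> S \<Longrightarrow> r \<noteq> r0 \<Longrightarrow> \<exists>d. \<forall>x. F r x = d"
    "r0 \<in> S \<Longrightarrow> affine_functional (F r0)"
  shows "affine_functional (\<lambda>x. \<Prod>r\<in>S. F r x)"
proof -
  obtain d where d: "\<And>r x. r \<in> S - {r0} \<Longrightarrow> F r x = d r"
    using assms(2) by (metis Diff_iff singletonI)
  have rest: "(\<Prod>r\<in>S - {r0}. F r x) = (\<Prod>r\<in>S - {r0}. d r)" for x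
    using d by (intro prod.cong) auto
  show ?thesis
  proof (cases "r0 \<in> S")
    case True
    then show ?thesis
      using assms(1,3) by (simp add: prod.remove[of S r0] rest affine_functional_mult)
  next
    case False
    then have "S - {r0} = S" by blast
    then show ?thesis using rest by (simp add: affine_functional_const)
  qed
qed

text \<open>At \<open>X0\<close> the columns in \<open>C\<close> together with \<open>b\<close> are
  independent, witnessed by a determinant that is affine in each point and so nonzero almost
  everywhere. Where it is nonzero, \<open>C\<close> is still independent, hence by maximality spans
  all columns, and \<open>b\<close> lies outside their span.\<close>

lemma AE_not_in_span:
  fixes A :: "nat \<Rightarrow> real ^ 'n \<Rightarrow> 'i \<Rightarrow> real"
  assumes I: "finite I" and J: "finite J" and C: "C \<subseteq> J"
    and aff: "\<And>i j. i \<in> I \<Longrightarrow> j \<in> J \<Longrightarrow> affine_functional (\<lambda>x. A j x i)"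
    and ind: "lin_indep I C (\<lambda>j. A j (X0 j))"
    and max: "\<And>X C'. C' \<subseteq> J \<Longrightarrow> lin_indep I C' (\<lambda>j. A j (X j)) \<Longrightarrow> card C' \<le> card C"
    and b: "\<not> in_span I J (\<lambda>j. A j (X0 j)) b"
  shows "AE X in PiM J (\<lambda>_. lborel). \<not> in_span I J (\<lambda>j. A j (X j)) b"
proof -
  have finC: "finite C" using C J by (rule finite_subset)
  define U where "U X k = (case k of None \<Rightarrow> b | Some j \<Rightarrow> A j (X j))" for X k
  define K where "K = insert None (Some ` C)"
  have finK: "finite K" using finC by (simp add: K_def)
  have sum_Some: "(\<Sum>k\<in>Some ` C. t k * U X k i) = (\<Sum>j\<in>C. t (Some j) * A j (X j) i)" for t X i
    by (subst sum.reindex) (auto simp: U_def)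
  have U_None: "U X None = b" for X
    by (simp add: U_def)
  have indU: "lin_indep I K (U X0)"
    unfolding K_def
  proof (rule lin_indep_insert)
    show "lin_indep I (Some ` C) (U X0)"
      using ind unfolding lin_indep_def sum_Some by auto
    show "\<not> in_span I (Some ` C) (U X0) (U X0 None)"
    proof
      assume "in_span I (Some ` C) (U X0) (U X0 None)"
      then obtain t where t: "\<forall>i\<in>I. b i = (\<Sum>j\<in>C. t (Some j) * A j (X0 j) i)"
        unfolding in_span_def sum_Some by (auto simp: U_def)
      have "(\<Sum>j\<in>C. t (Some j) * A j (X0 j) i) =
          (\<Sum>j\<in>J. (if j \<in> C then t (Some j) else 0) * A j (X0 j) i)" for i
        using C J by (intro sum.mono_neutral_cong_left) auto
      then have "in_span I J (\<lambda>j. A j (X0 j)) b"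
        unfolding in_span_def using t
        by (intro exI[of _ "\<lambda>j. if j \<in> C then t (Some j) else 0"]) simp
      then show False using b by blast
    qed
  qed (use finC in auto)
  \<comment> \<open>The functionals are dual at \<open>X0\<close> and do not move with the points,
    so \<open>D X\<close> is the identity matrix at \<open>X0\<close>.\<close>
  obtain y where y: "\<And>k l. k \<in> K \<Longrightarrow> l \<in> K \<Longrightarrow> (\<Sum>i\<in>I. y k i * U X0 l i) = (if l = k then 1 else 0)"
    using dual_family[OF I finK indU] by blast
  define n where "n = card K"
  obtain f where f: "bij_betw f {0..<n} K"
    using ex_bij_betw_nat_finite[OF finK] unfolding n_def by blast
  have fK: "f r \<in> K" if "r < n" for r
    using f that by (auto simp: bij_betw_def)
  have f_eq: "f r = f s \<longleftrightarrow> r = s" if "r < n" "s < n" for r s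
    using f that by (auto simp: bij_betw_def inj_on_eq_iff)
  define m where "m X r s = (\<Sum>i\<in>I. y (f s) i * U X (f r) i)" for X r s
  define D where "D X = mat n n (\<lambda>(r, s). m X r s)" for X
  define p where "p X = det (D X)" for X
  have D: "D X \<in> carrier_mat n n" for X by (simp add: D_def)
  have p_sum: "p X = (\<Sum>\<pi> | \<pi> permutes {0..<n}. signof \<pi> * (\<Prod>r = 0..<n. m X r (\<pi> r)))" for X
    unfolding p_def det_def'[OF D]
  proof (intro sum.cong refl arg_cong2[where f = "(*)"] prod.cong)
    fix \<pi> r assume "\<pi> \<in> {\<pi>. \<pi> permutes {0..<n}}" "r \<in> {0..<n}"
    then have "\<pi> r < n" "r < n" using permutes_in_image[of \<pi> "{0..<n}" r] by auto
    then show "D X $$ (r, \<pi> r) = m X r (\<pi> r)" by (simp add: D_def)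
  qed
  have "D X0 = 1\<^sub>m n"
    by (rule eq_matI) (auto simp: D_def m_def y fK f_eq)
  then have p0: "p X0 = 1" by (simp add: p_def)
  have indep: "lin_indep I K (U X)" if "p X \<noteq> 0" for X
    unfolding lin_indep_def
  proof (intro allI impI)
    fix t assume t: "\<forall>i\<in>I. (\<Sum>k\<in>K. t k * U X k i) = 0"
    define v where "v = vec n (\<lambda>r. t (f r))"
    \<comment> \<open>The vectors are the rows of \<open>D X\<close>, so a dependence among them is
      a kernel vector of the transpose.\<close>
    have "transpose_mat (D X) *\<^sub>v v = 0\<^sub>v n"
    proof (rule eq_vecI)
      fix s assume "s < dim_vec (0\<^sub>v n :: real vec)"
      then have s: "s < n" by simp
      have "(transpose_mat (D X) *\<^sub>v v) $ s = (\<Sum>r = 0..<n. m X r s * t (f r))"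
        using s by (simp add: D_def v_def scalar_prod_def)
      also have "\<dots> = (\<Sum>r = 0..<n. t (f r) * (\<Sum>i\<in>I. y (f s) i * U X (f r) i))"
        by (simp add: m_def mult.commute)
      also have "\<dots> = (\<Sum>k\<in>K. t k * (\<Sum>i\<in>I. y (f s) i * U X k i))"
        by (rule sum.reindex_bij_betw[OF f, where g = "\<lambda>k. t k * (\<Sum>i\<in>I. y (f s) i * U X k i)"])
      also have "\<dots> = (\<Sum>i\<in>I. y (f s) i * (\<Sum>k\<in>K. t k * U X k i))"
        by (rule sum_mult_sum_swap[symmetric])
      also have "\<dots> = 0" using t by simp
      finally show "(transpose_mat (D X) *\<^sub>v v) $ s = 0\<^sub>v n $ s" using s by simp
    qed (simp add: D_def)
    moreover have "det (transpose_mat (D X)) \<noteq> 0"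
      using that det_transpose[OF D] by (simp add: p_def)
    moreover have "v \<in> carrier_vec n" "transpose_mat (D X) \<in> carrier_mat n n"
      using D by (simp_all add: v_def)
    ultimately have v0: "v = 0\<^sub>v n"
      using det_0_iff_vec_prod_zero_field[of "transpose_mat (D X)" n] by blast
    have "t (f r) = 0" if "r < n" for r
    proof -
      have "t (f r) = v $ r" using that by (simp add: v_def)
      then show ?thesis using that v0 by simp
    qed
    then have "\<forall>k\<in>f ` {0..<n}. t k = 0"
      by simp
    then show "\<forall>k\<in>K. t k = 0"
      using bij_betw_imp_surj_on[OF f] by simp
  qed
  have not_span: "\<not> in_span I J (\<lambda>j. A j (X j)) b" if "p X \<noteq> 0" for X
  proof
    assume sp: "in_span I J (\<lambda>j. A j (X j)) b"
    have indK: "lin_indep I K (U X)" using indep[OF that] .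
    have indC: "lin_indep I C (\<lambda>j. A j (X j))"
      unfolding lin_indep_def
    proof (intro allI impI)
      fix t assume "\<forall>i\<in>I. (\<Sum>j\<in>C. t j * A j (X j) i) = 0"
      then have "\<forall>i\<in>I. (\<Sum>k\<in>K. (case k of None \<Rightarrow> 0 | Some j \<Rightarrow> t j) * U X k i) = 0"
        unfolding K_def using finC by (subst sum.insert) (auto simp: sum_Some)
      then show "\<forall>j\<in>C. t j = 0"
        using indK unfolding lin_indep_def K_def by fastforce
    qed
    have "in_span I C (\<lambda>j. A j (X j)) b"
    proof (rule in_span_trans[OF sp])
      fix j assume j: "j \<in> J"
      show "in_span I C (\<lambda>j. A j (X j)) (A j (X j))"
      proof (cases "j \<in> C")
        case True
        have "A j (X j) i = (\<Sum>k\<in>C. (if k = j then 1 else 0) * A k (X k) i)" for i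
        proof -
          have "(\<Sum>k\<in>C. (if k = j then 1 else 0) * A k (X k) i) = (\<Sum>k\<in>C. if k = j then A k (X k) i else 0)"
            by (intro sum.cong) auto
          then show ?thesis using True finC by simp
        qed
        then show ?thesis
          unfolding in_span_def by (intro exI[of _ "\<lambda>k. if k = j then 1 else 0"] ballI)
      next
        case False
        show ?thesis
        proof (rule ccontr)
          \<comment> \<open>Here maximality enters: a column outside the span of \<open>C\<close>
            would enlarge the independent family.\<close>
          assume "\<not> ?thesis"
          then have "lin_indep I (insert j C) (\<lambda>j. A j (X j))"
            using lin_indep_insert[OF finC False indC] by blast
          then have "card (insert j C) \<le> card C"
            using C j by (intro max) auto
          then show False using finC False by simp
        qed
      qed
    qed
    then obtain t where t: "\<forall>i\<in>I. b i = (\<Sum>j\<in>C. t j * A j (X j) i)"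
      unfolding in_span_def by blast
    have "\<forall>i\<in>I. (\<Sum>k\<in>K. (case k of None \<Rightarrow> - 1 | Some j \<Rightarrow> t j) * U X k i) = 0"
      unfolding K_def using finC t by (subst sum.insert) (auto simp: sum_Some U_None)
    then have "\<forall>k\<in>K. (case k of None \<Rightarrow> - 1 | Some j \<Rightarrow> t j) = 0"
      using indK unfolding lin_indep_def by blast
    then show False by (simp add: K_def)
  qed
  have U_const: "U (X(j := x)) k = U X k" if "k \<noteq> Some j" for X j x k
    using that by (auto simp: U_def split: option.splits)
  have U_aff: "affine_functional (\<lambda>x. U (X(j := x)) (Some j) i)" if "i \<in> I" "j \<in> J" for X j i
    using aff[OF that] by (simp add: U_def)
  have "affine_functional (\<lambda>x. p (X(j := x)))" if j: "j \<in> J" for X j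
  proof -
    obtain r0 where r0: "\<And>r. r \<in> {0..<n} \<Longrightarrow> r \<noteq> r0 \<Longrightarrow> f r \<noteq> Some j"
      "r0 \<in> {0..<n} \<Longrightarrow> f r0 = Some j"
    proof (cases "\<exists>r\<in>{0..<n}. f r = Some j")
      case True
      then obtain r1 where r1: "r1 < n" "f r1 = Some j" by auto
      then have "f r \<noteq> Some j" if "r \<in> {0..<n}" "r \<noteq> r1" for r
        using f_eq[of r r1] that by auto
      then show ?thesis using that[of r1] r1 by blast
    next
      case False
      \<comment> \<open>No row involves point \<open>j\<close>. The index \<open>n\<close> is out of
        range, so the second requirement on \<open>r0\<close> is vacuous.\<close>
      then show ?thesis using that[of n] by auto
    qed
    have "affine_functional (\<lambda>x. (\<Prod>r = 0..<n. m (X(j := x)) r (\<pi> r)) * signof \<pi>)" for \<pi>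
    proof (intro affine_functional_mult affine_functional_prod[where ?r0.0 = r0])
      show "\<exists>d. \<forall>x. m (X(j := x)) r (\<pi> r) = d" if "r \<in> {0..<n}" "r \<noteq> r0" for r
        using U_const[OF r0(1)[OF that]] by (simp add: m_def)
      show "affine_functional (\<lambda>x. m (X(j := x)) r0 (\<pi> r0))" if "r0 \<in> {0..<n}"
        unfolding m_def r0(2)[OF that] using U_aff j
        by (intro affine_functional_sum) (subst mult.commute, intro affine_functional_mult)
    qed simp
    then have "affine_functional (\<lambda>x. \<Sum>\<pi> | \<pi> permutes {0..<n}.
        (\<Prod>r = 0..<n. m (X(j := x)) r (\<pi> r)) * signof \<pi>)"
      by (intro affine_functional_sum)
    then show ?thesis by (simp add: p_sum mult.commute)
  qed
  moreover have "p \<in> borel_measurable (PiM J (\<lambda>_. lborel))"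
  proof -
    have "(\<lambda>X. U X k i) \<in> borel_measurable (PiM J (\<lambda>_. lborel))" if "k \<in> K" "i \<in> I" for k i
    proof (cases k)
      case None
      then show ?thesis by (simp add: U_def)
    next
      case (Some j)
      then have "j \<in> J" using that C by (auto simp: K_def)
      have "(\<lambda>X. X j) \<in> measurable (PiM J (\<lambda>_. lborel)) (lborel :: (real ^ 'n) measure)"
        using \<open>j \<in> J\<close> by (rule measurable_component_singleton)
      then have "(\<lambda>X. X j) \<in> measurable (PiM J (\<lambda>_. lborel)) (borel :: (real ^ 'n) measure)"
        by simp
      from measurable_compose[OF this affine_functional_measurable[OF aff[OF that(2) \<open>j \<in> J\<close>]]]
      show ?thesis using Some by (simp add: U_def)
    qed
    then have "(\<lambda>X. m X r s) \<in> borel_measurable (PiM J (\<lambda>_. lborel))" if "r < n" for r s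
      unfolding m_def using fK[OF that] by (intro borel_measurable_sum borel_measurable_times) auto
    then show ?thesis
      unfolding p_sum[abs_def] by (intro borel_measurable_sum borel_measurable_times borel_measurable_prod) auto
  qed
  moreover have "p (restrict X0 J) \<noteq> 0"
  proof -
    have "U (restrict X0 J) k = U X0 k" if "k \<in> K" for k
      using that C by (auto simp: U_def K_def)
    then have "m (restrict X0 J) r s = m X0 r s" if "r < n" for r s
      using fK[OF that] by (simp add: m_def)
    then have "D (restrict X0 J) = D X0"
      by (intro eq_matI) (auto simp: D_def)
    then show ?thesis using p0 by (simp add: p_def)
  qed
  ultimately have "AE X in PiM J (\<lambda>_. lborel). p X \<noteq> 0"
    using J by (intro AE_multiaffine_nonzero[where ?X0.0 = "restrict X0 J"]) auto
  then show ?thesis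
    by eventually_elim (rule not_span)
qed

section \<open>The linear system of a polytope partition\<close>

lemma sum_by_label:
  assumes "finite J" "finite G" "c \<in> J \<rightarrow> G"
  shows "(\<Sum>g\<in>G. \<Sum>j\<in>{j\<in>J. c j = g}. f j) = (\<Sum>j\<in>J. f j)"
  using assms by (intro sum.group) auto

text \<open>The vanishing of all Fourier coefficients of the component of \<open>g \<mapsto> x\<^sub>g\<close> in a coordinate
  plane except those at \<open>0\<close> and one further character says that \<open>x\<^sub>g\<close> is an affine
  function of the values at two fixed group elements. In this form, with the base points \<open>g0\<close> and
  \<open>e a\<close>, the condition is real linear, and it is vacuous exactly at these base points. Constant
  maps satisfy it, which is what makes the colour classes balanced.\<close>

locale affine_system =
  fixes G :: "'g set" and g0 :: 'g and e :: "'n::finite \<Rightarrow> 'g" and v :: "'n \<Rightarrow> 'g \<Rightarrow> real ^ 'n"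
  assumes finite_G: "finite G" and g0_in: "g0 \<in> G" and e_in: "e a \<in> G" and e_neq: "e a \<noteq> g0"
    and v_e: "v a (e a) = 0" and v_support: "v a g $ b \<noteq> 0 \<Longrightarrow> e b = e a"
begin

definition conditions :: "('n \<times> 'g) set" where
  "conditions = (SIGMA a:UNIV. G - {g0, e a})"

text \<open>The coefficient of x_g when condition (a, h) is moved to one side: the a-th coordinate
  of x_h - x_g0, minus <v a h, x_(e a) - x_g0>. By \<open>v_e\<close> the pair (a, e a), which is no
  condition, then expresses equality of the a-th coordinates at the two base points.\<close>

definition w :: "'n \<times> 'g \<Rightarrow> 'g \<Rightarrow> real ^ 'n" where
  "w p g = (if g = snd p then axis (fst p) 1 else 0)
     + (if g = g0 then v (fst p) (snd p) - axis (fst p) 1 else 0)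
     - (if g = e (fst p) then v (fst p) (snd p) else 0)"

text \<open>Sarkaria's lift of a point placed into class \<open>g\<close>: its contribution to each
  condition, and an indicator entry that records the class weights.\<close>

definition column :: "'g \<Rightarrow> real ^ 'n \<Rightarrow> ('n \<times> 'g) + 'g \<Rightarrow> real" where
  "column g x i = (case i of Inl p \<Rightarrow> inner (w p g) x | Inr h \<Rightarrow> if g = h then 1 else 0)"

definition class_point :: "nat \<Rightarrow> (nat \<Rightarrow> 'g) \<Rightarrow> (nat \<Rightarrow> real) \<Rightarrow> (nat \<Rightarrow> real ^ 'n) \<Rightarrow> 'g \<Rightarrow> real ^ 'n" where
  "class_point N c t X g = (\<Sum>j\<in>{j\<in>{..<N}. c j = g}. t j *\<^sub>R X j)"

text \<open>Signs of the weights are left out, which keeps nondegeneracy a linear statement.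
  Labellings are extensional so that they are finite in number.\<close>

definition solution :: "nat \<Rightarrow> (nat \<Rightarrow> real ^ 'n) \<Rightarrow> (nat \<Rightarrow> 'g) \<Rightarrow> (nat \<Rightarrow> real) \<Rightarrow> bool" where
  "solution N X c t \<longleftrightarrow> c \<in> {..<N} \<rightarrow>\<^sub>E G \<and>
     (\<forall>g\<in>G. (\<Sum>j\<in>{j\<in>{..<N}. c j = g}. t j) = 1) \<and>
     (\<forall>a. \<forall>h\<in>G - {g0, e a}. class_point N c t X h $ a = class_point N c t X g0 $ a
        + inner (v a h) (class_point N c t X (e a) - class_point N c t X g0))"

lemma finite_conditions: "finite conditions"
  unfolding conditions_def using finite_G by auto

lemma card_conditions: "card conditions = CARD('n) * (card G - 2)"
proof -
  have "card (G - {g0, e a}) = card G - 2" for a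
    using finite_G g0_in e_in[of a] e_neq[of a] by (subst card_Diff_subset) auto
  then show ?thesis
    unfolding conditions_def using finite_G by (simp add: card_SigmaI)
qed

lemma sum_inner_w:
  assumes "h \<in> G"
  shows "(\<Sum>g\<in>G. inner (w (a, h) g) (y g)) =
    y h $ a - y g0 $ a - inner (v a h) (y (e a) - y g0)"
proof -
  have "inner (w (a, h) g) (y g) = (if g = h then y g $ a else 0)
      + (if g = g0 then inner (v a h) (y g) - y g $ a else 0)
      - (if g = e a then inner (v a h) (y g) else 0)" for g
    by (auto simp: w_def inner_axis' inner_add_left inner_diff_left)
  then show ?thesis
    using assms finite_G g0_in e_in[of a]
    by (simp add: sum.distrib sum_subtractf sum.delta' inner_diff_right)
qed

lemma sum_w:
  assumes "h \<in> G"
  shows "(\<Sum>g\<in>G. inner (w (a, h) g) x) = 0"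
  using sum_inner_w[OF assms, of a "\<lambda>_. x"] by simp

lemma sum_inner_class_point:
  assumes "c \<in> {..<N} \<rightarrow> G"
  shows "(\<Sum>j<N. t j * inner (w p (c j)) (X j)) = (\<Sum>g\<in>G. inner (w p g) (class_point N c t X g))"
proof -
  have "inner (w p g) (class_point N c t X g) = (\<Sum>j\<in>{j\<in>{..<N}. c j = g}. t j * inner (w p (c j)) (X j))" for g
    unfolding class_point_def inner_sum_right by (intro sum.cong) auto
  then show ?thesis
    using sum_by_label[OF finite_lessThan finite_G assms, of "\<lambda>j. t j * inner (w p (c j)) (X j)"]
    by (simp only:)
qed

lemma exists_solution:
  assumes N: "card conditions + card G \<le> N"
  shows "\<exists>c t. solution N X c t \<and> (\<forall>j<N. 0 \<le> t j)"
proof -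
  \<comment> \<open>Equal class weights are stated relative to \<open>g0\<close>: row
    \<open>Inr h\<close> of \<open>u\<close> is 1 on class h and -1 on class \<open>g0\<close>, so
    it sums to zero over the classes. Leaving out h = g0 is what makes \<open>card I\<close> smaller
    than \<open>N\<close>.\<close>
  define I where "I = Inl ` conditions \<union> Inr ` (G - {g0})"
  define u where "u j g i = column g (X j) i - (case i of Inl _ \<Rightarrow> 0 | Inr _ \<Rightarrow> if g = g0 then 1 else 0)" for j :: nat and g i
  have "finite I" unfolding I_def using finite_conditions finite_G by simp
  have "card I = card conditions + (card G - 1)"
    unfolding I_def using finite_conditions finite_G g0_in
    by (subst card_Un_disjoint) (auto simp: card_image)
  moreover have "card G > 0" using finite_G g0_in by (auto simp: card_gt_0_iff)
  ultimately have "card I < card {..<N}" using N by simp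
  have zero: "(\<Sum>g\<in>G. u j g i) = 0" if "i \<in> I" for i j
  proof (cases i)
    case (Inl p)
    then show ?thesis
      using that sum_w by (cases p) (auto simp: u_def column_def I_def conditions_def)
  next
    case (Inr h)
    then have "h \<in> G" "h \<noteq> g0" using that by (auto simp: I_def)
    then show ?thesis
      using Inr finite_G g0_in by (simp add: u_def column_def sum_subtractf sum.delta sum.delta')
  qed
  obtain c t where c: "c \<in> {..<N} \<rightarrow> G" and t: "\<forall>j\<in>{..<N}. t j \<ge> 0" "(\<Sum>j\<in>{..<N}. t j) = 1"
    and eq: "\<forall>i\<in>I. (\<Sum>j\<in>{..<N}. t j * u j (c j) i) = 0"
    using colorful_caratheodory[OF \<open>finite I\<close> _ \<open>card I < card {..<N}\<close> finite_G, of u] g0_in zero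
    by blast
  define T where "T g = (\<Sum>j\<in>{j\<in>{..<N}. c j = g}. t j)" for g
  have T_alt: "T g = (\<Sum>j<N. t j * (if c j = g then 1 else 0))" for g
    unfolding T_def by (subst sum.inter_filter) (auto intro!: sum.cong)
  have "T h = T g0" if "h \<in> G" for h
  proof (cases "h = g0")
    case False
    then have "Inr h \<in> I" using that by (auto simp: I_def)
    then have "0 = (\<Sum>j<N. t j * u j (c j) (Inr h))" using eq by simp
    also have "\<dots> = T h - T g0"
      unfolding T_alt sum_subtractf[symmetric]
      by (intro sum.cong) (auto simp: u_def column_def)
    finally show ?thesis by simp
  qed simp
  then have "(\<Sum>g\<in>G. T g) = real (card G) * T g0" by simp
  moreover have "(\<Sum>g\<in>G. T g) = 1"
    unfolding T_def using sum_by_label[OF _ finite_G c, of t] t(2) by simp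
  ultimately have T: "real (card G) * T g = 1" if "g \<in> G" for g
    using \<open>\<And>h. h \<in> G \<Longrightarrow> T h = T g0\<close> that by simp
  \<comment> \<open>All classes have the common weight 1 / card \<open>G\<close>; scaling raises it
    to 1.\<close>
  define s where "s j = real (card G) * t j" for j
  define c' where "c' = restrict c {..<N}"
  have cls: "{j\<in>{..<N}. c' j = g} = {j\<in>{..<N}. c j = g}" for g
    by (auto simp: c'_def)
  have "c' \<in> {..<N} \<rightarrow>\<^sub>E G" using c by (simp add: c'_def restrict_PiE_iff Pi_iff)
  moreover have "(\<Sum>j\<in>{j\<in>{..<N}. c' j = g}. s j) = 1" if "g \<in> G" for g
    using T[OF that] unfolding cls s_def T_def by (simp add: sum_distrib_left)
  moreover have "class_point N c' s X h $ a = class_point N c' s X g0 $ a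
        + inner (v a h) (class_point N c' s X (e a) - class_point N c' s X g0)"
    if "h \<in> G - {g0, e a}" for a h
  proof -
    have "Inl (a, h) \<in> I" using that by (auto simp: I_def conditions_def)
    then have "0 = real (card G) * (\<Sum>j<N. t j * u j (c j) (Inl (a, h)))" using eq by simp
    also have "\<dots> = (\<Sum>j<N. s j * inner (w (a, h) (c' j)) (X j))"
      unfolding sum_distrib_left by (intro sum.cong) (auto simp: s_def u_def column_def c'_def)
    also have "\<dots> = (\<Sum>g\<in>G. inner (w (a, h) g) (class_point N c' s X g))"
      using c by (intro sum_inner_class_point) (auto simp: c'_def)
    finally show ?thesis
      using sum_inner_w[of h a "class_point N c' s X"] that by simp
  qed
  moreover have "0 \<le> s j" if "j < N" for j
    using t that by (simp add: s_def)
  ultimately show ?thesis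
    unfolding solution_def by blast
qed

text \<open>The system is triangular. Away from \<open>g0\<close> and \<open>e a\<close>, coordinate
  a of the slot h is touched by the single condition (a, h), because \<open>v_support\<close>
  confines the correction terms to the slot \<open>e a\<close>. Once these coefficients vanish, the
  slot \<open>e a0\<close> isolates the added pair.\<close>

lemma w_independent:
  assumes "\<And>g. g \<in> G \<Longrightarrow> (\<Sum>p\<in>insert (a0, e a0) conditions. m p *\<^sub>R w p g) = 0"
    and "p \<in> insert (a0, e a0) conditions"
  shows "m p = 0"
proof -
  let ?C = "insert (a0, e a0) conditions"
  have fin: "finite ?C" using finite_conditions by simp
  have w_comp: "w p h $ a = (if p = (a, h) then 1 else 0)"
    if "h \<noteq> g0" "h \<noteq> e a \<or> v (fst p) (snd p) $ a = 0" for p a h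
  proof -
    obtain a' h' where p: "p = (a', h')" by (cases p)
    have "h \<noteq> e a' \<or> v a' h' $ a = 0"
      using that(2) v_support[of a' h' a] p by (cases "v a' h' $ a = 0") auto
    then show ?thesis using that(1) by (auto simp: w_def axis_def p)
  qed
  have zero: "m (a, h) = 0" if "(a, h) \<in> conditions" for a h
  proof -
    have h: "h \<in> G" "h \<noteq> g0" "h \<noteq> e a" using that by (auto simp: conditions_def)
    have "0 = (\<Sum>p\<in>?C. m p *\<^sub>R w p h) $ a" using assms(1)[OF h(1)] by simp
    also have "\<dots> = (\<Sum>p\<in>?C. if p = (a, h) then m p else 0)"
      unfolding sum_component using h
      by (intro sum.cong) (simp_all add: w_comp)
    also have "\<dots> = m (a, h)" using fin that by simp
    finally show ?thesis by simp
  qed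
  have "0 = (\<Sum>p\<in>?C. m p *\<^sub>R w p (e a0)) $ a0" using assms(1)[OF e_in] by simp
  also have "\<dots> = (\<Sum>p\<in>?C. if p = (a0, e a0) then m p else 0)"
    unfolding sum_component using zero e_neq[of a0] v_e[of a0]
    by (intro sum.cong) (auto simp: w_comp)
  also have "\<dots> = m (a0, e a0)" using fin by simp
  finally show ?thesis using zero assms(2) by (cases p) auto
qed

end

section \<open>Almost every point set is nondegenerate\<close>

text \<open>There are infinitely many configurations, but the ranks are bounded by
  \<open>card J\<close>, so the largest one is attained.\<close>

lemma max_lin_indep_exists:
  fixes A :: "'j \<Rightarrow> 'x \<Rightarrow> 'i \<Rightarrow> real"
  assumes "finite J"
  shows "\<exists>X C. C \<subseteq> J \<and> lin_indep I C (\<lambda>j. A j (X j)) \<and>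
    (\<forall>X' C'. C' \<subseteq> J \<longrightarrow> lin_indep I C' (\<lambda>j. A j (X' j)) \<longrightarrow> card C' \<le> card C)"
proof -
  define S where "S = {card C | C X. C \<subseteq> J \<and> lin_indep I C (\<lambda>j. A j (X j))}"
  have "S \<subseteq> {..card J}"
    unfolding S_def using assms by (auto intro: card_mono)
  then have fin: "finite S" by (rule finite_subset) simp
  have "card {} \<in> S"
    unfolding S_def by (intro CollectI exI[of _ "{}"] exI[of _ "\<lambda>_. undefined"]) (simp add: lin_indep_def)
  then have "Max S \<in> S" using fin by (intro Max_in) auto
  then obtain C X where CX: "C \<subseteq> J" "lin_indep I C (\<lambda>j. A j (X j))" "card C = Max S"
    unfolding S_def by auto
  have "card C' \<le> card C" if "C' \<subseteq> J" "lin_indep I C' (\<lambda>j. A j (X' j))" for X' C'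
  proof -
    have "card C' \<in> S" using that unfolding S_def by blast
    then show ?thesis using Max_ge[OF fin] CX(3) by simp
  qed
  then show ?thesis using CX by blast
qed

context affine_system
begin

text \<open>The multipliers \<open>inner (w p h) (d h)\<close> are the same for all columns, so
  translating every class by its own vector is one invertible row operation on the whole
  matrix.\<close>

lemma column_shift:
  assumes "g \<in> G"
  shows "column g (x + d g) (Inl p) =
    column g x (Inl p) + (\<Sum>h\<in>G. inner (w p h) (d h) * column g x (Inr h))"
proof -
  have "(\<Sum>h\<in>G. inner (w p h) (d h) * column g x (Inr h)) = (\<Sum>h\<in>G. if h = g then inner (w p h) (d h) else 0)"
    by (intro sum.cong) (auto simp: column_def)
  then show ?thesis
    using assms finite_G by (simp add: column_def inner_add_right)
qed

lemma column_Inr: "column g (x + y) (Inr h) = column g x (Inr h)"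
  by (simp add: column_def)

text \<open>A degenerate solution solves a system with more rows than columns. At a configuration
  \<open>X1\<close> of maximal rank a functional \<open>y\<close> annihilates all columns; a
  suitable translate \<open>X2\<close> has the same rank but makes the right hand side unreachable,
  and \<open>AE_not_in_span\<close> spreads this to almost all configurations.\<close>

lemma AE_not_degenerate_solution:
  assumes N: "N \<le> card conditions + card G" and c: "c \<in> {..<N} \<rightarrow>\<^sub>E G"
  shows "AE X in PiM {..<N} (\<lambda>_. lborel). \<forall>t. solution N X c t \<longrightarrow>
    class_point N c t X (e a0) $ a0 \<noteq> class_point N c t X g0 $ a0"
proof (cases "\<forall>g\<in>G. \<exists>j<N. c j = g")
  case False
  then obtain g where g: "g \<in> G" "\<forall>j<N. c j \<noteq> g" by blast
  \<comment> \<open>An empty class has total weight 0 and not 1.\<close>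
  then have "{j\<in>{..<N}. c j = g} = {}" by auto
  then have "\<not> solution N X c t" for X t
    unfolding solution_def using g(1) by (metis sum.empty zero_neq_one)
  then show ?thesis by simp
next
  case True
  \<comment> \<open>The added pair is the degeneracy equation, since
    \<open>v a0 (e a0) = 0\<close>.\<close>
  define C' where "C' = insert (a0, e a0) conditions"
  define I where "I = Inl ` C' \<union> Inr ` G"
  define A where "A j = column (c j)" for j
  define b where "b i = (case i of Inl _ \<Rightarrow> 0 | Inr _ \<Rightarrow> (1 :: real))" for i :: "('n \<times> 'g) + 'g"
  have cG: "c j \<in> G" if "j < N" for j using c that by auto
  have finC': "finite C'" unfolding C'_def using finite_conditions by simp
  then have finI: "finite I" unfolding I_def using finite_G by simp
  have snd_C': "snd p \<in> G" if "p \<in> C'" for p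
    using that e_in by (auto simp: C'_def conditions_def)
  have "card I = card C' + card G"
    unfolding I_def using finC' finite_G by (subst card_Un_disjoint) (auto simp: card_image)
  moreover have "card C' = card conditions + 1"
    unfolding C'_def using finite_conditions by (subst card_insert_disjoint) (auto simp: conditions_def)
  ultimately have "card {..<N} < card I" using N by simp
  obtain X1 C where C: "C \<subseteq> {..<N}" and ind: "lin_indep I C (\<lambda>j. A j (X1 j))"
    and max: "\<And>X' C'. C' \<subseteq> {..<N} \<Longrightarrow> lin_indep I C' (\<lambda>j. A j (X' j)) \<Longrightarrow> card C' \<le> card C"
    using max_lin_indep_exists[of "{..<N}" I A] by blast
  obtain y where y0: "\<exists>i\<in>I. y i \<noteq> 0" and y: "\<And>j. j < N \<Longrightarrow> (\<Sum>i\<in>I. y i * A j (X1 j) i) = 0"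
    using homogeneous_system_nontrivial[OF finite_lessThan finI \<open>card {..<N} < card I\<close>, of "\<lambda>i j. A j (X1 j) i"]
    by auto
  define W where "W g = (\<Sum>p\<in>C'. y (Inl p) *\<^sub>R w p g)" for g
  have sum_I: "(\<Sum>i\<in>I. f i) = (\<Sum>p\<in>C'. f (Inl p)) + (\<Sum>g\<in>G. f (Inr g))" for f :: "_ \<Rightarrow> real"
    unfolding I_def using finC' finite_G
    by (subst sum.union_disjoint) (auto simp: sum.reindex)
  have W_column: "inner (W g) x = (\<Sum>p\<in>C'. y (Inl p) * column g x (Inl p))" for g x
    by (simp add: W_def column_def inner_sum_left)
  have y': "inner (W (c j)) (X1 j) + y (Inr (c j)) = 0" if "j < N" for j
  proof -
    have "(\<Sum>g\<in>G. y (Inr g) * column (c j) (X1 j) (Inr g)) = (\<Sum>g\<in>G. if g = c j then y (Inr g) else 0)"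
      by (intro sum.cong) (auto simp: column_def)
    then show ?thesis
      using y[OF that] cG[OF that] finite_G by (simp add: sum_I A_def W_column)
  qed
  \<comment> \<open>If \<open>W\<close> vanished, the class entries of \<open>y\<close> would vanish
    because every class contains a point, and the others by \<open>w_independent\<close>, so
    \<open>y\<close> would be 0.\<close>
  have "\<exists>g1\<in>G. W g1 \<noteq> 0"
  proof (rule ccontr)
    assume "\<not> ?thesis"
    then have W0: "W g = 0" if "g \<in> G" for g using that by blast
    have "y (Inr g) = 0" if "g \<in> G" for g
    proof -
      obtain j where "j < N" "c j = g" using True \<open>g \<in> G\<close> by blast
      then show ?thesis using y'[of j] W0[OF \<open>g \<in> G\<close>] by simp
    qed
    moreover have "y (Inl p) = 0" if "p \<in> C'" for p
      using W0 that unfolding W_def C'_def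
      by (intro w_independent[where ?a0.0 = a0 and m = "\<lambda>p. y (Inl p)"])
    ultimately show False using y0 by (auto simp: I_def)
  qed
  then obtain g1 where g1: "g1 \<in> G" "W g1 \<noteq> 0" by blast
  \<comment> \<open>The translation must make the two evaluations of \<open>y\<close> differ: after
    it, \<open>W\<close> paired with a solution would give 1, whereas the condition rows give
    0.\<close>
  define s where "s = ((\<Sum>g\<in>G. y (Inr g)) + 1) / inner (W g1) (W g1)"
  define d where "d g = (if g = g1 then s *\<^sub>R W g1 else 0)" for g
  define X2 where "X2 j = X1 j + d (c j)" for j
  have shift: "(\<Sum>j\<in>K. t j * A j (X2 j) (Inl p)) = (\<Sum>j\<in>K. t j * A j (X1 j) (Inl p))
      + (\<Sum>h\<in>G. inner (w p h) (d h) * (\<Sum>j\<in>K. t j * A j (X1 j) (Inr h)))" if "K \<subseteq> {..<N}" for K t p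
  proof -
    have "(\<Sum>j\<in>K. t j * A j (X2 j) (Inl p)) = (\<Sum>j\<in>K. t j * A j (X1 j) (Inl p))
        + (\<Sum>j\<in>K. t j * (\<Sum>h\<in>G. inner (w p h) (d h) * A j (X1 j) (Inr h)))"
      unfolding sum.distrib[symmetric] A_def X2_def using cG that
      by (intro sum.cong) (auto simp: column_shift distrib_left subset_iff)
    then show ?thesis
      using sum_mult_sum_swap[of t "\<lambda>h. inner (w p h) (d h)" "\<lambda>h j. A j (X1 j) (Inr h)" G K] by simp
  qed
  have ind2: "lin_indep I C (\<lambda>j. A j (X2 j))"
    unfolding lin_indep_def
  proof (intro allI impI)
    fix t assume t: "\<forall>i\<in>I. (\<Sum>j\<in>C. t j * A j (X2 j) i) = 0"
    have r: "(\<Sum>j\<in>C. t j * A j (X1 j) (Inr h)) = 0" if "h \<in> G" for h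
    proof -
      have "Inr h \<in> I" using that by (auto simp: I_def)
      then have "(\<Sum>j\<in>C. t j * A j (X2 j) (Inr h)) = 0" using t by blast
      then show ?thesis by (simp add: A_def X2_def column_Inr)
    qed
    have "(\<Sum>j\<in>C. t j * A j (X1 j) (Inl p)) = 0" if "p \<in> C'" for p
    proof -
      have "Inl p \<in> I" using that by (auto simp: I_def)
      then have "(\<Sum>j\<in>C. t j * A j (X2 j) (Inl p)) = 0" using t by blast
      then show ?thesis using shift[OF C, of t p] r by simp
    qed
    then have "\<forall>i\<in>I. (\<Sum>j\<in>C. t j * A j (X1 j) i) = 0"
      using r by (auto simp: I_def)
    then show "\<forall>j\<in>C. t j = 0"
      using ind unfolding lin_indep_def by blast
  qed
  have "\<not> in_span I {..<N} (\<lambda>j. A j (X2 j)) b"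
  proof
    assume "in_span I {..<N} (\<lambda>j. A j (X2 j)) b"
    then obtain t where t: "\<And>i. i \<in> I \<Longrightarrow> b i = (\<Sum>j<N. t j * A j (X2 j) i)"
      unfolding in_span_def by blast
    have "(\<Sum>j<N. t j * inner (W (c j)) (X2 j)) = (\<Sum>p\<in>C'. y (Inl p) * (\<Sum>j<N. t j * A j (X2 j) (Inl p)))"
      unfolding W_column A_def by (rule sum_mult_sum_swap)
    also have "\<dots> = (\<Sum>p\<in>C'. y (Inl p) * b (Inl p))"
      using t by (intro sum.cong) (auto simp: I_def)
    also have "\<dots> = 0" by (simp add: b_def)
    finally have 1: "(\<Sum>j<N. t j * inner (W (c j)) (X2 j)) = 0" .
    have cls: "(\<Sum>j<N. t j * (if c j = h then 1 else 0)) = 1" if "h \<in> G" for h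
      using t[of "Inr h"] that by (simp add: I_def b_def A_def column_def)
    have "(\<Sum>j<N. t j * y (Inr (c j))) = (\<Sum>j<N. t j * (\<Sum>h\<in>G. y (Inr h) * (if c j = h then 1 else 0)))"
      using cG finite_G by (intro sum.cong refl) (simp add: if_distrib sum.delta cong: if_cong)
    also have "\<dots> = (\<Sum>h\<in>G. y (Inr h) * (\<Sum>j<N. t j * (if c j = h then 1 else 0)))"
      by (rule sum_mult_sum_swap)
    also have "\<dots> = (\<Sum>h\<in>G. y (Inr h))"
      using cls by (intro sum.cong) auto
    finally have 2: "(\<Sum>j<N. t j * y (Inr (c j))) = (\<Sum>h\<in>G. y (Inr h))" .
    have "(\<Sum>j<N. t j * inner (W (c j)) (d (c j))) = (\<Sum>j<N. t j * (if c j = g1 then 1 else 0)) * (s * inner (W g1) (W g1))"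
      unfolding sum_distrib_right by (intro sum.cong) (auto simp: d_def)
    also have "\<dots> = (\<Sum>h\<in>G. y (Inr h)) + 1"
      using cls[OF g1(1)] g1(2) by (simp add: s_def)
    finally have 3: "(\<Sum>j<N. t j * inner (W (c j)) (d (c j))) = (\<Sum>h\<in>G. y (Inr h)) + 1" .
    have "inner (W (c j)) (X2 j) = inner (W (c j)) (d (c j)) - y (Inr (c j))" if "j < N" for j
      using y'[OF that] by (simp add: X2_def inner_add_right algebra_simps)
    then have "(\<Sum>j<N. t j * inner (W (c j)) (X2 j)) = (\<Sum>j<N. t j * inner (W (c j)) (d (c j))) - (\<Sum>j<N. t j * y (Inr (c j)))"
      unfolding sum_subtractf[symmetric] by (intro sum.cong) (auto simp: right_diff_distrib)
    then show False using 1 2 3 by simp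
  qed
  then have "AE X in PiM {..<N} (\<lambda>_. lborel). \<not> in_span I {..<N} (\<lambda>j. A j (X j)) b"
  proof (rule AE_not_in_span[where ?X0.0 = X2 and C = C and I = I and A = A, OF finI finite_lessThan C, rotated -1])
    show "affine_functional (\<lambda>x. A j x i)" for j i
    proof (cases i)
      case (Inl p)
      then show ?thesis
        unfolding affine_functional_def A_def column_def
        by (intro exI[of _ 0] exI[of _ "w p (c j)"]) simp
    next
      case (Inr h)
      then show ?thesis by (simp add: A_def column_def affine_functional_const)
    qed
  qed (rule ind2 max; assumption?)+
  then show ?thesis
  proof eventually_elim
    case (elim X)
    show ?case
    proof (intro allI impI notI)
      fix t assume sol: "solution N X c t"
        and eq: "class_point N c t X (e a0) $ a0 = class_point N c t X g0 $ a0"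
      have "b i = (\<Sum>j<N. t j * A j (X j) i)" if "i \<in> I" for i
      proof (cases i)
        case (Inl p)
        obtain a h where p: "p = (a, h)" by (cases p)
        have ah: "(a, h) \<in> C'" using that Inl p by (auto simp: I_def)
        have "(\<Sum>j<N. t j * A j (X j) i) = (\<Sum>g\<in>G. inner (w (a, h) g) (class_point N c t X g))"
          using c unfolding Inl p A_def column_def by (simp add: sum_inner_class_point[of c] PiE_iff Pi_iff)
        also have "\<dots> = class_point N c t X h $ a - class_point N c t X g0 $ a
            - inner (v a h) (class_point N c t X (e a) - class_point N c t X g0)"
          using snd_C'[OF ah] by (intro sum_inner_w) simp
        also have "\<dots> = 0"
        proof (cases "(a, h) \<in> conditions")
          case True
          then have "h \<in> G - {g0, e a}" by (simp add: conditions_def)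
          with sol have "class_point N c t X h $ a = class_point N c t X g0 $ a
              + inner (v a h) (class_point N c t X (e a) - class_point N c t X g0)"
            unfolding solution_def by blast
          then show ?thesis by simp
        next
          case False
          then have "a = a0" "h = e a0" using ah by (simp_all add: C'_def)
          then show ?thesis using eq v_e by simp
        qed
        finally show ?thesis using Inl by (simp add: b_def)
      next
        case (Inr h)
        then have "h \<in> G" using that by (auto simp: I_def)
        have "(\<Sum>j<N. t j * A j (X j) i) = (\<Sum>j\<in>{j\<in>{..<N}. c j = h}. t j)"
          unfolding Inr A_def column_def
          by (subst sum.inter_filter) (auto intro!: sum.cong)
        also have "\<dots> = 1" using sol \<open>h \<in> G\<close> unfolding solution_def by blast
        finally show ?thesis using Inr by (simp add: b_def)
      qed
      then have "in_span I {..<N} (\<lambda>j. A j (X j)) b"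
        unfolding in_span_def by blast
      then show False using elim by blast
    qed
  qed
qed

text \<open>Only finitely many labellings and coordinates occur, so the exceptional null sets can be
  united.\<close>

lemma AE_nondegenerate:
  assumes "N \<le> card conditions + card G"
  shows "AE X in PiM {..<N} (\<lambda>_. lborel). \<forall>c t a. solution N X c t \<longrightarrow>
    class_point N c t X (e a) $ a \<noteq> class_point N c t X g0 $ a"
proof -
  have "finite ({..<N} \<rightarrow>\<^sub>E G)"
    using finite_G by (intro finite_PiE) auto
  then have "AE X in PiM {..<N} (\<lambda>_. lborel). \<forall>c\<in>{..<N} \<rightarrow>\<^sub>E G. \<forall>a\<in>UNIV. \<forall>t. solution N X c t \<longrightarrow>
      class_point N c t X (e a) $ a \<noteq> class_point N c t X g0 $ a"
    using AE_not_degenerate_solution[OF assms] by (intro AE_finite_allI) auto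
  then show ?thesis
    by eventually_elim (auto simp: solution_def)
qed

end

section \<open>Characters of finite abelian groups\<close>

abbreviation zeta :: "nat \<Rightarrow> complex" where
  "zeta n \<equiv> cis (2 * pi / real n)"

lemma zeta_powi_nonneg: "0 \<le> a \<Longrightarrow> zeta n powi a = cis (2 * pi * real (nat a) / real n)"
  by (simp only: power_int_nonneg_exp Complex.DeMoivre times_divide_eq_right mult.commute)

lemma zeta_powi_inj:
  assumes "a \<in> {0..<int n}" "b \<in> {0..<int n}" "zeta n powi a = zeta n powi b"
  shows "a = b"
proof -
  have "n > 0" using assms(1) by (cases n) auto
  then have "inj_on (\<lambda>k. cis (2 * pi * real k / real n)) {..<n}"
    using bij_betw_imp_inj_on[OF Complex.bij_betw_roots_unity] by simp
  moreover have "cis (2 * pi * real (nat a) / real n) = cis (2 * pi * real (nat b) / real n)"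
    using assms by (simp only: zeta_powi_nonneg[symmetric] atLeastLessThan_iff)
  ultimately have "nat a = nat b"
    using assms(1,2) by (auto simp: inj_on_def)
  then show ?thesis using assms(1,2) by auto
qed

lemma zeta_pow_n: "n > 0 \<Longrightarrow> zeta n ^ n = 1"
  by (simp add: Complex.DeMoivre)

lemma zeta_neq_one: "n \<ge> 2 \<Longrightarrow> zeta n \<noteq> 1"
  using zeta_powi_inj[of 1 n 0] by auto

lemma sum_zeta_powi:
  assumes n: "n > 0" and a: "a \<in> {0..<int n}" and b: "b \<in> {0..<int n}" and "a \<noteq> b"
  shows "(\<Sum>s\<in>{0..<int n}. zeta n powi ((a - b) * s)) = 0"
proof -
  define z where "z = zeta n powi (a - b)"
  have "z \<noteq> 1"
  proof
    assume "z = 1"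
    then have "zeta n powi a = zeta n powi b"
      unfolding z_def by (simp add: power_int_diff)
    then show False using zeta_powi_inj[OF a b] \<open>a \<noteq> b\<close> by blast
  qed
  have "z ^ n = (zeta n ^ n) powi (a - b)"
    unfolding z_def by (simp add: power_int_power power_int_power' mult.commute)
  then have "z ^ n = 1" using zeta_pow_n[OF n] by simp
  have "(\<Sum>s\<in>{0..<int n}. zeta n powi ((a - b) * s)) = (\<Sum>s<n. z ^ s)"
    by (rule sum.reindex_bij_witness[where i = int and j = nat])
       (auto simp: z_def power_int_mult power_int_nonneg_exp)
  also have "\<dots> = 0"
    using geometric_sum[OF \<open>z \<noteq> 1\<close>, of n] \<open>z ^ n = 1\<close> by simp
  finally show ?thesis .
qed

text \<open>Positive moduli matter: for modulus 0 the factor would be the group of all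
  integers.\<close>

lemma carrier_cyclic_sum:
  assumes "\<And>j. j < l \<Longrightarrow> q j \<ge> 1"
  shows "carrier (cyclic_sum l q) = (\<Pi>\<^sub>E j\<in>{..<l}. {0..<int (q j)})"
  unfolding cyclic_sum_def carrier_product_group using assms
  by (intro PiE_cong) (force simp: carrier_integer_mod_group)

lemma group_cyclic_sum: "group (cyclic_sum l q)"
  unfolding cyclic_sum_def by simp

lemma card_cyclic_sum:
  assumes "\<And>j. j < l \<Longrightarrow> q j \<ge> 1"
  shows "card (carrier (cyclic_sum l q)) = (\<Prod>j<l. q j)"
  by (simp add: carrier_cyclic_sum[of l q, OF assms] card_PiE)

lemma finite_cyclic_sum:
  assumes "\<And>j. j < l \<Longrightarrow> q j \<ge> 1"
  shows "finite (carrier (cyclic_sum l q))"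
  by (subst carrier_cyclic_sum[of l q, OF assms]) (auto intro: finite_PiE)

lemma one_cyclic_sum: "\<one>\<^bsub>cyclic_sum l q\<^esub> = (\<lambda>j\<in>{..<l}. 0)"
  by (simp add: cyclic_sum_def)

text \<open>The sum over the product group factors into sums over the cyclic groups, and a factor in
  which \<open>a\<close> and \<open>h\<close> differ is a vanishing geometric sum.\<close>

lemma group_character_orthogonal:
  assumes q: "\<And>j. j < l \<Longrightarrow> q j \<ge> 1"
    and a: "a \<in> carrier (cyclic_sum l q)" and h: "h \<in> carrier (cyclic_sum l q)" and "a \<noteq> h"
  shows "(\<Sum>g\<in>carrier (cyclic_sum l q). group_character l q a g * inverse (group_character l q h g)) = 0"
proof -
  have car: "carrier (cyclic_sum l q) = (\<Pi>\<^sub>E j\<in>{..<l}. {0..<int (q j)})"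
    by (rule carrier_cyclic_sum) (rule q)
  obtain j where j: "j < l" "a j \<noteq> h j"
  proof -
    have "\<exists>j<l. a j \<noteq> h j"
    proof (rule ccontr)
      assume "\<not> ?thesis"
      then have "a = h"
        using a h unfolding car by (intro PiE_ext[of a "{..<l}" "\<lambda>j. {0..<int (q j)}" h]) auto
      then show False using \<open>a \<noteq> h\<close> by blast
    qed
    then show ?thesis using that by blast
  qed
  have "group_character l q a g * inverse (group_character l q h g) =
      (\<Prod>j<l. zeta (q j) powi ((a j - h j) * g j))" for g
    unfolding group_character_def prod_inversef[symmetric] prod.distrib[symmetric]
    by (intro prod.cong)
       (auto simp: power_int_diff left_diff_distrib divide_inverse)
  then have "(\<Sum>g\<in>carrier (cyclic_sum l q). group_character l q a g * inverse (group_character l q h g)) =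
      (\<Prod>j<l. \<Sum>s\<in>{0..<int (q j)}. zeta (q j) powi ((a j - h j) * s))"
    by (simp add: car prod_sum_PiE)
  also have "\<dots> = 0"
  proof (rule prod_zero)
    have "(\<Sum>s\<in>{0..<int (q j)}. zeta (q j) powi ((a j - h j) * s)) = 0"
      using j a h q[of j] by (intro sum_zeta_powi) (auto simp: car PiE_iff)
    then show "\<exists>j\<in>{..<l}. (\<Sum>s\<in>{0..<int (q j)}. zeta (q j) powi ((a j - h j) * s)) = 0"
      using j by blast
  qed simp
  finally show ?thesis .
qed

text \<open>A half system: one element of each pair \<open>{h, -h}\<close>, and all elements of order two.\<close>

lemma half_system:
  assumes "finite Z" and inv: "\<And>h. h \<in> Z \<Longrightarrow> \<iota> h \<in> Z" "\<And>h. h \<in> Z \<Longrightarrow> \<iota> (\<iota> h) = h"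
  shows "\<exists>T\<subseteq>Z. (\<forall>h\<in>T. \<iota> h \<noteq> h \<longrightarrow> \<iota> h \<notin> T) \<and> card Z + card {h \<in> T. \<iota> h = h} = 2 * card T"
proof -
  obtain f :: "_ \<Rightarrow> nat" where f: "inj_on f Z"
    using finite_imp_inj_to_nat_seg[OF assms(1)] by blast
  \<comment> \<open>The injection orders each pair and the smaller element is kept; fixed points
    pass the test by equality and form the intersection of \<open>T\<close> with its image.\<close>
  define T where "T = {h \<in> Z. f h \<le> f (\<iota> h)}"
  have finT: "finite T" unfolding T_def using assms(1) by simp
  have eq: "\<iota> h = h" if "h \<in> T" "\<iota> h \<in> T" for h
    using that inv f by (auto simp: T_def inj_on_eq_iff)
  have inj: "inj_on \<iota> T"
    using inv by (intro inj_onI) (metis (no_types, lifting) T_def mem_Collect_eq)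
  have "Z = T \<union> \<iota> ` T"
  proof
    show "Z \<subseteq> T \<union> \<iota> ` T"
    proof
      fix h assume h: "h \<in> Z"
      show "h \<in> T \<union> \<iota> ` T"
      proof (cases "f h \<le> f (\<iota> h)")
        case True
        then show ?thesis using h by (simp add: T_def)
      next
        case False
        then have "\<iota> h \<in> T" using h inv by (simp add: T_def)
        then show ?thesis using inv(2)[OF h] by (metis UnI2 imageI)
      qed
    qed
  qed (use inv in \<open>auto simp: T_def\<close>)
  moreover have "T \<inter> \<iota> ` T = {h \<in> T. \<iota> h = h}"
    using eq inv by (force simp: T_def)
  ultimately have "card Z + card {h \<in> T. \<iota> h = h} = 2 * card T"
    using card_Un_Int[OF finT, of "\<iota> ` T"] finT card_image[OF inj] by simp
  then show ?thesis
    using eq by (intro exI[of _ T]) (auto simp: T_def)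
qed

text \<open>Translates the elements of order two in an admissible choice into fixed points of
  inversion, which \<open>half_system\<close> counts.\<close>

lemma (in group) ord_two_iff:
  assumes "x \<in> carrier G"
  shows "ord x = 2 \<longleftrightarrow> x \<noteq> \<one> \<and> inv x = x"
proof -
  have sq: "inv x = x \<longleftrightarrow> x [^] (2 :: nat) = \<one>"
  proof
    assume "inv x = x"
    then show "x [^] (2 :: nat) = \<one>"
      using assms l_inv[of x] by (simp add: numeral_2_eq_2)
  next
    assume "x [^] (2 :: nat) = \<one>"
    then show "inv x = x"
      using assms inv_equality[of x x] by (simp add: numeral_2_eq_2)
  qed
  have "ord x = 2 \<longleftrightarrow> x \<noteq> \<one> \<and> x [^] (2 :: nat) = \<one>"
  proof
    assume "ord x = 2"
    then show "x \<noteq> \<one> \<and> x [^] (2 :: nat) = \<one>"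
      using pow_ord_eq_1[OF assms] ord_eq_1[OF assms] by auto
  next
    assume "x \<noteq> \<one> \<and> x [^] (2 :: nat) = \<one>"
    then have "ord x dvd 2" "ord x \<noteq> 1"
      using pow_eq_id[OF assms, of 2] ord_eq_1[OF assms] by simp_all
    then show "ord x = 2"
      using two_is_prime_nat unfolding prime_nat_iff by blast
  qed
  then show ?thesis using sq by simp
qed

section \<open>Coordinate planes and cyclic factors\<close>

text \<open>\<open>\<alpha> i\<close> and \<open>\<beta> i\<close> are the real and imaginary axes
  of the i-th plane. For d' = 1 the axis \<open>\<alpha> k\<close> is the remaining line, paired
  with the cyclic factor of order two, so the even and the odd case share one argument.\<close>

locale coordinate_split =
  fixes k d' :: nat and q :: "nat \<Rightarrow> nat" and \<alpha> \<beta> :: "nat \<Rightarrow> 'n::finite"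
  assumes d'_le: "d' \<le> 1" and q_ge: "\<And>i. i < k + d' \<Longrightarrow> q i \<ge> 2" and q_last: "d' = 1 \<Longrightarrow> q k = 2"
    and inj_\<alpha>: "inj_on \<alpha> {..<k + d'}" and inj_\<beta>: "inj_on \<beta> {..<k}"
    and disj: "\<alpha> ` {..<k + d'} \<inter> \<beta> ` {..<k} = {}"
    and cover: "\<alpha> ` {..<k + d'} \<union> \<beta> ` {..<k} = UNIV"
begin

abbreviation "l \<equiv> k + d'"

abbreviation "G \<equiv> carrier (cyclic_sum l q)"

definition zero :: "nat \<Rightarrow> int" where
  "zero = (\<lambda>j\<in>{..<l}. 0)"

definition unit :: "nat \<Rightarrow> nat \<Rightarrow> int" where
  "unit i = (\<lambda>j\<in>{..<l}. if j = i then 1 else 0)"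

definition factor :: "'n \<Rightarrow> nat" where
  "factor a = (SOME i. i < l \<and> (a = \<alpha> i \<or> i < k \<and> a = \<beta> i))"

text \<open>The interpolation coefficient: a function C0 + C1 zeta^s with values y0 at s = 0 and y1
  at s = 1 equals y0 + ratio (y1 - y0) at s = \<open>h i\<close>.\<close>

definition ratio :: "nat \<Rightarrow> (nat \<Rightarrow> int) \<Rightarrow> complex" where
  "ratio i h = (zeta (q i) powi (h i) - 1) / (zeta (q i) - 1)"

text \<open>The value at \<open>unit (factor a)\<close> is overwritten by \<open>0\<close> because the locale
  \<open>affine_system\<close> uses that slot for the nondegeneracy condition.\<close>

definition v :: "'n \<Rightarrow> (nat \<Rightarrow> int) \<Rightarrow> real ^ 'n" where
  "v a h = (let i = factor a; c = ratio i h in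
     if h = unit i then 0
     else if a = \<alpha> i then Re c *\<^sub>R axis (\<alpha> i) 1 - (if i < k then Im c *\<^sub>R axis (\<beta> i) 1 else 0)
     else Im c *\<^sub>R axis (\<alpha> i) 1 + Re c *\<^sub>R axis (\<beta> i) 1)"

definition \<sigma> :: "nat \<Rightarrow> real ^ 'n \<Rightarrow> complex" where
  "\<sigma> i = (if i < k then (\<lambda>y. Complex (y $ \<alpha> i) (y $ \<beta> i)) else (\<lambda>y. complex_of_real (y $ \<alpha> i)))"

lemma \<alpha>_eq: "i < l \<Longrightarrow> j < l \<Longrightarrow> \<alpha> i = \<alpha> j \<longleftrightarrow> i = j"
  using inj_\<alpha> by (auto simp: inj_on_eq_iff)

lemma \<beta>_eq: "i < k \<Longrightarrow> j < k \<Longrightarrow> \<beta> i = \<beta> j \<longleftrightarrow> i = j"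
  using inj_\<beta> by (auto simp: inj_on_eq_iff)

lemma \<alpha>_neq_\<beta>: "i < l \<Longrightarrow> j < k \<Longrightarrow> \<alpha> i \<noteq> \<beta> j"
  using disj by blast

lemma coordinate_cases:
  obtains i where "i < l" "a = \<alpha> i" | i where "i < k" "a = \<beta> i"
  using cover by blast

lemma factor_\<alpha>: "i < l \<Longrightarrow> factor (\<alpha> i) = i"
  unfolding factor_def using \<alpha>_eq \<alpha>_neq_\<beta> by (intro some_equality) blast+

lemma factor_\<beta>: "i < k \<Longrightarrow> factor (\<beta> i) = i"
  unfolding factor_def using \<beta>_eq \<alpha>_neq_\<beta> by (intro some_equality) (metis trans_less_add1)+

lemma factor_less: "factor a < l"
  by (cases a rule: coordinate_cases) (auto simp: factor_\<alpha> factor_\<beta>)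

lemma q_ge_one: "i < l \<Longrightarrow> 1 \<le> q i"
  using q_ge[of i] by simp

lemma carrier_G: "G = (\<Pi>\<^sub>E j\<in>{..<l}. {0..<int (q j)})"
  by (rule carrier_cyclic_sum) (rule q_ge_one)

lemma mem_G: "h \<in> G \<Longrightarrow> j < l \<Longrightarrow> h j \<in> {0..<int (q j)}"
  unfolding carrier_G by (drule PiE_mem[where x = j]) simp_all

lemma finite_G': "finite G"
  by (rule finite_cyclic_sum) (rule q_ge_one)

lemma card_G: "card G = (\<Prod>j<l. q j)"
  by (rule card_cyclic_sum) (rule q_ge_one)

lemma zero_one: "zero = \<one>\<^bsub>cyclic_sum l q\<^esub>"
  by (simp add: zero_def one_cyclic_sum)

lemma zero_in: "zero \<in> G"
  unfolding carrier_G zero_def using q_ge_one by (auto simp: Suc_le_eq)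

lemma unit_in: "unit i \<in> G"
proof -
  have "(if j = i then 1 else 0) \<in> {0..<int (q j)}" if "j < l" for j
    using q_ge[OF that] by (cases "j = i") auto
  then show ?thesis
    unfolding carrier_G unit_def by (simp add: restrict_PiE_iff)
qed

lemma unit_neq_zero: "i < l \<Longrightarrow> unit i \<noteq> zero"
  by (auto simp: unit_def zero_def fun_eq_iff)

lemma card_n: "CARD('n) = 2 * k + d'"
proof -
  have "CARD('n) = card (\<alpha> ` {..<l}) + card (\<beta> ` {..<k})"
    unfolding cover[symmetric] by (rule card_Un_disjoint) (use disj in auto)
  then show ?thesis
    by (simp add: card_image inj_\<alpha> inj_\<beta>)
qed

lemma v_support:
  assumes "v a h $ b \<noteq> 0"
  shows "factor b = factor a"
proof -
  define i where "i = factor a"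
  have il: "i < l" using factor_less by (simp add: i_def)
  show ?thesis
  proof (cases a rule: coordinate_cases)
    case (1 i')
    then have "b = \<alpha> i \<or> i < k \<and> b = \<beta> i"
      using assms unfolding v_def Let_def i_def[symmetric]
      by (auto simp: axis_def factor_\<alpha> i_def split: if_splits)
    then show ?thesis using il factor_\<alpha> factor_\<beta> i_def by auto
  next
    case (2 i')
    then have "i < k" "i = i'" by (auto simp: i_def factor_\<beta>)
    then have "b = \<alpha> i \<or> b = \<beta> i"
      using assms unfolding v_def Let_def i_def[symmetric]
      by (auto simp: axis_def split: if_splits)
    then show ?thesis using il \<open>i < k\<close> factor_\<alpha> factor_\<beta> i_def by auto
  qed
qed

text \<open>Both axes of a plane have the same second base point, because multiplication by a
  complex ratio mixes them.\<close>

sublocale affine_system G zero "\<lambda>a. unit (factor a)" v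
proof
  show "v a (unit (factor a)) = 0" for a by (simp add: v_def)
  show "unit (factor b) = unit (factor a)" if "v a g $ b \<noteq> 0" for a g b
    using v_support[OF that] by simp
qed (use finite_G' zero_in unit_in unit_neq_zero factor_less in auto)

lemma card_conditions': "card conditions = (2 * k + d') * (card G - 2)"
  using card_conditions card_n by simp

lemma zeta_neq_one': "i < l \<Longrightarrow> zeta (q i) \<noteq> 1"
  using zeta_neq_one q_ge by blast

lemma zeta_last: "d' = 1 \<Longrightarrow> zeta (q k) = - 1"
  using q_last by simp

text \<open>The conditions for \<open>\<alpha> i\<close> and \<open>\<beta> i\<close> are the real
  and imaginary parts of one complex equation, the two vectors \<open>v\<close> being the rows of
  the matrix of multiplication by \<open>ratio i h\<close>.\<close>

lemma \<sigma>_solution: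
  assumes sol: "solution N X c t" and i: "i < l" and h: "h \<in> G"
  shows "\<sigma> i (class_point N c t X h) = \<sigma> i (class_point N c t X zero)
    + ratio i h * (\<sigma> i (class_point N c t X (unit i)) - \<sigma> i (class_point N c t X zero))"
proof -
  define x where "x = class_point N c t X"
  have eq: "x h $ a = x zero $ a + inner (v a h) (x (unit (factor a)) - x zero)"
    if "h \<noteq> zero" "h \<noteq> unit (factor a)" for a
    using sol that h unfolding solution_def x_def by blast
  consider "h = zero" | "h = unit i" | "h \<noteq> zero" "h \<noteq> unit i" by blast
  then have "\<sigma> i (x h) = \<sigma> i (x zero) + ratio i h * (\<sigma> i (x (unit i)) - \<sigma> i (x zero))"
  proof cases
    case 1
    then show ?thesis using i by (simp add: ratio_def zero_def)
  next
    case 2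
    then show ?thesis using i zeta_neq_one'[OF i] by (simp add: ratio_def unit_def)
  next
    case 3
    note eq\<alpha> = eq[of "\<alpha> i"]
    show ?thesis
    proof (cases "i < k")
      case True
      have "x h $ \<alpha> i = x zero $ \<alpha> i + Re (ratio i h) * (x (unit i) - x zero) $ \<alpha> i
          - Im (ratio i h) * (x (unit i) - x zero) $ \<beta> i"
        using eq[of "\<alpha> i"] 3 True i
        by (simp add: v_def Let_def factor_\<alpha> inner_diff_left inner_axis')
      moreover have "x h $ \<beta> i = x zero $ \<beta> i + Im (ratio i h) * (x (unit i) - x zero) $ \<alpha> i
          + Re (ratio i h) * (x (unit i) - x zero) $ \<beta> i"
        using eq[of "\<beta> i"] 3 True i \<alpha>_neq_\<beta>[OF i True]
        by (simp add: v_def Let_def factor_\<beta> inner_add_left inner_axis')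
      ultimately show ?thesis
        using True by (simp add: \<sigma>_def complex_eq_iff algebra_simps)
    next
      case False
      then have "i = k" "d' = 1" using i d'_le by auto
      have "h k \<in> {0..<2}"
        using mem_G[OF h i] q_last[OF \<open>d' = 1\<close>] by (simp add: \<open>i = k\<close>)
      then have "h k = 0 \<or> h k = 1" by auto
      \<comment> \<open>For order two the ratio is 0 or 1, so one real equation carries all of
        it.\<close>
      then have "Im (ratio i h) = 0"
        using zeta_last[OF \<open>d' = 1\<close>] by (auto simp: ratio_def \<open>i = k\<close>)
      moreover have "x h $ \<alpha> i = x zero $ \<alpha> i + Re (ratio i h) * (x (unit i) - x zero) $ \<alpha> i"
        using eq[of "\<alpha> i"] 3 False i
        by (simp add: v_def Let_def factor_\<alpha> inner_axis')
      ultimately show ?thesis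
        using False by (simp add: \<sigma>_def complex_eq_iff)
    qed
  qed
  then show ?thesis by (simp add: x_def)
qed

lemma \<sigma>_solution_character:
  assumes sol: "solution N X c t" and i: "i < l"
  shows "\<exists>C0 C1. (\<forall>h\<in>G. \<sigma> i (class_point N c t X h) = C0 + C1 * zeta (q i) powi (h i)) \<and>
    (C1 = 0 \<longleftrightarrow> \<sigma> i (class_point N c t X (unit i)) = \<sigma> i (class_point N c t X zero))"
proof -
  let ?s = "\<lambda>h. \<sigma> i (class_point N c t X h)"
  define C1 where "C1 = (?s (unit i) - ?s zero) / (zeta (q i) - 1)"
  have "?s h = (?s zero - C1) + C1 * zeta (q i) powi (h i)" if "h \<in> G" for h
  proof -
    have "ratio i h * (?s (unit i) - ?s zero) = C1 * (zeta (q i) powi (h i) - 1)"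
      by (simp add: C1_def ratio_def)
    then show ?thesis
      unfolding \<sigma>_solution[OF sol i that] by (simp only: right_diff_distrib mult_1_right) simp
  qed
  then show ?thesis
    using zeta_neq_one'[OF i] by (intro exI[of _ "?s zero - C1"] exI[of _ C1]) (auto simp: C1_def)
qed

end

section \<open>Vertices of multiprisms\<close>

lemma span_two: "span {a, b :: 'a::real_vector} = {s *\<^sub>R a + t *\<^sub>R b | s t. True}"
proof -
  have "x \<in> span {a, b} \<longleftrightarrow> (\<exists>s t. x = s *\<^sub>R a + t *\<^sub>R b)" for x
    unfolding span_breakdown_eq by (auto simp: algebra_simps)
  then show ?thesis by blast
qed

context coordinate_split
begin

definition embed :: "nat \<Rightarrow> complex \<Rightarrow> real ^ 'n" where
  "embed i z = Re z *\<^sub>R axis (\<alpha> i) 1 + Im z *\<^sub>R axis (\<beta> i) 1"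

lemma embed_add: "embed i (y + z) = embed i y + embed i z"
  by (simp add: embed_def algebra_simps)

lemma embed_scale: "embed i (of_real s * z) = s *\<^sub>R embed i z"
  by (simp add: embed_def algebra_simps)

lemma inner_embed:
  assumes "i < k" "j < k"
  shows "inner (embed i y) (embed j z) = (if i = j then Re y * Re z + Im y * Im z else 0)"
  using assms \<alpha>_eq[of i j] \<beta>_eq[of i j] \<alpha>_neq_\<beta>[of i j] \<alpha>_neq_\<beta>[of j i]
  by (auto simp: embed_def inner_add_left inner_add_right inner_axis_axis)

lemma plane_eq: "span {axis (\<alpha> i) 1, axis (\<beta> i) 1} = range (embed i)"
proof -
  have "s *\<^sub>R axis (\<alpha> i) 1 + t *\<^sub>R axis (\<beta> i) 1 = embed i (Complex s t)" for s t
    by (simp add: embed_def)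
  then have "span {axis (\<alpha> i) 1, axis (\<beta> i) 1} = {embed i (Complex s t) | s t. True}"
    unfolding span_two by simp
  also have "\<dots> = range (embed i)"
    by (auto simp: image_iff) (metis complex_surj)
  finally show ?thesis .
qed

lemma embed_components:
  assumes "i < k"
  shows "j < l \<Longrightarrow> embed i z $ \<alpha> j = (if i = j then Re z else 0)"
    and "j < k \<Longrightarrow> embed i z $ \<beta> j = (if i = j then Im z else 0)"
  using assms \<alpha>_eq[of i j] \<beta>_eq[of i j] \<alpha>_neq_\<beta>[of i j] \<alpha>_neq_\<beta>[of j i]
  by (auto simp: embed_def axis_def)

lemma vector_decomposition:
  "y = (\<Sum>i<k. embed i (\<sigma> i y)) + (if d' = 1 then y $ \<alpha> k *\<^sub>R axis (\<alpha> k) 1 else 0)"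
proof (rule Finite_Cartesian_Product.vec_eq_iff[THEN iffD2], rule allI)
  fix a
  show "y $ a = ((\<Sum>i<k. embed i (\<sigma> i y)) + (if d' = 1 then y $ \<alpha> k *\<^sub>R axis (\<alpha> k) 1 else 0)) $ a"
  proof (cases a rule: coordinate_cases)
    case (1 j)
    have "(\<Sum>i<k. embed i (\<sigma> i y) $ \<alpha> j) = (\<Sum>i<k. if i = j then y $ \<alpha> j else 0)"
      using 1 by (intro sum.cong) (auto simp: embed_components \<sigma>_def)
    also have "\<dots> = (if j < k then y $ \<alpha> j else 0)"
      by simp
    finally have "(\<Sum>i<k. embed i (\<sigma> i y)) $ \<alpha> j = (if j < k then y $ \<alpha> j else 0)"
      by simp
    moreover have "(if d' = 1 then y $ \<alpha> k *\<^sub>R axis (\<alpha> k) 1 else 0) $ \<alpha> j = (if j < k then 0 else y $ \<alpha> j)"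
    proof (cases "d' = 1")
      case True
      then show ?thesis using \<alpha>_eq[of k j] 1 by (auto simp: axis_def)
    next
      case False
      then show ?thesis using 1 d'_le by simp
    qed
    ultimately show ?thesis using 1 by simp
  next
    case (2 j)
    have "(\<Sum>i<k. embed i (\<sigma> i y) $ \<beta> j) = (\<Sum>i<k. if i = j then y $ \<beta> j else 0)"
      using 2 by (intro sum.cong) (auto simp: embed_components \<sigma>_def)
    also have "\<dots> = y $ \<beta> j"
      using 2 by simp
    finally have "(\<Sum>i<k. embed i (\<sigma> i y)) $ \<beta> j = y $ \<beta> j"
      by simp
    moreover have "(if d' = 1 then y $ \<alpha> k *\<^sub>R axis (\<alpha> k) 1 else 0) $ \<beta> j = 0"
      using \<alpha>_neq_\<beta>[of k j] 2 by (cases "d' = 1") (simp_all add: axis_def)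
    ultimately show ?thesis using 2 by simp
  qed
qed

lemma regular_polygon_embed:
  assumes i: "i < k" and "C1 \<noteq> 0"
  shows "regular_polygon (q i) (span {axis (\<alpha> i) 1, axis (\<beta> i) 1})
    {embed i (C0 + C1 * zeta (q i) powi int j) | j. j < q i}"
proof -
  let ?W = "span {axis (\<alpha> i) 1, axis (\<beta> i) 1 :: real ^ 'n}"
  have "\<alpha> i \<noteq> \<beta> i" using i \<alpha>_neq_\<beta>[of i i] by simp
  then have "card {axis (\<alpha> i) 1, axis (\<beta> i) 1 :: real ^ 'n} = 2"
    by (simp add: axis_eq_axis)
  moreover have "independent {axis (\<alpha> i) 1, axis (\<beta> i) 1 :: real ^ 'n}"
    using \<open>\<alpha> i \<noteq> \<beta> i\<close>
    by (intro pairwise_orthogonal_independent)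
       (auto simp: pairwise_def real_inner_class.orthogonal_def inner_axis_axis axis_eq_0_iff)
  ultimately have dim: "dim ?W = 2"
    by (simp add: dim_eq_card_independent)
  \<comment> \<open>Multiplication by the imaginary unit is the quarter turn, which supplies the
    second, orthogonal vector of equal length.\<close>
  have "embed i (C0 + C1 * zeta (q i) powi int j) = embed i C0
      + cos (2 * pi * real j / real (q i)) *\<^sub>R embed i C1
      + sin (2 * pi * real j / real (q i)) *\<^sub>R embed i (\<i> * C1)" for j
  proof -
    have "zeta (q i) powi int j = cis (2 * pi * real j / real (q i))"
      using zeta_powi_nonneg[of "int j" "q i"] by simp
    then have "C1 * zeta (q i) powi int j =
        of_real (cos (2 * pi * real j / real (q i))) * C1 + of_real (sin (2 * pi * real j / real (q i))) * (\<i> * C1)"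
      by (simp add: complex_eq_iff algebra_simps)
    then show ?thesis
      by (simp only: embed_add embed_scale add.assoc)
  qed
  then have set: "{embed i (C0 + C1 * zeta (q i) powi int j) | j. j < q i} =
      {embed i C0 + cos (2 * pi * real j / real (q i)) *\<^sub>R embed i C1
        + sin (2 * pi * real j / real (q i)) *\<^sub>R embed i (\<i> * C1) | j. j < q i}"
    by simp
  have "real_inner_class.orthogonal (embed i C1) (embed i (\<i> * C1))"
    using i by (simp add: real_inner_class.orthogonal_def inner_embed)
  moreover have "norm (embed i C1) = norm (embed i (\<i> * C1))"
    using i by (simp add: norm_eq_sqrt_inner inner_embed)
  moreover have "embed i C1 \<noteq> 0"
  proof
    assume "embed i C1 = 0"
    then have "inner (embed i C1) (embed i C1) = 0" by simp
    then have "C1 = 0"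
      using i by (simp add: inner_embed complex_eq_iff sum_squares_eq_zero_iff)
    then show False using \<open>C1 \<noteq> 0\<close> by simp
  qed
  moreover have "embed i z \<in> ?W" for z
    unfolding plane_eq by simp
  ultimately show ?thesis
    unfolding regular_polygon_def set using dim subspace_span by blast
qed

text \<open>From here on only the character form of the components is used. \<open>r\<close> is
  compared with \<open>q\<close> below \<open>k\<close> because in the odd case \<open>q\<close> has
  the additional entry 2 at \<open>k\<close>.\<close>

context
  fixes x :: "(nat \<Rightarrow> int) \<Rightarrow> real ^ 'n" and C0 C1 :: "nat \<Rightarrow> complex"
    and r :: "nat \<Rightarrow> nat" and U :: "nat \<Rightarrow> (real ^ 'n) set"
  assumes x: "\<And>i h. i < l \<Longrightarrow> h \<in> G \<Longrightarrow> \<sigma> i (x h) = C0 i + C1 i * zeta (q i) powi (h i)"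
    and C1: "\<And>i. i < l \<Longrightarrow> C1 i \<noteq> 0"
    and r: "\<And>i. i < k \<Longrightarrow> r i = q i"
    and U: "\<And>i. i < k \<Longrightarrow> U i = span {axis (\<alpha> i) 1, axis (\<beta> i) 1}"
begin

definition V :: "nat \<Rightarrow> (real ^ 'n) set" where
  "V i = {embed i (C0 i + C1 i * zeta (q i) powi int j) | j. j < q i}"

lemma x_inj: "inj_on x G"
proof (rule inj_onI)
  fix g h assume gh: "g \<in> G" "h \<in> G" "x g = x h"
  have "g i = h i" if "i \<in> {..<l}" for i
  proof -
    have "zeta (q i) powi (g i) = zeta (q i) powi (h i)"
      using x[of i g] x[of i h] gh that C1[of i] by simp
    then show ?thesis
      using zeta_powi_inj[of "g i" "q i" "h i"] mem_G gh that by simp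
  qed
  then show "g = h"
    using gh(1,2) unfolding carrier_G by (intro PiE_ext) blast+
qed

lemma planes_orthogonal: "pairwise_orthogonal k U"
  unfolding pairwise_orthogonal_def
  using U by (auto simp: plane_eq real_inner_class.orthogonal_def inner_embed)

lemma base_multiprism: "{(\<Sum>i<k. a i) | a. \<forall>i<k. a i \<in> V i} \<in> multiprisms_parallel k r U"
  unfolding multiprisms_parallel_def
  using planes_orthogonal regular_polygon_embed C1 r U
  by (intro CollectI conjI exI[of _ V]) (auto simp: V_def)

lemma x_component: "h \<in> G \<Longrightarrow> i < k \<Longrightarrow> embed i (\<sigma> i (x h)) \<in> V i"
proof -
  assume h: "h \<in> G" "i < k"
  then have "h i \<in> {0..<int (q i)}" using mem_G by simp
  then show ?thesis
    unfolding V_def using x[of i h] h by (intro CollectI exI[of _ "nat (h i)"]) auto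
qed

text \<open>The entries of a group element can be prescribed independently, so every choice of one
  vertex per polygon, and of a segment end if there is a segment, occurs.\<close>

lemma base_realized:
  assumes "\<forall>i<k. a i \<in> V i" "s \<in> {0..<2}"
  shows "\<exists>h\<in>G. (\<forall>i<k. embed i (\<sigma> i (x h)) = a i) \<and> (d' = 1 \<longrightarrow> h k = s)"
proof -
  have "\<forall>i. \<exists>j. i < k \<longrightarrow> j < q i \<and> a i = embed i (C0 i + C1 i * zeta (q i) powi int j)"
    using assms(1) unfolding V_def by blast
  then obtain j where j: "\<And>i. i < k \<Longrightarrow> j i < q i"
    "\<And>i. i < k \<Longrightarrow> a i = embed i (C0 i + C1 i * zeta (q i) powi int (j i))"
    by metis
  define h where "h = (\<lambda>i\<in>{..<l}. if i < k then int (j i) else s)"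
  have "(if i < k then int (j i) else s) \<in> {0..<int (q i)}" if "i < l" for i
  proof (cases "i < k")
    case False
    then have "i = k" "d' = 1" using that d'_le by auto
    then show ?thesis using assms(2) q_last by simp
  qed (use j in simp)
  then have "h \<in> G"
    unfolding carrier_G h_def by (simp add: restrict_PiE_iff)
  moreover have "embed i (\<sigma> i (x h)) = a i" if "i < k" for i
    using x[of i h] \<open>h \<in> G\<close> that j(2)[OF that] by (simp add: h_def)
  moreover have "d' = 1 \<longrightarrow> h k = s" by (simp add: h_def)
  ultimately show ?thesis by blast
qed

lemma multiprism_vertices:
  assumes "d' = 0"
  shows "x ` G \<in> multiprisms_parallel k r U"
proof -
  have "x ` G = {(\<Sum>i<k. a i) | a. \<forall>i<k. a i \<in> V i}"
  proof (intro subset_antisym subsetI)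
    fix y assume "y \<in> x ` G"
    then obtain h where h: "h \<in> G" "y = x h" by blast
    then have "y = (\<Sum>i<k. embed i (\<sigma> i (x h)))"
      using vector_decomposition[of y] assms by simp
    then show "y \<in> {(\<Sum>i<k. a i) | a. \<forall>i<k. a i \<in> V i}"
      using x_component[OF h(1)] by blast
  next
    fix y assume "y \<in> {(\<Sum>i<k. a i) | a. \<forall>i<k. a i \<in> V i}"
    then obtain a where a: "\<forall>i<k. a i \<in> V i" "y = (\<Sum>i<k. a i)" by blast
    obtain h where h: "h \<in> G" "\<forall>i<k. embed i (\<sigma> i (x h)) = a i"
      using base_realized[OF a(1), of 0] by auto
    then have "x h = y"
      using vector_decomposition[of "x h"] a(2) assms by simp
    then show "y \<in> x ` G" using h(1) by blast
  qed
  then show ?thesis using base_multiprism by simp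
qed

lemma segment_multiprism_vertices:
  assumes "d' = 1"
  shows "x ` G \<in> segment_multiprisms_parallel k r U"
proof -
  define E where "E s = Re (C0 k + C1 k * zeta (q k) powi s) *\<^sub>R (axis (\<alpha> k) 1 :: real ^ 'n)" for s
  have kl: "k < l" using assms by simp
  have zu: "zero k = 0" "unit k k = 1"
    using kl unfolding zero_def unit_def by (simp_all only: lessThan_iff restrict_apply if_True refl)
  have last: "x h $ \<alpha> k *\<^sub>R axis (\<alpha> k) 1 = E (h k)" if "h \<in> G" for h
    using x[OF kl that] by (simp add: E_def \<sigma>_def complex_eq_iff)
  have dec: "x h = (\<Sum>i<k. embed i (\<sigma> i (x h))) + E (h k)" if "h \<in> G" for h
    using vector_decomposition[of "x h"] last[OF that] assms by simp
  have bit: "h k = 0 \<or> h k = 1" if "h \<in> G" for h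
    using mem_G[OF that kl] q_last[OF assms] by auto
  \<comment> \<open>\<open>E\<close> sees only real parts, and \<open>C1 k\<close> is complex a
    priori. Since the last component is real, C0 + C1 and C0 - C1 are both real, hence so is
    C1.\<close>
  have "E 0 \<noteq> E 1"
  proof
    assume "E 0 = E 1"
    then have "E 0 $ \<alpha> k = E 1 $ \<alpha> k" by simp
    then have "Re (C1 k) = 0"
      using zeta_last[OF assms] by (simp add: E_def)
    moreover have "Im (C0 k + C1 k) = 0"
      using x[OF kl zero_in] zu(1) by (simp add: \<sigma>_def complex_eq_iff)
    moreover have "Im (C0 k - C1 k) = 0"
      using x[OF kl unit_in[of k]] zu(2) zeta_last[OF assms] by (simp add: \<sigma>_def complex_eq_iff)
    ultimately show False using C1[OF kl] by (simp add: complex_eq_iff)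
  qed
  moreover have "E s \<in> orthogonal_comp (\<Union>i<k. U i)" for s
  proof -
    have "real_inner_class.orthogonal (embed i z) (E s)" if "i < k" for i z
      using that embed_components(1)[OF that kl] by (simp add: real_inner_class.orthogonal_def E_def inner_axis)
    then show ?thesis
      unfolding orthogonal_comp_def using U by (auto simp: plane_eq)
  qed
  moreover have "x ` G = {y + z | y z. y \<in> {(\<Sum>i<k. a i) | a. \<forall>i<k. a i \<in> V i} \<and> z \<in> {E 0, E 1}}"
  proof (intro subset_antisym subsetI)
    fix y assume "y \<in> x ` G"
    then obtain h where h: "h \<in> G" "y = x h" by blast
    have "(\<Sum>i<k. embed i (\<sigma> i (x h))) \<in> {(\<Sum>i<k. a i) | a. \<forall>i<k. a i \<in> V i}"
      using x_component[OF h(1)] by blast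
    moreover have "E (h k) \<in> {E 0, E 1}" using bit[OF h(1)] by auto
    ultimately show "y \<in> {y + z | y z. y \<in> {(\<Sum>i<k. a i) | a. \<forall>i<k. a i \<in> V i} \<and> z \<in> {E 0, E 1}}"
      using dec[OF h(1)] h(2) by blast
  next
    fix y assume "y \<in> {y + z | y z. y \<in> {(\<Sum>i<k. a i) | a. \<forall>i<k. a i \<in> V i} \<and> z \<in> {E 0, E 1}}"
    then obtain a z where a: "\<forall>i<k. a i \<in> V i" "y = (\<Sum>i<k. a i) + z" "z = E 0 \<or> z = E 1"
      by blast
    obtain s :: int where s: "s \<in> {0..<2}" "z = E s"
      using a(3) by (elim disjE) (use that[of 0] that[of 1] in auto)
    obtain h where h: "h \<in> G" "\<forall>i<k. embed i (\<sigma> i (x h)) = a i" "h k = s"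
      using base_realized[OF a(1) s(1)] assms by blast
    then have "x h = y"
      using dec[OF h(1)] a(2) s(2) by simp
    then show "y \<in> x ` G" using h(1) by blast
  qed
  ultimately show ?thesis
    unfolding segment_multiprisms_parallel_def using base_multiprism by blast
qed

end

end

section \<open>Partitions from solutions\<close>

context coordinate_split
begin

text \<open>Injectivity of \<open>X\<close> turns disjoint classes of indices into disjoint sets of
  points.\<close>

lemma polytope_partition_of_solution:
  assumes sol: "solution N X c t" and t: "\<And>j. j < N \<Longrightarrow> 0 \<le> t j" and X: "inj_on X {..<N}"
    and inj: "inj_on (class_point N c t X) G" and P: "class_point N c t X ` G \<in> P"
  shows "\<exists>A. polytope_partition P (card G) (X ` {..<N}) A"
proof -
  obtain \<eta> where \<eta>: "bij_betw \<eta> {..<card G} G"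
    using ex_bij_betw_nat_finite[OF finite_G] by (auto simp: atLeast0LessThan)
  have c: "c p \<in> G" if "p < N" for p
    using sol that unfolding solution_def by auto
  define A where "A j = X ` {p \<in> {..<N}. c p = \<eta> j}" for j
  have "disjoint_family_on A {..<card G}"
    unfolding disjoint_family_on_def
  proof (intro ballI impI)
    fix i j assume ij: "i \<in> {..<card G}" "j \<in> {..<card G}" "i \<noteq> j"
    then have "\<eta> i \<noteq> \<eta> j"
      using bij_betw_imp_inj_on[OF \<eta>] by (simp add: inj_on_eq_iff)
    then show "A i \<inter> A j = {}"
      unfolding A_def using X by (auto simp: inj_on_eq_iff)
  qed
  moreover have "(\<Union>j<card G. A j) = X ` {..<N}"
  proof
    show "X ` {..<N} \<subseteq> (\<Union>j<card G. A j)"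
    proof
      fix y assume "y \<in> X ` {..<N}"
      then obtain p where p: "p < N" "y = X p" by blast
      obtain j where "j < card G" "\<eta> j = c p"
      proof -
        have "c p \<in> \<eta> ` {..<card G}" using c[OF p(1)] bij_betw_imp_surj_on[OF \<eta>] by blast
        then show ?thesis using that by auto
      qed
      then show "y \<in> (\<Union>j<card G. A j)"
        using p by (intro UN_I[of j]) (auto simp: A_def)
    qed
  qed (auto simp: A_def)
  moreover have "(class_point N c t X \<circ> \<eta>) j \<in> convex hull A j" if "j < card G" for j
  proof -
    have "\<eta> j \<in> G" using bij_betw_apply[OF \<eta>] that by simp
    then have "(\<Sum>p\<in>{p \<in> {..<N}. c p = \<eta> j}. t p) = 1"
      using sol unfolding solution_def by blast
    then show ?thesis
      unfolding class_point_def comp_def A_def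
      using t by (intro convex_sum convex_convex_hull) (auto intro: hull_inc)
  qed
  moreover have "bij_betw (class_point N c t X \<circ> \<eta>) {..<card G} (class_point N c t X ` G)"
    using bij_betw_trans[OF \<eta> inj_on_imp_bij_betw[OF inj]] .
  ultimately show ?thesis
    unfolding polytope_partition_def using P by blast
qed

lemma prism_partition:
  assumes sol: "solution N X c t" and t: "\<And>j. j < N \<Longrightarrow> 0 \<le> t j" and X: "inj_on X {..<N}"
    and nondeg: "\<And>i. i < l \<Longrightarrow> \<sigma> i (class_point N c t X (unit i)) \<noteq> \<sigma> i (class_point N c t X zero)"
    and r: "\<And>i. i < k \<Longrightarrow> r i = q i"
    and U: "\<And>i. i < k \<Longrightarrow> U i = span {axis (\<alpha> i) 1, axis (\<beta> i) 1}"
  shows "d' = 0 \<Longrightarrow> \<exists>A. polytope_partition (multiprisms_parallel k r U) (card G) (X ` {..<N}) A"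
    and "d' = 1 \<Longrightarrow> \<exists>A. polytope_partition (segment_multiprisms_parallel k r U) (card G) (X ` {..<N}) A"
proof -
  have "\<forall>i\<in>{..<l}. \<exists>C. (\<forall>h\<in>G. \<sigma> i (class_point N c t X h) = fst C + snd C * zeta (q i) powi (h i)) \<and> snd C \<noteq> 0"
  proof
    fix i assume "i \<in> {..<l}"
    then have i: "i < l" by simp
    obtain C0 C1 where "\<forall>h\<in>G. \<sigma> i (class_point N c t X h) = C0 + C1 * zeta (q i) powi (h i)" "C1 \<noteq> 0"
      using \<sigma>_solution_character[OF sol i] nondeg[OF i] by blast
    then show "\<exists>C. (\<forall>h\<in>G. \<sigma> i (class_point N c t X h) = fst C + snd C * zeta (q i) powi (h i)) \<and> snd C \<noteq> 0"
      by (intro exI[of _ "(C0, C1)"]) simp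
  qed
  from bchoice[OF this] obtain C where C: "\<forall>i\<in>{..<l}.
      (\<forall>h\<in>G. \<sigma> i (class_point N c t X h) = fst (C i) + snd (C i) * zeta (q i) powi (h i)) \<and> snd (C i) \<noteq> 0"
    by blast
  define C0 C1 where "C0 i = fst (C i)" and "C1 i = snd (C i)" for i
  have form: "\<sigma> i (class_point N c t X h) = C0 i + C1 i * zeta (q i) powi (h i)" if "i < l" "h \<in> G" for i h
    using C that unfolding C0_def C1_def by blast
  have C1: "C1 i \<noteq> 0" if "i < l" for i
    using C that unfolding C1_def by blast
  have inj: "inj_on (class_point N c t X) G"
    using x_inj[of "class_point N c t X" C0 C1, OF form C1 r U] .
  show "\<exists>A. polytope_partition (multiprisms_parallel k r U) (card G) (X ` {..<N}) A" if "d' = 0"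
    by (rule polytope_partition_of_solution[OF sol t X inj
        multiprism_vertices[of "class_point N c t X" C0 C1, OF form C1 r U that]])
  show "\<exists>A. polytope_partition (segment_multiprisms_parallel k r U) (card G) (X ` {..<N}) A" if "d' = 1"
    by (rule polytope_partition_of_solution[OF sol t X inj
        segment_multiprism_vertices[of "class_point N c t X" C0 C1, OF form C1 r U that]])
qed

section \<open>Coordinate decomposition and Fourier coefficients of a solution\<close>

definition part :: "nat \<Rightarrow> (real ^ 'n) set" where
  "part i = (if i < k then span {axis (\<alpha> i) 1, axis (\<beta> i) 1} else span {axis (\<alpha> i) 1})"

lemma part_support:
  fixes u :: "real ^ 'n"
  assumes "i < l" "u \<in> part i" "factor a \<noteq> i"
  shows "u $ a = 0"
proof -
  have "subspace {u :: real ^ 'n. u $ a = 0}"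
    by (simp add: subspace_def)
  moreover have "axis (\<alpha> i) 1 \<in> {u :: real ^ 'n. u $ a = 0}"
    using assms(1,3) factor_\<alpha> by (auto simp: axis_def)
  moreover have "axis (\<beta> i) 1 \<in> {u :: real ^ 'n. u $ a = 0}" if "i < k"
    using assms(3) factor_\<beta>[OF that] by (auto simp: axis_def)
  ultimately have "part i \<subseteq> {u. u $ a = 0}"
    unfolding part_def by (cases "i < k") (simp_all add: span_minimal)
  then show ?thesis using assms(2) by blast
qed

lemma part_decomposition: "coordinate_decomposition k d' part"
  unfolding coordinate_decomposition_def
proof (intro conjI)
  show "CARD('n) = 2 * k + d'" by (rule card_n)
  show "\<forall>i<k. coordinate_plane (part i)"
  proof (intro allI impI)
    fix i assume "i < k"
    then show "coordinate_plane (part i)"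
      unfolding coordinate_plane_def using \<alpha>_neq_\<beta>[of i i]
      by (intro exI[of _ "\<alpha> i"] exI[of _ "\<beta> i"]) (simp add: part_def)
  qed
  show "\<forall>i\<in>{k..<k + d'}. coordinate_line (part i)"
    unfolding coordinate_line_def part_def by auto
  show "pairwise_orthogonal (k + d') part"
    unfolding pairwise_orthogonal_def
  proof (intro allI impI ballI)
    fix i j u z assume *: "i < l" "j < l" "i \<noteq> j" "u \<in> part i" "z \<in> part j"
    have "u $ a * z $ a = 0" for a
      using part_support[of i u a] part_support[of j z a] * by (cases "factor a = i") auto
    then show "real_inner_class.orthogonal u z"
      unfolding real_inner_class.orthogonal_def inner_vec_def by (intro sum.neutral) simp
  qed
  have "axis a 1 \<in> (\<Union>i<l. part i)" for a :: 'n
  proof (cases a rule: coordinate_cases)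
    case (1 i)
    then have "axis a 1 \<in> part i" by (auto simp: part_def intro: span_base)
    then show ?thesis using 1 by blast
  next
    case (2 i)
    then have "axis a 1 \<in> part i" by (auto simp: part_def intro: span_base)
    then show ?thesis using 2 by (intro UN_I[of i]) auto
  qed
  then have "(Basis :: (real ^ 'n) set) \<subseteq> (\<Union>i<l. part i)"
    by (auto simp: Basis_vec_def)
  then show "span (\<Union>i<k + d'. part i) = UNIV"
    using span_mono[of Basis "\<Union>i<l. part i"] by (simp add: span_Basis top.extremum_unique)
qed

lemma part_permutation: "coordinate_permutation k d' part \<sigma>"
  unfolding coordinate_permutation_def
proof (intro conjI allI ballI impI)
  fix i assume "i < k"
  then show "\<exists>a b. a \<noteq> b \<and> part i = span {axis a 1, axis b 1} \<and> \<sigma> i = (\<lambda>y. Complex (y $ a) (y $ b))"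
    using \<alpha>_neq_\<beta>[of i i] by (intro exI[of _ "\<alpha> i"] exI[of _ "\<beta> i"]) (simp add: part_def \<sigma>_def)
next
  fix i assume "i \<in> {k..<k + d'}"
  then show "\<exists>a. part i = span {axis a 1} \<and> \<sigma> i = (\<lambda>y. complex_of_real (y $ a))"
    by (intro exI[of _ "\<alpha> i"]) (simp add: part_def \<sigma>_def)
qed

lemma zeta_powi_character:
  assumes "i < l"
  shows "zeta (q i) powi (g i) = group_character l q (unit i) g"
proof -
  have "group_character l q (unit i) g = (\<Prod>j<l. if j = i then zeta (q j) powi (g j) else 1)"
    unfolding group_character_def unit_def by (intro prod.cong) auto
  then show ?thesis using assms by simp
qed

lemma character_zero: "group_character l q zero g = 1"
  unfolding group_character_def zero_def by (intro prod.neutral) auto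

text \<open>The function combines only the characters at \<open>zero\<close> and
  \<open>unit i\<close>, so orthogonality kills all other coefficients, and the one at
  \<open>unit i\<close> as well when C1 = 0.\<close>

lemma fourier_coefficient_zero:
  assumes F: "\<And>g. g \<in> G \<Longrightarrow> F (y g) = C0 + C1 * zeta (q i) powi (g i)"
    and "i < l" "h \<in> G" "h \<noteq> zero" "C1 = 0 \<or> h \<noteq> unit i"
  shows "fourier_coefficient l q F y h = 0"
proof -
  have orth: "(\<Sum>g\<in>G. group_character l q a g * inverse (group_character l q h g)) = 0"
    if "a \<in> G" "a \<noteq> h" for a
    by (rule group_character_orthogonal) (use q_ge_one that assms(3) in auto)
  have "(\<Sum>g\<in>G. F (y g) * inverse (group_character l q h g)) =
      C0 * (\<Sum>g\<in>G. group_character l q zero g * inverse (group_character l q h g))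
      + C1 * (\<Sum>g\<in>G. group_character l q (unit i) g * inverse (group_character l q h g))"
    unfolding sum_distrib_left sum.distrib[symmetric]
    by (intro sum.cong) (auto simp: F zeta_powi_character[OF assms(2)] character_zero distrib_right mult.assoc)
  also have "\<dots> = 0"
    using orth[OF zero_in] orth[OF unit_in[of i]] assms(4,5) by auto
  finally show ?thesis
    by (simp add: fourier_coefficient_def)
qed

lemma last_unit_involution:
  assumes "d' = 1"
  shows "inv\<^bsub>cyclic_sum l q\<^esub> (unit k) = unit k"
proof (rule group.inv_equality[OF group_cyclic_sum _ unit_in unit_in])
  show "unit k \<otimes>\<^bsub>cyclic_sum l q\<^esub> unit k = \<one>\<^bsub>cyclic_sum l q\<^esub>"
    unfolding cyclic_sum_def mult_product_group one_product_group unit_def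
    using q_last[OF assms] by (intro restrict_ext) auto
qed

end

lemma AE_inj_on:
  assumes "finite J"
  shows "AE X in PiM J (\<lambda>_. lborel :: (real ^ 'n::finite) measure). inj_on X J"
proof -
  have neq: "AE X in PiM J (\<lambda>_. lborel :: (real ^ 'n) measure). X i \<noteq> X j"
    if ij: "i \<in> J" "j \<in> J" "i \<noteq> j" for i j
  proof -
    \<comment> \<open>One real coordinate already separates two points almost surely, so the
      multiaffine criterion applies to a single linear form.\<close>
    define b :: "real ^ 'n" where "b = (SOME b. b \<in> Basis)"
    have "inner b b = 1"
      unfolding b_def by (intro inner_same_Basis someI_ex[of "\<lambda>b. b \<in> Basis"]) (use nonempty_Basis in blast)
    have "AE X in PiM J (\<lambda>_. lborel :: (real ^ 'n) measure). inner b (X i - X j) \<noteq> 0"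
    proof (rule AE_multiaffine_nonzero[OF assms, where ?X0.0 = "\<lambda>p\<in>J. if p = i then b else 0"])
      have "(\<lambda>X. X p) \<in> measurable (PiM J (\<lambda>_. lborel)) (borel :: (real ^ 'n) measure)" if "p \<in> J" for p
        using measurable_component_singleton[OF that, of "\<lambda>_. lborel :: (real ^ 'n) measure"] by simp
      then show "(\<lambda>X. inner b (X i - X j)) \<in> borel_measurable (PiM J (\<lambda>_. lborel :: (real ^ 'n) measure))"
        using ij by (intro borel_measurable_inner borel_measurable_diff) simp_all
      show "affine_functional (\<lambda>x. inner b ((X(p := x)) i - (X(p := x)) j))" for X :: "_ \<Rightarrow> real ^ 'n" and p
      proof -
        consider "p = i" | "p = j" | "p \<noteq> i" "p \<noteq> j" by blast
        then show ?thesis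
        proof cases
          case 1
          then show ?thesis using ij(3) unfolding affine_functional_def
            by (intro exI[of _ "- inner b (X j)"] exI[of _ b]) (simp add: inner_diff_right)
        next
          case 2
          then show ?thesis using ij(3) unfolding affine_functional_def
            by (intro exI[of _ "inner b (X i)"] exI[of _ "- b"]) (simp add: inner_diff_right)
        next
          case 3
          then show ?thesis by (simp add: affine_functional_const)
        qed
      qed
      show "inner b ((\<lambda>p\<in>J. if p = i then b else 0) i - (\<lambda>p\<in>J. if p = i then b else 0) j) \<noteq> 0"
        using ij \<open>inner b b = 1\<close> by simp
    qed simp
    then show ?thesis
      by eventually_elim auto
  qed
  have "AE X in PiM J (\<lambda>_. lborel :: (real ^ 'n) measure). \<forall>p\<in>{(i, j) \<in> J \<times> J. i \<noteq> j}. X (fst p) \<noteq> X (snd p)"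
    using assms neq by (intro AE_finite_allI) (auto intro: finite_subset[of _ "J \<times> J"])
  then show ?thesis
    by eventually_elim (auto simp: inj_on_def)
qed

section \<open>Existence of the partition, almost surely and for generic points\<close>

context coordinate_split
begin

definition total :: nat where
  "total = (2 * k + d') * (card G - 2) + card G"

lemma total_eq: "total = card conditions + card G"
  by (simp add: total_def card_conditions')

lemma AE_partition:
  assumes r: "\<And>i. i < k \<Longrightarrow> r i = q i"
    and U: "\<And>i. i < k \<Longrightarrow> U i = span {axis (\<alpha> i) 1, axis (\<beta> i) 1}"
  shows "AE X in PiM {..<total} (\<lambda>_. lborel).
    (d' = 0 \<longrightarrow> (\<exists>A. polytope_partition (multiprisms_parallel k r U) (card G) (X ` {..<total}) A)) \<and>
    (d' = 1 \<longrightarrow> (\<exists>A. polytope_partition (segment_multiprisms_parallel k r U) (card G) (X ` {..<total}) A))"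
proof -
  have "AE X in PiM {..<total} (\<lambda>_. lborel). \<forall>c t a. solution total X c t \<longrightarrow>
    class_point total c t X (unit (factor a)) $ a \<noteq> class_point total c t X zero $ a"
    by (rule AE_nondegenerate) (simp add: total_eq)
  moreover have "AE X in PiM {..<total} (\<lambda>_. lborel :: (real ^ 'n) measure). inj_on X {..<total}"
    by (rule AE_inj_on) simp
  ultimately show ?thesis
  proof eventually_elim
    case (elim X)
    obtain c t where sol: "solution total X c t" and t: "\<forall>j<total. 0 \<le> t j"
      using exists_solution[of total X] total_eq by auto
    have nd: "\<sigma> i (class_point total c t X (unit i)) \<noteq> \<sigma> i (class_point total c t X zero)" if "i < l" for i
    proof -
      \<comment> \<open>A difference in the real part alone is enough for \<open>\<sigma> i\<close>
        to differ.\<close>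
      have "class_point total c t X (unit (factor (\<alpha> i))) $ \<alpha> i \<noteq> class_point total c t X zero $ \<alpha> i"
        using elim(1) sol by blast
      then show ?thesis
        using that by (simp add: factor_\<alpha> \<sigma>_def)
    qed
    have t': "0 \<le> t j" if "j < total" for j
      using t that by blast
    show ?case
      by (intro conjI impI prism_partition[OF sol t' elim(2) nd r U])
  qed
qed

text \<open>2 m - m' counts real equations: on the line, coefficients at h and -h are conjugate, so
  one of them is taken, and those of order two are real. A solution makes D (n - 2) such equations
  hold, with n = card \<open>G\<close>; a degenerate component adds at least one, which reaches the
  number that genericity forbids on the full simplex.\<close>

lemma generic_nondegenerate:
  assumes gen: "fourier_generic M (\<lambda>w. \<Sum>j\<le>M. w j *\<^sub>R X j)" and M: "Suc M = total"
    and sol: "solution total X c t" and t: "\<And>j. j < total \<Longrightarrow> 0 \<le> t j" and i0: "i0 < l"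
  shows "\<sigma> i0 (class_point total c t X (unit i0)) \<noteq> \<sigma> i0 (class_point total c t X zero)"
proof
  assume deg: "\<sigma> i0 (class_point total c t X (unit i0)) = \<sigma> i0 (class_point total c t X zero)"
  let ?Gr = "cyclic_sum l q"
  interpret Gr: group ?Gr by (rule group_cyclic_sum)
  have ot: "order_two ?Gr T = {h \<in> T. inv\<^bsub>?Gr\<^esub> h = h}" if "T \<subseteq> G - {zero}" for T
    using that Gr.ord_two_iff unfolding order_two_def zero_one by blast
  \<comment> \<open>Stable under inversion, because \<open>unit k\<close> is its own inverse when
    the factor has order two.\<close>
  define Z where "Z = G - {zero, unit k}"
  have "\<exists>T\<subseteq>Z. (\<forall>h\<in>T. inv\<^bsub>?Gr\<^esub> h \<noteq> h \<longrightarrow> inv\<^bsub>?Gr\<^esub> h \<notin> T) \<and>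
      card Z + card {h \<in> T. inv\<^bsub>?Gr\<^esub> h = h} = 2 * card T" if "d' = 1"
  proof (rule half_system)
    show "finite Z" by (simp add: Z_def finite_G)
    show "inv\<^bsub>?Gr\<^esub> h \<in> Z" if "h \<in> Z" for h
    proof -
      have "inv\<^bsub>?Gr\<^esub> h \<noteq> inv\<^bsub>?Gr\<^esub> zero" "inv\<^bsub>?Gr\<^esub> h \<noteq> inv\<^bsub>?Gr\<^esub> (unit k)"
        using that zero_in unit_in[of k] Gr.inv_inj unfolding Z_def by (auto simp: inj_on_eq_iff)
      then show ?thesis
        using that last_unit_involution[OF \<open>d' = 1\<close>] by (simp add: Z_def zero_one)
    qed
    show "inv\<^bsub>?Gr\<^esub> (inv\<^bsub>?Gr\<^esub> h) = h" if "h \<in> Z" for h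
      using that by (simp add: Z_def)
  qed
  then obtain T where T: "T \<subseteq> Z" "\<And>h. h \<in> T \<Longrightarrow> inv\<^bsub>?Gr\<^esub> h \<noteq> h \<Longrightarrow> inv\<^bsub>?Gr\<^esub> h \<notin> T"
    "d' = 1 \<Longrightarrow> card Z + card {h \<in> T. inv\<^bsub>?Gr\<^esub> h = h} = 2 * card T"
  proof (cases "d' = 1")
    case False
    then show ?thesis using that[of "{}"] by simp
  qed blast
  have finT: "finite T" using T(1) finite_G by (auto simp: Z_def intro: finite_subset)
  \<comment> \<open>Each plane contributes all nonzero characters except its own, and the line one
    representative of each inverse pair; the degenerate component \<open>i0\<close> contributes its
    own character too.\<close>
  define S where "S i = (if i < k then G - (if i = i0 then {zero} else {zero, unit i})
    else if i = i0 then insert (unit k) T else T)" for i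
  have S_sub: "S i \<subseteq> G - {zero}" for i
    using T(1) unit_in[of k] unit_neq_zero[of k] i0 by (auto simp: S_def Z_def)
  have S_unit: "h \<noteq> unit i" if "h \<in> S i" "i < l" "i \<noteq> i0" for h i
  proof (cases "i < k")
    case False
    then have "i = k" using that d'_le by simp
    then show ?thesis using that T(1) by (auto simp: S_def Z_def)
  qed (use that in \<open>auto simp: S_def\<close>)
  have adm: "admissible_choice ?Gr k d' S"
    unfolding admissible_choice_def
  proof (intro conjI allI ballI impI)
    show "S i \<subseteq> G - {\<one>\<^bsub>?Gr\<^esub>}" for i using S_sub zero_one by simp
    fix i h assume "i \<in> {k..<k + d'}" and h: "h \<in> S i - order_two ?Gr (S i)"
    then have "i = k" "d' = 1" using d'_le by auto
    have Si: "S i = (if i = i0 then insert (unit k) T else T)" using \<open>i = k\<close> by (simp add: S_def)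
    have hi: "inv\<^bsub>?Gr\<^esub> h \<noteq> h"
      using h unfolding ot[OF S_sub[of i]] by blast
    have "h \<in> T \<or> h = unit k"
      using h unfolding Si by (cases "i = i0") auto
    then have "h \<in> T" using hi last_unit_involution[OF \<open>d' = 1\<close>] by auto
    then have "h \<in> G" using T(1) by (auto simp: Z_def)
    have "h \<noteq> unit k" using \<open>h \<in> T\<close> T(1) by (auto simp: Z_def)
    then have "inv\<^bsub>?Gr\<^esub> h \<noteq> unit k"
      using last_unit_involution[OF \<open>d' = 1\<close>] Gr.inv_inv[OF \<open>h \<in> G\<close>] by auto
    then show "inv\<^bsub>?Gr\<^esub> h \<notin> S i"
      using T(2)[OF \<open>h \<in> T\<close> hi] unfolding Si by (cases "i = i0") simp_all
  qed
  define m where "m = (\<Sum>i<k + d'. card (S i))"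
  define m' where "m' = (\<Sum>i\<in>{k..<k + d'}. card (order_two ?Gr (S i)))"
  define gain where "gain i = 2 * int (card (S i)) - (if k \<le> i then int (card (order_two ?Gr (S i))) else 0)" for i
  have "card {zero, unit i0} \<le> card G"
    using zero_in unit_in[of i0] finite_G by (intro card_mono) auto
  then have G2: "2 \<le> card G" using unit_neq_zero[OF i0] by simp
  \<comment> \<open>A degenerate plane gains two real equations and a degenerate line one; the
    guaranteed 1 is what makes the final inequality strict.\<close>
  have gain: "(if i < k then 2 else 1) * int (card G - 2) + (if i = i0 then 1 else 0) \<le> gain i"
    if "i < l" for i
  proof (cases "i < k")
    case True
    have "card (G - {zero, unit i}) = card G - 2" "card (G - {zero}) = card G - 1"
      using zero_in unit_in[of i] unit_neq_zero[OF that] finite_G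
      by (simp_all add: card_Diff_subset)
    then show ?thesis using True G2 by (auto simp: gain_def S_def)
  next
    case False
    then have ik: "i = k" "d' = 1" using that d'_le by auto
    have cZ: "card Z = card G - 2"
      unfolding Z_def using zero_in unit_in[of k] unit_neq_zero[of k] ik finite_G
      by (simp add: card_Diff_subset)
    have oT: "order_two ?Gr T = {h \<in> T. inv\<^bsub>?Gr\<^esub> h = h}"
      using T(1) by (intro ot) (auto simp: Z_def)
    have e: "int (card G - 2) + int (card {h \<in> T. inv\<^bsub>?Gr\<^esub> h = h}) = 2 * int (card T)"
      using T(3)[OF ik(2)] cZ by linarith
    show ?thesis
    proof (cases "i = i0")
      case True
      have "unit k \<notin> T" using T(1) by (auto simp: Z_def)
      moreover have "order_two ?Gr (insert (unit k) T) = insert (unit k) {h \<in> T. inv\<^bsub>?Gr\<^esub> h = h}"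
        using ot[OF S_sub[of i]] True ik last_unit_involution[OF ik(2)] by (auto simp: S_def)
      ultimately show ?thesis
        using True ik(1) e finT by (simp add: gain_def S_def)
    next
      case False
      then show ?thesis
        using ik(1) e by (simp add: gain_def S_def oT)
    qed
  qed
  have "2 * int m - int m' = (\<Sum>i<l. gain i)"
  proof -
    have "(\<Sum>i<l. if k \<le> i then int (card (order_two ?Gr (S i))) else 0) =
        (\<Sum>i\<in>{k..<k + d'}. int (card (order_two ?Gr (S i))))"
      by (intro sum.mono_neutral_cong_right) auto
    then show ?thesis
      by (simp add: gain_def m_def m'_def sum_subtractf sum_distrib_left)
  qed
  moreover have "(\<Sum>i<l. (if i < k then 2 else 1) * int (card G - 2) + (if i = i0 then 1 else 0)) =
      int (2 * k + d') * int (card G - 2) + 1"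
  proof -
    have "(\<Sum>i<l. (if i < k then 2 else 1) * int (card G - 2)) = int (2 * k + d') * int (card G - 2)"
    proof (cases "d' = 0")
      case False
      then have "d' = 1" using d'_le by simp
      then show ?thesis by (simp add: algebra_simps)
    qed simp
    then show ?thesis using i0 by (simp add: sum.distrib)
  qed
  moreover have "(\<Sum>i<l. (if i < k then 2 else 1) * int (card G - 2) + (if i = i0 then 1 else 0)) \<le> (\<Sum>i<l. gain i)"
    using gain by (intro sum_mono) simp
  moreover have "int M = int (2 * k + d') * int (card G - 2) + int (card G) - 1"
    using M unfolding total_def by (simp add: of_nat_mult[symmetric] of_nat_add[symmetric] del: of_nat_mult of_nat_add) 
  ultimately have bound: "int M < 2 * int m - int m' + int (card G) - 1"
    by linarith
  have clt: "j < total \<longleftrightarrow> j \<le> M" for j using M by auto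
  have cG: "c j \<in> G" if "j \<le> M" for j
    using sol that clt unfolding solution_def by auto
  define y where "y g j = (if j \<le> M \<and> c j = g then t j else 0)" for g j
  have y_sum: "(\<Sum>j\<le>M. y g j) = 1" if "g \<in> G" for g
  proof -
    have "(\<Sum>j\<le>M. y g j) = (\<Sum>j\<in>{j \<in> {..<total}. c j = g}. t j)"
      unfolding y_def using clt by (intro sum.mono_neutral_cong_right) auto
    then show ?thesis using sol that unfolding solution_def by simp
  qed
  have y_simplex: "y g \<in> simplex_face M {j. j \<le> M \<and> c j = g}" if "g \<in> G" for g
  proof -
    have nn: "0 \<le> y g j" for j using t clt by (simp add: y_def)
    moreover have "y g j \<le> 1" for j
    proof (cases "j \<le> M")
      case True
      then show ?thesis using member_le_sum[of j "{..M}" "y g"] nn y_sum[OF that] by simp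
    qed (simp add: y_def)
    ultimately show ?thesis
      using y_sum[OF that] by (auto simp: simplex_face_def standard_simplex_def y_def)
  qed
  have "pairwise_disjoint_support M G y"
    unfolding pairwise_disjoint_support_def
  proof (intro exI[of _ "\<lambda>g. {j. j \<le> M \<and> c j = g}"] conjI ballI)
    show "disjoint_family_on (\<lambda>g. simplex_face M {j. j \<le> M \<and> c j = g}) G"
      unfolding disjoint_family_on_def
    proof (intro ballI impI)
      fix g h :: "nat \<Rightarrow> int" assume gh: "g \<noteq> h"
      \<comment> \<open>A point common to faces on disjoint vertex sets would have all coordinates
        0, against coordinate sum 1.\<close>
      show "simplex_face M {j. j \<le> M \<and> c j = g} \<inter> simplex_face M {j. j \<le> M \<and> c j = h} = {}"
      proof (rule ccontr)
        assume "\<not> ?thesis"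
        then obtain z where z: "z \<in> simplex_face M {j. j \<le> M \<and> c j = g}" "z \<in> simplex_face M {j. j \<le> M \<and> c j = h}"
          by blast
        then have "z j = 0" for j
          using gh unfolding simplex_face_def by (cases "c j = g") auto
        then have "(\<Sum>j\<le>M. z j) = 0" by simp
        then show False using z(1) by (simp add: simplex_face_def standard_simplex_def)
      qed
    qed
  qed (use y_simplex in auto)
  moreover have "y g \<in> simplex_face M {..M}" if "g \<in> G" for g
    using y_simplex[OF that] unfolding simplex_face_def by (auto simp: standard_simplex_def)
  moreover have "fourier_coefficient l q (\<sigma> i \<circ> (\<lambda>w. \<Sum>j\<le>M. w j *\<^sub>R X j)) y h = 0"
    if ih: "i < l" "h \<in> S i" for i h
  proof -
    have y_point: "(\<Sum>j\<le>M. y g j *\<^sub>R X j) = class_point total c t X g" for g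
      unfolding class_point_def y_def using clt
      by (intro sum.mono_neutral_cong_right) auto
    obtain C0 C1 where C: "\<forall>h\<in>G. \<sigma> i (class_point total c t X h) = C0 + C1 * zeta (q i) powi (h i)"
      "C1 = 0 \<longleftrightarrow> \<sigma> i (class_point total c t X (unit i)) = \<sigma> i (class_point total c t X zero)"
      using \<sigma>_solution_character[OF sol ih(1)] by blast
    show ?thesis
    proof (rule fourier_coefficient_zero)
      show "(\<sigma> i \<circ> (\<lambda>w. \<Sum>j\<le>M. w j *\<^sub>R X j)) (y g) = C0 + C1 * zeta (q i) powi (g i)" if "g \<in> G" for g
        using C(1) that by (simp add: y_point)
      show "C1 = 0 \<or> h \<noteq> unit i"
        using C(2) deg S_unit[OF ih(2,1)] by (cases "i = i0") auto
    qed (use S_sub[of i] ih in auto)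
  qed
  moreover have "\<forall>j<l. q j \<ge> 2" "k + d' \<ge> 1" using q_ge i0 by auto
  ultimately show False
    using gen[unfolded fourier_generic_def, rule_format, of l q k d' part \<sigma> S m m' "{..M}" M]
      part_decomposition part_permutation adm m_def m'_def bound by auto
qed

lemma generic_partition:
  fixes P :: "(real ^ 'n) set"
  assumes P: "card P = total" "generic_points P"
    and r: "\<And>i. i < k \<Longrightarrow> r i = q i"
    and U: "\<And>i. i < k \<Longrightarrow> U i = span {axis (\<alpha> i) 1, axis (\<beta> i) 1}"
  shows "d' = 0 \<Longrightarrow> \<exists>A. polytope_partition (multiprisms_parallel k r U) (card G) P A"
    and "d' = 1 \<Longrightarrow> \<exists>A. polytope_partition (segment_multiprisms_parallel k r U) (card G) P A"
proof -
  obtain M X where X: "bij_betw X {..M} P" and gen: "fourier_generic M (\<lambda>w. \<Sum>j\<le>M. w j *\<^sub>R X j)"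
    using P(2) unfolding generic_points_def by blast
  have M: "Suc M = total"
    using bij_betw_same_card[OF X] P(1) by simp
  have "{..M} = {..<total}" using M by auto
  then have inj: "inj_on X {..<total}" and img: "X ` {..<total} = P"
    using X by (auto simp: bij_betw_def)
  obtain c t where sol: "solution total X c t" and t: "\<forall>j<total. 0 \<le> t j"
    using exists_solution[of total X] total_eq by auto
  have t': "0 \<le> t j" if "j < total" for j
    using t that by blast
  have nd: "\<sigma> i (class_point total c t X (unit i)) \<noteq> \<sigma> i (class_point total c t X zero)" if "i < l" for i
    by (rule generic_nondegenerate[OF gen M sol t' that])
  show "\<exists>A. polytope_partition (multiprisms_parallel k r U) (card G) P A" if "d' = 0"
    using prism_partition(1)[OF sol t' inj nd r U that] unfolding img .
  show "\<exists>A. polytope_partition (segment_multiprisms_parallel k r U) (card G) P A" if "d' = 1"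
    using prism_partition(2)[OF sol t' inj nd r U that] unfolding img .
qed

end

section \<open>Conclusion\<close>

lemma coordinate_planes_axes:
  fixes U :: "nat \<Rightarrow> (real ^ 'n::finite) set"
  assumes plane: "\<forall>i<k. coordinate_plane (U i)" and orth: "pairwise_orthogonal k U"
  shows "\<exists>\<alpha> \<beta>. (\<forall>i<k. U i = span {axis (\<alpha> i) 1, axis (\<beta> i) 1}) \<and> inj_on \<alpha> {..<k} \<and> inj_on \<beta> {..<k} \<and>
    \<alpha> ` {..<k} \<inter> \<beta> ` {..<k} = {}"
proof -
  have "\<forall>i\<in>{..<k}. \<exists>p. fst p \<noteq> snd p \<and> U i = span {axis (fst p) 1, axis (snd p) 1}"
    using plane unfolding coordinate_plane_def by force
  from bchoice[OF this] obtain p where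
    p: "\<forall>i\<in>{..<k}. fst (p i) \<noteq> snd (p i) \<and> U i = span {axis (fst (p i)) 1, axis (snd (p i)) 1}"
    by blast
  define \<alpha> \<beta> where "\<alpha> i = fst (p i)" and "\<beta> i = snd (p i)" for i
  have ab: "\<alpha> i \<noteq> \<beta> i" and U: "U i = span {axis (\<alpha> i) 1, axis (\<beta> i) 1}" if "i < k" for i
    using p that by (auto simp: \<alpha>_def \<beta>_def)
  \<comment> \<open>A shared axis vector would have product 1 with itself, against orthogonality of
    the planes.\<close>
  have ne: "a \<noteq> b" if "i < k" "j < k" "i \<noteq> j" "a \<in> {\<alpha> i, \<beta> i}" "b \<in> {\<alpha> j, \<beta> j}" for i j a b
  proof -
    have "axis a 1 \<in> U i" "axis b 1 \<in> U j"
      using that U by (auto intro: span_base)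
    then have "real_inner_class.orthogonal (axis a 1 :: real ^ 'n) (axis b 1)"
      using orth that(1-3) unfolding pairwise_orthogonal_def by blast
    then show ?thesis
      by (auto simp: real_inner_class.orthogonal_def inner_axis_axis)
  qed
  have "inj_on \<alpha> {..<k}" "inj_on \<beta> {..<k}"
    using ne by (auto intro!: inj_onI)
  moreover have "\<alpha> ` {..<k} \<inter> \<beta> ` {..<k} = {}"
  proof -
    have "\<alpha> i \<noteq> \<beta> j" if "i < k" "j < k" for i j
      using ne[of i j "\<alpha> i" "\<beta> j"] ab that by (cases "i = j") auto
    then show ?thesis by auto
  qed
  ultimately show ?thesis
    using U by (intro exI[of _ \<alpha>] exI[of _ \<beta>]) simp
qed

text \<open>The bounds on the partition numbers leave the planes free, so any axes will do.\<close>

lemma exists_axes: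
  assumes "2 * k \<le> CARD('n::finite)"
  shows "\<exists>(\<alpha> :: nat \<Rightarrow> 'n) \<beta>. inj_on \<alpha> {..<k} \<and> inj_on \<beta> {..<k} \<and> \<alpha> ` {..<k} \<inter> \<beta> ` {..<k} = {}"
proof -
  obtain f :: "nat \<Rightarrow> 'n" where f: "bij_betw f {0..<CARD('n)} UNIV"
    using ex_bij_betw_nat_finite[of "UNIV :: 'n set"] by auto
  have f_eq: "f i = f j \<longleftrightarrow> i = j" if "i < 2 * k" "j < 2 * k" for i j
    using bij_betw_imp_inj_on[OF f] that assms by (simp add: inj_on_eq_iff)
  have "inj_on (\<lambda>i. f (2 * i)) {..<k}" "inj_on (\<lambda>i. f (2 * i + 1)) {..<k}"
    by (auto intro!: inj_onI simp: f_eq)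
  moreover have "f (2 * i) \<noteq> f (2 * j + 1)" if "i < k" "j < k" for i j
  proof -
    have "2 * i \<noteq> 2 * j + 1" by presburger
    then show ?thesis using that f_eq[of "2 * i" "2 * j + 1"] by simp
  qed
  then have "(\<lambda>i. f (2 * i)) ` {..<k} \<inter> (\<lambda>i. f (2 * i + 1)) ` {..<k} = {}"
    by auto
  ultimately show ?thesis by blast
qed

lemma axes_card:
  assumes "inj_on \<alpha> {..<k}" "inj_on \<beta> {..<k}" "\<alpha> ` {..<k} \<inter> \<beta> ` {..<k} = {}"
  shows "card (\<alpha> ` {..<k} \<union> \<beta> ` {..<k}) = 2 * k"
  using assms by (subst card_Un_disjoint) (auto simp: card_image)

lemma coordinate_split_even:
  fixes \<alpha> \<beta> :: "nat \<Rightarrow> 'n::finite"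
  assumes "CARD('n) = 2 * k" "\<forall>i<k. r i \<ge> 3"
    and axes: "inj_on \<alpha> {..<k}" "inj_on \<beta> {..<k}" "\<alpha> ` {..<k} \<inter> \<beta> ` {..<k} = {}"
  shows "coordinate_split k 0 r \<alpha> \<beta>"
proof
  show "\<alpha> ` {..<k + 0} \<union> \<beta> ` {..<k} = UNIV"
    using axes_card[OF axes] assms(1) by (intro card_subset_eq) auto
  show "2 \<le> r i" if "i < k + 0" for i
    using assms(2)[rule_format, of i] that by simp
qed (use axes in auto)

text \<open>The single axis left over by the planes carries the segment, whose group factor has
  order two.\<close>

lemma coordinate_split_odd:
  fixes \<alpha> \<beta> :: "nat \<Rightarrow> 'n::finite"
  assumes "CARD('n) = 2 * k + 1" "\<forall>i<k. r i \<ge> 3"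
    and axes: "inj_on \<alpha> {..<k}" "inj_on \<beta> {..<k}" "\<alpha> ` {..<k} \<inter> \<beta> ` {..<k} = {}"
  shows "\<exists>\<gamma>. coordinate_split k 1 (r(k := 2)) (\<alpha>(k := \<gamma>)) \<beta>"
proof -
  let ?A = "\<alpha> ` {..<k} \<union> \<beta> ` {..<k}"
  have "?A \<noteq> UNIV" using axes_card[OF axes] assms(1) by auto
  then obtain \<gamma> where \<gamma>: "\<gamma> \<notin> ?A" by blast
  have "card (insert \<gamma> ?A) = CARD('n)"
    using axes_card[OF axes] assms(1) \<gamma> by (subst card_insert_disjoint) auto
  then have "insert \<gamma> ?A = UNIV"
    by (intro card_subset_eq) auto
  moreover have img: "(\<alpha>(k := \<gamma>)) ` {..<k + 1} = insert \<gamma> (\<alpha> ` {..<k})"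
    by (auto simp: lessThan_Suc)
  ultimately have cover: "(\<alpha>(k := \<gamma>)) ` {..<k + 1} \<union> \<beta> ` {..<k} = UNIV"
    by simp
  have "inj_on (\<alpha>(k := \<gamma>)) {..<k + 1}"
    using axes(1) \<gamma> by (auto simp: inj_on_def less_Suc_eq)
  moreover have "(\<alpha>(k := \<gamma>)) ` {..<k + 1} \<inter> \<beta> ` {..<k} = {}"
    unfolding img using axes(3) \<gamma> by auto
  moreover have "2 \<le> (r(k := 2)) i" if "i < k + 1" for i
    using assms(2)[rule_format, of i] that by (cases "i = k") auto
  ultimately have "coordinate_split k 1 (r(k := 2)) (\<alpha>(k := \<gamma>)) \<beta>"
    using axes(2) cover by unfold_locales auto
  then show ?thesis by blast
qed

lemma tverberg_number_diff:
  assumes "R \<ge> 2"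
  shows "tverberg_number R d - d = d * (R - 2) + R"
proof -
  obtain n where "R = n + 2" using assms by (metis add.commute le_Suc_ex)
  then show ?thesis by (simp add: tverberg_number_def algebra_simps)
qed

lemma partition_number_le:
  assumes "AE X in PiM {..<N} (\<lambda>_. lborel :: (real ^ 'n::finite) measure). \<exists>A. polytope_partition P q (X ` {..<N}) A"
  shows "partition_number P q \<le> enat N"
  unfolding partition_number_def using assms by (intro Inf_lower) blast

lemma polytope_partition_mono:
  "polytope_partition P q S A \<Longrightarrow> P \<subseteq> Q \<Longrightarrow> polytope_partition Q q S A"
  unfolding polytope_partition_def by blast

lemma prod_ge_two:
  fixes r :: "nat \<Rightarrow> nat"
  assumes "k \<ge> 1" "\<forall>i<k. r i \<ge> 3"
  shows "(\<Prod>i<k. r i) \<ge> 2"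
proof -
  have "r 0 dvd (\<Prod>i<k. r i)" using assms(1) by (intro dvd_prodI) auto
  moreover have "(\<Prod>i<k. r i) > 0" using assms(2) by (intro prod_pos) force
  ultimately have "r 0 \<le> (\<Prod>i<k. r i)" by (rule dvd_imp_le)
  moreover have "r 0 \<ge> 3" using assms by simp
  ultimately show ?thesis by simp
qed

theorem theorem1p2:
  fixes k R :: nat and r :: "nat \<Rightarrow> nat"
  assumes "k \<ge> 1"
    and "\<forall>i<k. r i \<ge> 3"
    and "R = (\<Prod>i<k. r i)"
  shows
    "(CARD('m::finite) = 2 * k \<longrightarrow>
        partition_number (multiprisms k r :: (real ^ 'm) set set) R
          \<le> enat (tverberg_number R (2 * k) - 2 * k) \<and>
        (\<forall>(S :: (real ^ 'm) set) U.
           card S = tverberg_number R (2 * k) - 2 * k \<and> generic_points S \<and>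
           (\<forall>i<k. coordinate_plane (U i)) \<and> pairwise_orthogonal k U \<and>
           span (\<Union>i<k. U i) = UNIV \<longrightarrow>
           (\<exists>A. polytope_partition (multiprisms_parallel k r U) R S A)))
     \<and>
     (CARD('n::finite) = 2 * k + 1 \<longrightarrow>
        partition_number (segment_multiprisms k r :: (real ^ 'n) set set) (2 * R)
          \<le> enat (tverberg_number (2 * R) (2 * k + 1) - 2 * k - 1) \<and>
        (\<forall>(S :: (real ^ 'n) set) U.
           card S = tverberg_number (2 * R) (2 * k + 1) - 2 * k - 1 \<and> generic_points S \<and>
           (\<forall>i<k. coordinate_plane (U i)) \<and> pairwise_orthogonal k U \<longrightarrow>
           (\<exists>A. polytope_partition (segment_multiprisms_parallel k r U) (2 * R) S A)))"
proof (intro conjI impI)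
  have R2: "R \<ge> 2" using prod_ge_two[OF assms(1,2)] assms(3) by simp
  {
    \<comment> \<open>Both claims are proved for fixed axes: the bound then takes arbitrary axes,
      the generic claim those of the given planes.\<close>
    fix \<alpha> \<beta> :: "nat \<Rightarrow> 'm"
    assume card: "CARD('m) = 2 * k"
      and axes: "inj_on \<alpha> {..<k}" "inj_on \<beta> {..<k}" "\<alpha> ` {..<k} \<inter> \<beta> ` {..<k} = {}"
    interpret coordinate_split k 0 r \<alpha> \<beta>
      by (rule coordinate_split_even[OF card assms(2) axes])
    have cG: "card G = R" using card_G assms(3) by simp
    have tot: "total = tverberg_number R (2 * k) - 2 * k"
      unfolding total_def cG using tverberg_number_diff[OF R2, of "2 * k"] by simp
    have "AE X in PiM {..<tverberg_number R (2 * k) - 2 * k} (\<lambda>_. lborel :: (real ^ 'm) measure).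
        \<exists>A. polytope_partition (multiprisms k r) R (X ` {..<tverberg_number R (2 * k) - 2 * k}) A"
      unfolding tot[symmetric] using AE_partition[of r "\<lambda>i. span {axis (\<alpha> i) 1, axis (\<beta> i) 1}", OF refl refl]
      unfolding cG
    proof eventually_elim
      case (elim X)
      then show ?case
        using polytope_partition_mono[of _ R "X ` {..<total}" _ "multiprisms k r"]
        unfolding multiprisms_def by blast
    qed
    moreover have "\<exists>A. polytope_partition (multiprisms_parallel k r U) R S A"
      if "card S = tverberg_number R (2 * k) - 2 * k" "generic_points S"
        "\<And>i. i < k \<Longrightarrow> U i = span {axis (\<alpha> i) 1, axis (\<beta> i) 1}" for S U
      using generic_partition(1)[of S r U, OF _ that(2) refl that(3) refl] that(1) unfolding tot cG by blast
    ultimately have "AE X in PiM {..<tverberg_number R (2 * k) - 2 * k} (\<lambda>_. lborel :: (real ^ 'm) measure).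
        \<exists>A. polytope_partition (multiprisms k r) R (X ` {..<tverberg_number R (2 * k) - 2 * k}) A"
      "\<And>S U. card S = tverberg_number R (2 * k) - 2 * k \<Longrightarrow> generic_points S \<Longrightarrow>
        (\<And>i. i < k \<Longrightarrow> U i = span {axis (\<alpha> i) 1, axis (\<beta> i) 1}) \<Longrightarrow>
        \<exists>A. polytope_partition (multiprisms_parallel k r U) R S A"
      by blast+
  }
  note even = this
  show "partition_number (multiprisms k r :: (real ^ 'm) set set) R
      \<le> enat (tverberg_number R (2 * k) - 2 * k)" if card: "CARD('m) = 2 * k"
  proof -
    obtain \<alpha> \<beta> :: "nat \<Rightarrow> 'm" where "inj_on \<alpha> {..<k}" "inj_on \<beta> {..<k}" "\<alpha> ` {..<k} \<inter> \<beta> ` {..<k} = {}"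
      using exists_axes[of k, where 'n = 'm] card by auto
    from even(1)[OF card this] show ?thesis by (rule partition_number_le)
  qed
  show "\<forall>(S :: (real ^ 'm) set) U.
      card S = tverberg_number R (2 * k) - 2 * k \<and> generic_points S \<and>
      (\<forall>i<k. coordinate_plane (U i)) \<and> pairwise_orthogonal k U \<and> span (\<Union>i<k. U i) = UNIV \<longrightarrow>
      (\<exists>A. polytope_partition (multiprisms_parallel k r U) R S A)" if card: "CARD('m) = 2 * k"
  proof (intro allI impI, elim conjE)
    fix S :: "(real ^ 'm) set" and U :: "nat \<Rightarrow> (real ^ 'm) set"
    assume S: "card S = tverberg_number R (2 * k) - 2 * k" "generic_points S"
      and U: "\<forall>i<k. coordinate_plane (U i)" "pairwise_orthogonal k U"
    obtain \<alpha> \<beta> where *: "\<forall>i<k. U i = span {axis (\<alpha> i) 1, axis (\<beta> i) 1}"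
      "inj_on \<alpha> {..<k}" "inj_on \<beta> {..<k}" "\<alpha> ` {..<k} \<inter> \<beta> ` {..<k} = {}"
      using coordinate_planes_axes[OF U] by blast
    show "\<exists>A. polytope_partition (multiprisms_parallel k r U) R S A"
      by (rule even(2)[OF card *(2-4) S]) (use *(1) in blast)
  qed
  have R2': "2 * R \<ge> 2" using R2 by simp
  {
    fix \<alpha> \<beta> :: "nat \<Rightarrow> 'n"
    assume card: "CARD('n) = 2 * k + 1"
      and axes: "inj_on \<alpha> {..<k}" "inj_on \<beta> {..<k}" "\<alpha> ` {..<k} \<inter> \<beta> ` {..<k} = {}"
    obtain \<gamma> where split: "coordinate_split k 1 (r(k := 2)) (\<alpha>(k := \<gamma>)) \<beta>"
      using coordinate_split_odd[OF card assms(2) axes] by blast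
    interpret coordinate_split k 1 "r(k := 2)" "\<alpha>(k := \<gamma>)" \<beta>
      by (rule split)
    have "(\<Prod>j<k. (r(k := 2)) j) = R"
      unfolding assms(3) by (intro prod.cong) auto
    then have cG: "card G = 2 * R" using card_G by (simp only: Suc_eq_plus1[symmetric] prod.lessThan_Suc fun_upd_same mult.commute)
    have tot: "total = tverberg_number (2 * R) (2 * k + 1) - 2 * k - 1"
      unfolding total_def cG using tverberg_number_diff[OF R2', of "2 * k + 1"] by simp
    have ax: "span {axis (\<alpha> i) 1, axis (\<beta> i) 1 :: real ^ 'n} = span {axis ((\<alpha>(k := \<gamma>)) i) 1, axis (\<beta> i) 1}"
      if "i < k" for i using that by simp
    have rq: "r i = (r(k := 2)) i" if "i < k" for i using that by simp
    have ae: "AE X in PiM {..<total} (\<lambda>_. lborel). \<exists>A. polytope_partition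
        (segment_multiprisms_parallel k r (\<lambda>i. span {axis (\<alpha> i) 1, axis (\<beta> i) 1})) (card G) (X ` {..<total}) A"
      using AE_partition[of r "\<lambda>i. span {axis (\<alpha> i) 1, axis (\<beta> i) 1}", OF rq ax] by simp
    have "AE X in PiM {..<tverberg_number (2 * R) (2 * k + 1) - 2 * k - 1} (\<lambda>_. lborel :: (real ^ 'n) measure).
        \<exists>A. polytope_partition (segment_multiprisms k r) (2 * R) (X ` {..<tverberg_number (2 * R) (2 * k + 1) - 2 * k - 1}) A"
      unfolding tot[symmetric]
      using ae unfolding cG
    proof eventually_elim
      case (elim X)
      then show ?case
        using polytope_partition_mono[of _ "2 * R" "X ` {..<total}" _ "segment_multiprisms k r"]
        unfolding segment_multiprisms_def by blast
    qed
    moreover have "\<exists>A. polytope_partition (segment_multiprisms_parallel k r U) (2 * R) S A"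
      if S: "card S = tverberg_number (2 * R) (2 * k + 1) - 2 * k - 1" "generic_points S"
        and U: "\<And>i. i < k \<Longrightarrow> U i = span {axis (\<alpha> i) 1, axis (\<beta> i) 1}" for S U
    proof -
      have "U i = span {axis ((\<alpha>(k := \<gamma>)) i) 1, axis (\<beta> i) 1}" if "i < k" for i
        using U[OF that] ax[OF that] by simp
      from generic_partition(2)[of S r U, OF _ S(2) rq this refl]
      show ?thesis using S(1) unfolding tot cG by blast
    qed
    ultimately have "AE X in PiM {..<tverberg_number (2 * R) (2 * k + 1) - 2 * k - 1} (\<lambda>_. lborel :: (real ^ 'n) measure).
        \<exists>A. polytope_partition (segment_multiprisms k r) (2 * R) (X ` {..<tverberg_number (2 * R) (2 * k + 1) - 2 * k - 1}) A"
      "\<And>S U. card S = tverberg_number (2 * R) (2 * k + 1) - 2 * k - 1 \<Longrightarrow> generic_points S \<Longrightarrow>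
        (\<And>i. i < k \<Longrightarrow> U i = span {axis (\<alpha> i) 1, axis (\<beta> i) 1}) \<Longrightarrow>
        \<exists>A. polytope_partition (segment_multiprisms_parallel k r U) (2 * R) S A"
      by blast+
  }
  note odd = this
  show "partition_number (segment_multiprisms k r :: (real ^ 'n) set set) (2 * R)
      \<le> enat (tverberg_number (2 * R) (2 * k + 1) - 2 * k - 1)" if card: "CARD('n) = 2 * k + 1"
  proof -
    obtain \<alpha> \<beta> :: "nat \<Rightarrow> 'n" where "inj_on \<alpha> {..<k}" "inj_on \<beta> {..<k}" "\<alpha> ` {..<k} \<inter> \<beta> ` {..<k} = {}"
      using exists_axes[of k, where 'n = 'n] card by auto
    from odd(1)[OF card this] show ?thesis by (rule partition_number_le)
  qed
  show "\<forall>(S :: (real ^ 'n) set) U.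
      card S = tverberg_number (2 * R) (2 * k + 1) - 2 * k - 1 \<and> generic_points S \<and>
      (\<forall>i<k. coordinate_plane (U i)) \<and> pairwise_orthogonal k U \<longrightarrow>
      (\<exists>A. polytope_partition (segment_multiprisms_parallel k r U) (2 * R) S A)" if card: "CARD('n) = 2 * k + 1"
  proof (intro allI impI, elim conjE)
    fix S :: "(real ^ 'n) set" and U :: "nat \<Rightarrow> (real ^ 'n) set"
    assume S: "card S = tverberg_number (2 * R) (2 * k + 1) - 2 * k - 1" "generic_points S"
      and U: "\<forall>i<k. coordinate_plane (U i)" "pairwise_orthogonal k U"
    obtain \<alpha> \<beta> where *: "\<forall>i<k. U i = span {axis (\<alpha> i) 1, axis (\<beta> i) 1}"
      "inj_on \<alpha> {..<k}" "inj_on \<beta> {..<k}" "\<alpha> ` {..<k} \<inter> \<beta> ` {..<k} = {}"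
      using coordinate_planes_axes[OF U] by blast
    show "\<exists>A. polytope_partition (segment_multiprisms_parallel k r U) (2 * R) S A"
      by (rule odd(2)[OF card *(2-4) S]) (use *(1) in blast)
  qed
qed

end
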